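(* Let $M$ be a Polish space, $l$ a not necessarily finite measure on $M$, and let $V:M\to(-\infty,\infty]$ and $G:M\times M\to(-\infty,\infty]$ be lower semicontinuous with $G$ symmetric. Define $$H_n(x_1,\dots,x_n)=\sum_{1\le i<j\le n}G(x_i,x_j)+n\sum_{i=1}^nV(x_i),\qquad W(\mu)=\frac12\int_{M\times M}\big(G(x,y)+V(x)+V(y)\big)\,d\mu(x)d\mu(y)$$ for $(x_1,\dots,x_n)\in M^n$, $\mu\in\mathcal P(M)$, and let $d\gamma_n=e^{-H_n}\,dl^{\otimes n}$ (the case $\beta_n=n$ of $d\gamma_n=e^{-\frac{\beta_n}nH_n}dl^{\otimes n}$). Suppose that: (1) $\int_Me^{-V}\,dl<\infty$; (2) the function $(x,y)\mapsto G(x,y)+V(x)+V(y)$ is bounded from below; (3) $G(x,y)+V(x)+V(y)\to\infty$ when $x,y\to\infty$ at the same time; (4) for every $\mu\in\mathcal P(M)$ with $W(\mu)<\infty$ there exists a sequence $\{\mu_n\}_{n\in\mathbb N}$ of probability measures absolutely continuous with respect to $l$ such that $\mu_n\to\mu$ and $W(\mu_n)\to W(\mu)$. Then for every bounded continuous function $f:\mathcal P(M)\to\mathbb R$, $$\frac1{n^2}\log\int_{M^n}e^{-n^2f\circ i_n}\,d\gamma_n\ \xrightarrow[n\to\infty]{}\ -\inf_{\mu\in\mathcal P(M)}\{f(\mu)+W(\mu)\}.$$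
   Context: $\mathcal P(M)$ is the space of Borel probability measures on $M$ with the weak topology; $i_n(x_1,\dots,x_n)=\frac1n\sum_{i=1}^n\delta_{x_i}$. "$h(x,y)\to\infty$ when $x,y\to\infty$ at the same time" means: for every $C\in\mathbb R$ there is a compact set $K\subset M$ such that $h\ge C$ on $K^c\times K^c$. *)

theory Defs
  imports "HOL-Probability.Probability"
begin

definition prob_measures :: "'a::topological_space measure set" where
  "prob_measures = {\<mu>. prob_space \<mu> \<and> sets \<mu> = sets borel}"

text \<open>The coarsest topology on the Borel probability measures for which integration against every
  bounded continuous function is continuous.\<close>

definition weak_topology :: "'a::topological_space measure topology" where
  "weak_topology = topology_generated_by
     {{\<mu> \<in> prob_measures. (LINT x|\<mu>. g x) \<in> U} | (g :: 'a \<Rightarrow> real) (U :: real set).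
        continuous_on UNIV g \<and> bounded (range g) \<and> open U}"

lemma topspace_weak_topology [simp]: "topspace weak_topology = prob_measures"
proof -
  have "prob_measures \<in> {{\<mu> \<in> prob_measures. (LINT x|\<mu>. g x) \<in> U} | (g :: 'a \<Rightarrow> real) (U :: real set).
        continuous_on UNIV g \<and> bounded (range g) \<and> open U}"
    by (rule CollectI, rule exI[of _ "\<lambda>_. 0"], rule exI[of _ UNIV]) auto
  then show ?thesis
    unfolding weak_topology_def topology_generated_by_topspace by blast
qed

definition lower_semicontinuous :: "('a::topological_space \<Rightarrow> ereal) \<Rightarrow> bool" where
  "lower_semicontinuous f \<longleftrightarrow> (\<forall>c. open {x. c < f x})"

definition exp_ereal :: "ereal \<Rightarrow> ennreal" where
  "exp_ereal x = (case x of ereal r \<Rightarrow> ennreal (exp r) | PInfty \<Rightarrow> \<infinity> | MInfty \<Rightarrow> 0)"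

definition ln_ennreal :: "ennreal \<Rightarrow> ereal" where
  "ln_ennreal z = (if z = 0 then -\<infinity> else if z = \<infinity> then \<infinity> else ereal (ln (enn2real z)))"

text \<open>Integral of an extended real function as positive minus negative part (\<^const>\<open>e2ennreal\<close>
  truncates negative values to \<open>0\<close>). It is meaningful if one of the two parts is finite, for instance
  if \<open>f\<close> is bounded from below and \<open>M\<close> is finite.\<close>

definition ereal_integral :: "'a measure \<Rightarrow> ('a \<Rightarrow> ereal) \<Rightarrow> ereal" where
  "ereal_integral M f =
     enn2ereal (\<integral>\<^sup>+ x. e2ennreal (f x) \<partial>M) - enn2ereal (\<integral>\<^sup>+ x. e2ennreal (- f x) \<partial>M)"

text \<open>Points of \<open>M\<^sup>n\<close> are functions on the index set \<open>{1..n}\<close>.\<close>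

definition empirical_measure :: "nat \<Rightarrow> (nat \<Rightarrow> 'a) \<Rightarrow> 'a::topological_space measure" where
  "empirical_measure n x = measure_of UNIV (sets borel)
     (\<lambda>A. (\<Sum>i=1..n. emeasure (return borel (x i)) A) / of_nat n)"

lemma sets_empirical_measure [simp]: "sets (empirical_measure n x) = sets borel"
  unfolding empirical_measure_def using sets.sigma_sets_eq[of borel] by simp

lemma emeasure_empirical_measure:
  fixes x :: "nat \<Rightarrow> 'a::topological_space"
  assumes A: "A \<in> sets borel"
  shows "emeasure (empirical_measure n x) A = (\<Sum>i=1..n. indicator A (x i)) / of_nat n"
proof -
  let ?m = "\<lambda>A. (\<Sum>i=1..n. emeasure (return borel (x i)) A) / of_nat n"
  have "countably_additive (sets (borel :: 'a measure)) ?m"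
  proof (rule countably_additiveI)
    fix B :: "nat \<Rightarrow> 'a set"
    assume B: "range B \<subseteq> sets borel" "disjoint_family B"
    have "(\<Sum>k. ?m (B k)) = (\<Sum>k. \<Sum>i=1..n. emeasure (return borel (x i)) (B k)) / of_nat n"
      by (simp add: divide_ennreal_def)
    also have "\<dots> = (\<Sum>i=1..n. \<Sum>k. emeasure (return borel (x i)) (B k)) / of_nat n"
      by (subst suminf_sum) simp_all
    also have "\<dots> = ?m (\<Union>(range B))"
      using B by (intro arg_cong2[where f = "(/)"] sum.cong refl suminf_emeasure) simp_all
    finally show "(\<Sum>k. ?m (B k)) = ?m (\<Union>(range B))" .
  qed
  moreover have "positive (sets (borel :: 'a measure)) ?m"
    by (simp add: positive_def)
  ultimately have "emeasure (empirical_measure n x) A = ?m A"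
    unfolding empirical_measure_def
    using A sets.sigma_algebra_axioms[of "borel :: 'a measure"]
    by (intro emeasure_measure_of_sigma) simp_all
  with A show ?thesis by simp
qed

lemma empirical_measure_in_prob_measures:
  assumes "n > 0"
  shows "empirical_measure n x \<in> prob_measures"
proof -
  have "space (empirical_measure n x) = UNIV"
    by (metis sets_eq_imp_space_eq sets_empirical_measure space_borel)
  then have "emeasure (empirical_measure n x) (space (empirical_measure n x)) = 1"
    using assms by (simp add: emeasure_empirical_measure ennreal_divide_self less_top[symmetric])
  then show ?thesis
    by (simp add: prob_measures_def prob_spaceI)
qed

definition hamiltonian ::
    "('a \<Rightarrow> 'a \<Rightarrow> ereal) \<Rightarrow> ('a \<Rightarrow> ereal) \<Rightarrow> nat \<Rightarrow> (nat \<Rightarrow> 'a) \<Rightarrow> ereal" where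
  "hamiltonian G V n x =
     (\<Sum>(i, j) | 1 \<le> i \<and> i < j \<and> j \<le> n. G (x i) (x j)) + ereal (real n) * (\<Sum>i=1..n. V (x i))"

definition energy ::
    "('a \<Rightarrow> 'a \<Rightarrow> ereal) \<Rightarrow> ('a \<Rightarrow> ereal) \<Rightarrow> 'a measure \<Rightarrow> ereal" where
  "energy G V \<mu> = ereal (1/2) * ereal_integral (\<mu> \<Otimes>\<^sub>M \<mu>) (\<lambda>(x, y). G x y + V x + V y)"

text \<open>No \<open>\<sigma>\<close>-finiteness of \<open>l\<close> is required: for finite index sets \<^const>\<open>PiM\<close> always picks a measure
  with \<open>l\<^sup>\<otimes>\<^sup>n(A\<^sub>1 \<times> \<dots> \<times> A\<^sub>n) = l(A\<^sub>1) \<cdots> l(A\<^sub>n)\<close>. If \<open>\<integral> e\<^sup>-\<^sup>V dl < \<infinity>\<close> and \<open>G > -\<infinity>\<close>, the choice does not affect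
  \<open>gibbs_measure\<close>, because the density vanishes off \<open>{V < \<infinity>}\<^sup>n\<close> and \<open>l\<close> is \<open>\<sigma>\<close>-finite on \<open>{V < \<infinity>}\<close>.\<close>

definition gibbs_measure ::
    "'a measure \<Rightarrow> ('a \<Rightarrow> 'a \<Rightarrow> ereal) \<Rightarrow> ('a \<Rightarrow> ereal) \<Rightarrow> nat \<Rightarrow> (nat \<Rightarrow> 'a) measure" where
  "gibbs_measure l G V n =
     density (PiM {1..n} (\<lambda>_. l)) (\<lambda>x. exp_ereal (- hamiltonian G V n x))"

end

theory Submission
  imports Defs "HOL-Real_Asymp.Real_Asymp"
begin

text \<open>Put \<open>g(x, y) = G(x, y) + V(x) + V(y) \<ge> -d\<close> and \<open>m = e\<^sup>-\<^sup>V l\<close>, a finite measure. Since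
  \<open>n \<Sum>\<^sub>i V(x\<^sub>i) = \<Sum>\<^sub>i\<^sub><\<^sub>j (V(x\<^sub>i) + V(x\<^sub>j)) + \<Sum>\<^sub>i V(x\<^sub>i)\<close>, the Gibbs measure is
  \<open>exp (-\<Sum>\<^sub>i\<^sub><\<^sub>j g(x\<^sub>i, x\<^sub>j)) m\<^sup>\<otimes>\<^sup>n\<close>.

  Upper bound: \<open>m\<^sup>\<otimes>\<^sup>n\<close> has mass \<open>exp (O(n))\<close>, so it suffices to bound \<open>f(i\<^sub>n(x)) + n\<^sup>-\<^sup>2 \<Sum>\<^sub>i\<^sub><\<^sub>j g\<close> from below
  uniformly in \<open>x\<close>. Empirical measures of bounded energy are tight because \<open>g\<close> is confining, so they have
  weak limit points, at which \<open>W\<close> is lower semicontinuous.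

  Lower bound: by regularity and by restricting a measure to a set on which its density with respect to \<open>m\<close>
  is bounded, it suffices to consider \<open>\<mu> \<le> R m\<close>. Then \<open>m\<^sup>\<otimes>\<^sup>n \<ge> R\<^sup>-\<^sup>n \<mu>\<^sup>\<otimes>\<^sup>n\<close>, under \<open>\<mu>\<^sup>\<otimes>\<^sup>n\<close> the empirical
  measure is close to \<open>\<mu>\<close> with probability tending to 1, and by Markov's inequality the pair energy is at
  most slightly above its mean with probability bounded away from 0.\<close>

section \<open>Prokhorov compactness\<close>

text \<open>At speed n^2 every error of order n in the exponent is harmless, so crude estimates of
  product measures suffice. The difficulties lie elsewhere. The measure i_n(x) \<otimes> i_n(x)
  charges the diagonal, which H_n omits and on which G may be infinite. The energy is therefore
  bounded through \<open>min q C\<close>, with C fixed while n grows; C tends to infinity only at a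
  limit measure. Since l may fail to be sigma-finite, the usual product theory applies only after
  restriction to the set where e^-V is positive, and products of l itself are controlled on boxes.
  The function x \<mapsto> f (i_n x) is never shown to be measurable: it is squeezed between
  functions of a measurable set and of the total cost, and \<open>nn_integral\<close> is monotone
  for arbitrary functions. Finally, limits are taken along filters. The weak topology is given by a
  subbase, and a finer filter plays the part of a convergent subsequence.\<close>

lemma compact_in_countable_Union_decomp:
  fixes K :: "'a::metric_space set" and U :: "'i \<Rightarrow> 'a set"
  assumes "compact K" and op: "\<And>i. open (U i)" and sub: "K \<subseteq> (\<Union>i. U i)"
  obtains I C where "finite I" "\<And>i. compact (C i)" "\<And>i. C i \<subseteq> U i" "K = (\<Union>i\<in>I. C i)"
proof -
  have "\<exists>i e. 0 < e \<and> cball x e \<subseteq> U i" if "x \<in> K" for x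
  proof -
    obtain i where "x \<in> U i" using sub \<open>x \<in> K\<close> by blast
    then show ?thesis using op[of i] unfolding open_contains_cball by blast
  qed
  then obtain i e where ie: "\<And>x. x \<in> K \<Longrightarrow> 0 < e x \<and> cball x (e x) \<subseteq> U (i x)"
    by metis
  have "K \<subseteq> (\<Union>x\<in>K. ball x (e x))" using ie by fastforce
  then obtain T where T: "T \<subseteq> K" "finite T" "K \<subseteq> (\<Union>x\<in>T. ball x (e x))"
    using compactE_image[OF \<open>compact K\<close>, of K "\<lambda>x. ball x (e x)"] by auto
  \<comment> \<open>Closed balls keep the pieces compact. Grouping the finitely many balls by their
    chosen index puts each group inside one \<open>U j\<close>; an index without balls gets the
    empty set.\<close>
  define C where "C j = (\<Union>x\<in>{x\<in>T. i x = j}. K \<inter> cball x (e x))" for j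
  show ?thesis
  proof (rule that[of "i ` T" C])
    show "finite (i ` T)" using T by simp
    show "compact (C j)" for j
      unfolding C_def using T \<open>compact K\<close> by (intro compact_UN compact_Int_closed) auto
    show "C j \<subseteq> U j" for j
      using ie T by (fastforce simp: C_def)
    show "K = (\<Union>j\<in>i ` T. C j)"
      using T by (fastforce simp: C_def)
  qed
qed

text \<open>Halmos's construction: \<open>b\<close> is the inner content of open sets,
  \<open>out\<close> its outer measure, and Caratheodory's theorem applies once closed sets are seen
  to split every set. Only the values on open sets are recorded; on a compact set the measure may
  differ from \<open>L\<close>.\<close>

lemma compact_content_extends_to_measure:
  fixes L :: "'a::metric_space set \<Rightarrow> ennreal"
  assumes L0: "L {} = 0"
    and mono: "\<And>K K'. compact K \<Longrightarrow> compact K' \<Longrightarrow> K \<subseteq> K' \<Longrightarrow> L K \<le> L K'"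
    and sub: "\<And>K K'. compact K \<Longrightarrow> compact K' \<Longrightarrow> L (K \<union> K') \<le> L K + L K'"
    and disj: "\<And>K K'. compact K \<Longrightarrow> compact K' \<Longrightarrow> K \<inter> K' = {} \<Longrightarrow> L K + L K' \<le> L (K \<union> K')"
  obtains \<nu> :: "'a measure" where "sets \<nu> = sets borel"
    "\<And>U. open U \<Longrightarrow> emeasure \<nu> U = (SUP K\<in>{K. compact K \<and> K \<subseteq> U}. L K)"
proof -
  define b where "b U = (SUP K\<in>{K. compact K \<and> K \<subseteq> U}. L K)" for U
  define out where "out A = (INF U\<in>{U. open U \<and> A \<subseteq> U}. b U)" for A
  have b_mono: "b U \<le> b W" if "U \<subseteq> W" for U W
    unfolding b_def using that by (intro SUP_subset_mono) auto
  have b_upper: "L K \<le> b U" if "compact K" "K \<subseteq> U" for K U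
    unfolding b_def using that by (intro SUP_upper) auto
  have out_open: "out U = b U" if "open U" for U
    unfolding out_def using that by (intro antisym INF_lower INF_greatest b_mono) auto
  have out_mono: "out A \<le> out B" if "A \<subseteq> B" for A B
    unfolding out_def using that by (intro INF_superset_mono) auto
  have out_le: "out A \<le> b U" if "open U" "A \<subseteq> U" for A U
    unfolding out_def using that by (intro INF_lower) auto
  have L_finite: "L (\<Union>i\<in>I. C i) \<le> (\<Sum>i\<in>I. L (C i))" if "finite I" "\<And>i. compact (C i)"
    for I and C :: "nat \<Rightarrow> 'a set"
    using that
  proof (induction I rule: finite_induct)
    case (insert i I)
    have "L (C i \<union> (\<Union>i\<in>I. C i)) \<le> L (C i) + L (\<Union>i\<in>I. C i)"
      using insert by (intro sub compact_UN) auto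
    also have "\<dots> \<le> L (C i) + (\<Sum>i\<in>I. L (C i))"
      using insert by (intro add_left_mono) auto
    finally show ?case using insert by simp
  qed (simp add: L0)
  have b_csub: "b (\<Union>i. U i) \<le> (\<Sum>i. b (U i))" if "\<And>i. open (U i)" for U :: "nat \<Rightarrow> 'a set"
    unfolding b_def[of "\<Union>i. U i"]
  proof (rule SUP_least)
    fix K assume "K \<in> {K. compact K \<and> K \<subseteq> (\<Union>i. U i)}"
    then have "compact K" "K \<subseteq> (\<Union>i. U i)" by auto
    from compact_in_countable_Union_decomp[OF this(1) that this(2)]
    obtain I C where C: "finite I" "\<And>i. compact (C i)" "\<And>i. C i \<subseteq> U i" "K = (\<Union>i\<in>I. C i)"
      by blast
    have "L K \<le> (\<Sum>i\<in>I. L (C i))" using C L_finite by simp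
    also have "\<dots> \<le> (\<Sum>i\<in>I. b (U i))" using C by (intro sum_mono b_upper)
    also have "\<dots> \<le> (\<Sum>i. b (U i))" using C by (intro sum_le_suminf) auto
    finally show "L K \<le> (\<Sum>i. b (U i))" .
  qed
  have out_csub: "out (\<Union>i. A i) \<le> (\<Sum>i. out (A i))" for A :: "nat \<Rightarrow> 'a set"
  proof (rule ennreal_le_epsilon)
    fix e :: real assume fin: "(\<Sum>i. out (A i)) < top" and "0 < e"
    have "\<exists>U. open U \<and> A i \<subseteq> U \<and> b U \<le> out (A i) + ennreal (e * (1/2) ^ Suc i)" for i
    proof -
      have "out (A i) < top"
        using fin by (metis ennreal_suminf_lessD)
      then have "out (A i) < out (A i) + ennreal (e * (1/2) ^ Suc i)"
        using \<open>0 < e\<close> ennreal_add_left_cancel_less[of "out (A i)" 0 "ennreal (e * (1/2) ^ Suc i)"]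
        by (simp add: less_top)
      then show ?thesis
        unfolding out_def[of "A i"] INF_less_iff by (auto intro: less_imp_le)
    qed
    then obtain U where U: "\<And>i. open (U i)" "\<And>i. A i \<subseteq> U i"
        "\<And>i. b (U i) \<le> out (A i) + ennreal (e * (1/2) ^ Suc i)"
      by metis
    have "out (\<Union>i. A i) \<le> b (\<Union>i. U i)"
      using U by (intro out_le) auto
    also have "\<dots> \<le> (\<Sum>i. b (U i))" by (rule b_csub) (rule U)
    also have "\<dots> \<le> (\<Sum>i. out (A i) + ennreal (e * (1/2) ^ Suc i))"
      by (intro suminf_le U) auto
    also have "\<dots> = (\<Sum>i. out (A i)) + (\<Sum>i. ennreal (e * (1/2) ^ Suc i))"
      by (rule suminf_add[symmetric]) auto
    also have "(\<Sum>i. ennreal (e * (1/2) ^ Suc i)) = ennreal e"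
      using sums_mult[OF power_half_series, of e] \<open>0 < e\<close>
      by (subst suminf_ennreal2) (auto simp: sums_iff)
    finally show "out (\<Union>i. A i) \<le> (\<Sum>i. out (A i)) + ennreal e" .
  qed
  have out_empty: "out {} = 0"
  proof -
    have "{K. compact K \<and> K \<subseteq> ({}::'a set)} = {{}}" by auto
    then show ?thesis using out_open[of "{}"] by (simp add: b_def L0)
  qed
  have oms: "outer_measure_space (Pow UNIV) out"
    unfolding outer_measure_space_def positive_def increasing_def countably_subadditive_def
    using out_empty out_mono out_csub by auto
  have ms: "measure_space UNIV (lambda_system UNIV (Pow UNIV) out) out"
    by (rule sigma_algebra.caratheodory_lemma[OF sigma_algebra_Pow oms])
  have sa: "sigma_algebra UNIV (lambda_system UNIV (Pow UNIV) out)"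
    using ms by (simp add: measure_space_def)
  have out_sub2: "out (A \<union> B) \<le> out A + out B" for A B
  proof -
    have "out (\<Union>i. if i = 0 then A else if i = Suc 0 then B else {})
          \<le> (\<Sum>i. out (if i = 0 then A else if i = Suc 0 then B else {}))"
      by (rule out_csub)
    also have "\<dots> = (\<Sum>i\<in>{0, Suc 0}. out (if i = 0 then A else if i = Suc 0 then B else {}))"
      by (rule suminf_finite) (auto simp: out_empty)
    also have "(\<Union>i. if i = 0 then A else if i = Suc 0 then B else {}) = A \<union> B"
      by (auto split: if_splits)
    finally show ?thesis by simp
  qed
  \<comment> \<open>Instead of \<open>U - F\<close>, remove a compact \<open>K\<close> inside it.
    Then \<open>U - K\<close> is open and still contains \<open>U \<inter> F\<close>, and every
    compact subset of it is disjoint from \<open>K\<close>, so additivity on disjoint compact sets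
    applies. The suprema over both compact sets give the claim.\<close>
  have open_split: "out (U \<inter> F) + b (U - F) \<le> b U" if U: "open U" and F: "closed F" for U F
  proof -
    have *: "out (U \<inter> F) + L K \<le> b U" if K: "compact K" "K \<subseteq> U - F" for K
    proof -
      have "open (U - K)" using U K compact_imp_closed by blast
      then have "out (U \<inter> F) + L K \<le> b (U - K) + L K"
        using K by (intro add_right_mono out_le) auto
      also have "\<dots> = (SUP K'\<in>{K'. compact K' \<and> K' \<subseteq> U - K}. L K' + L K)"
        unfolding b_def by (rule ennreal_SUP_add_left[symmetric]) auto
      also have "\<dots> \<le> b U"
      proof (rule SUP_least)
        fix K' assume K': "K' \<in> {K'. compact K' \<and> K' \<subseteq> U - K}"
        then have "L K' + L K \<le> L (K' \<union> K)" using K by (intro disj) auto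
        also have "\<dots> \<le> b U" using K K' by (intro b_upper) auto
        finally show "L K' + L K \<le> b U" .
      qed
      finally show ?thesis .
    qed
    have "out (U \<inter> F) + b (U - F) = (SUP K\<in>{K. compact K \<and> K \<subseteq> U - F}. out (U \<inter> F) + L K)"
      unfolding b_def by (rule ennreal_SUP_add_right) auto
    also have "\<dots> \<le> b U" using * by (intro SUP_least) auto
    finally show ?thesis .
  qed
  have closed_in: "F \<in> lambda_system UNIV (Pow UNIV) out" if F: "closed F" for F
  proof -
    have "out (F \<inter> A) + out ((UNIV - F) \<inter> A) = out A" for A
    proof (rule antisym)
      have "out A = out ((F \<inter> A) \<union> ((UNIV - F) \<inter> A))"
        by (rule arg_cong[where f = out]) auto
      then show "out A \<le> out (F \<inter> A) + out ((UNIV - F) \<inter> A)"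
        using out_sub2[of "F \<inter> A" "(UNIV - F) \<inter> A"] by simp
      show "out (F \<inter> A) + out ((UNIV - F) \<inter> A) \<le> out A"
        unfolding out_def[of A]
      proof (rule INF_greatest)
        fix U assume U: "U \<in> {U. open U \<and> A \<subseteq> U}"
        have "out (F \<inter> A) + out ((UNIV - F) \<inter> A) \<le> out (U \<inter> F) + out (U - F)"
          using U by (intro add_mono out_mono) auto
        also have "out (U - F) = b (U - F)" using U F by (intro out_open) auto
        also have "out (U \<inter> F) + b (U - F) \<le> b U" using U F by (intro open_split) auto
        finally show "out (F \<inter> A) + out ((UNIV - F) \<inter> A) \<le> b U" .
      qed
    qed
    then show ?thesis by (simp add: lambda_system_def)
  qed
  have borel_in: "sets borel \<subseteq> lambda_system UNIV (Pow UNIV) out"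
    unfolding borel_eq_closed sets_measure_of_conv
    using closed_in sigma_algebra.sigma_sets_subset[OF sa, of "Collect closed"] by auto
  have ms': "measure_space UNIV (sets borel) out"
    using measure_down[OF ms _ borel_in] sets.sigma_algebra_axioms[of borel] by simp
  define \<nu> where "\<nu> = measure_of UNIV (sets borel) out"
  have sets\<nu>: "sets \<nu> = sets borel"
    unfolding \<nu>_def using sets.sigma_sets_eq[of borel] by simp
  have "emeasure \<nu> A = out A" if "A \<in> sets borel" for A
    using ms' that unfolding \<nu>_def measure_space_def
    by (intro emeasure_measure_of_sigma) auto
  then show ?thesis
    using that[OF sets\<nu>] out_open unfolding b_def by simp
qed

text \<open>The open-set criterion of the portmanteau theorem. It is used as the notion of
  convergence because the content construction yields it directly and because, being one-sided, it
  passes to lower semicontinuous integrands and to products.\<close>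

definition open_liminf_ge :: "('i \<Rightarrow> 'b::topological_space measure) \<Rightarrow> 'b measure \<Rightarrow> 'i filter \<Rightarrow> bool" where
  "open_liminf_ge \<mu> \<nu> F \<longleftrightarrow>
     (\<forall>U e. open U \<longrightarrow> 0 < e \<longrightarrow> (\<forall>\<^sub>F i in F. measure \<nu> U - e < measure (\<mu> i) U))"

text \<open>By Tychonoff's theorem the measures of all sets converge simultaneously along a finer filter; the
  limit set function need not be countably additive, but its values on compact sets form a content.\<close>

lemma tight_imp_cluster_measure:
  fixes \<mu> :: "'i \<Rightarrow> 'a::metric_space measure" and F :: "'i filter"
  assumes F: "F \<noteq> bot"
    and prob: "\<And>i. prob_space (\<mu> i)" and sets\<mu>: "\<And>i. sets (\<mu> i) = sets borel"
    and tight: "\<And>e::real. 0 < e \<Longrightarrow> \<exists>K. compact K \<and> (\<forall>\<^sub>F i in F. 1 - e \<le> measure (\<mu> i) K)"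
  obtains \<nu> :: "'a measure" and F' where "F' \<le> F" "F' \<noteq> bot" "prob_space \<nu>" "sets \<nu> = sets borel"
    "open_liminf_ge \<mu> \<nu> F'"
proof -
  define \<Phi> where "\<Phi> i = (\<lambda>A. measure (\<mu> i) A)" for i
  define S where "S = PiE UNIV (\<lambda>_::'a set. {0..1::real})"
  have comp: "compact S"
    using compactin_PiE[of "\<lambda>_::'a set. euclidean::real topology" UNIV "\<lambda>_. {0..1}"]
    by (simp add: S_def euclidean_product_topology)
  have inS: "\<Phi> i \<in> S" for i
    unfolding S_def \<Phi>_def using prob_space.prob_le_1[OF prob] by (auto simp: PiE_def)
  have "filtermap \<Phi> F \<noteq> bot" "eventually (\<lambda>x. x \<in> S) (filtermap \<Phi> F)"
    using F inS by (auto simp: filtermap_bot_iff eventually_filtermap)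
  then obtain L where "L \<in> S" and L: "inf (nhds L) (filtermap \<Phi> F) \<noteq> bot"
    using comp unfolding compact_filter by blast
  \<comment> \<open>The trace on \<open>F\<close> of the indices whose measures are close to
    \<open>L\<close>. It is nontrivial because \<open>L\<close> is a cluster point, and along it the
    measures of all sets converge by construction.\<close>
  define F' where "F' = inf (filtercomap \<Phi> (nhds L)) F"
  have F'_le: "F' \<le> F" by (simp add: F'_def)
  have F'_bot: "F' \<noteq> bot"
  proof
    assume "F' = bot"
    then have "eventually (\<lambda>_. False) (inf (filtercomap \<Phi> (nhds L)) F)"
      by (simp add: F'_def)
    then obtain P Q where P: "eventually P (nhds L)" and Q: "eventually Q F" and PQ: "\<And>i. P (\<Phi> i) \<and> Q i \<Longrightarrow> False"
      unfolding eventually_inf eventually_filtercomap by metis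
    have "eventually (\<lambda>y. \<not> P y) (filtermap \<Phi> F)"
      unfolding eventually_filtermap using Q by (rule eventually_mono) (use PQ in blast)
    with P have "eventually (\<lambda>_. False) (inf (nhds L) (filtermap \<Phi> F))"
      unfolding eventually_inf by blast
    with L show False by (simp add: trivial_limit_def)
  qed
  have lim: "((\<lambda>i. measure (\<mu> i) A) \<longlongrightarrow> L A) F'" for A
  proof -
    have "filterlim \<Phi> (nhds L) F'"
      unfolding filterlim_iff_le_filtercomap F'_def by simp
    then have "((\<lambda>i. \<Phi> i A) \<longlongrightarrow> L A) F'"
      by (rule continuous_on_tendsto_compose[OF continuous_on_product_coordinates]) auto
    then show ?thesis by (simp add: \<Phi>_def)
  qed
  have L_nonneg: "0 \<le> L A" for A
    using \<open>L \<in> S\<close> by (auto simp: S_def PiE_def)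
  have L_le1: "L A \<le> 1" for A
    using \<open>L \<in> S\<close> by (auto simp: S_def PiE_def)
  note lims = tendsto_le[OF F'_bot] 
  have meas: "K \<in> sets (\<mu> i)" if "compact K" for i K
    using that sets\<mu> by (simp add: borel_compact)
  have Lmono: "L A \<le> L B" if "A \<subseteq> B" "B \<in> sets borel" for A B
    using that sets\<mu> finite_measure.finite_measure_mono[OF prob_space.finite_measure[OF prob]]
    by (intro lims[OF lim lim]) auto
  have Lsub: "L (A \<union> B) \<le> L A + L B" if "compact A" "compact B" for A B
    using measure_subadditive[OF meas[OF that(1)] meas[OF that(2)]]
      finite_measure.emeasure_finite[OF prob_space.finite_measure[OF prob]]
    by (intro lims[OF tendsto_add[OF lim lim] lim]) auto
  have Ldisj: "L A + L B \<le> L (A \<union> B)" if "compact A" "compact B" "A \<inter> B = {}" for A B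
    using finite_measure.finite_measure_Union[OF prob_space.finite_measure[OF prob] meas[OF that(1)] meas[OF that(2)] that(3)]
    by (intro lims[OF lim tendsto_add[OF lim lim]]) auto
  have L0: "L {} = 0"
    using tendsto_unique[OF F'_bot lim[of "{}"], of 0] by simp
  obtain \<nu> where \<nu>: "sets \<nu> = sets borel"
      "\<And>U. open U \<Longrightarrow> emeasure \<nu> U = (SUP K\<in>{K. compact K \<and> K \<subseteq> U}. ennreal (L K))"
  proof (rule compact_content_extends_to_measure[of "\<lambda>A. ennreal (L A)"])
    show "ennreal (L {}) = 0" by (simp add: L0)
    show "ennreal (L K) \<le> ennreal (L K')" if "compact K'" "K \<subseteq> K'" for K K'
      using that Lmono by (intro ennreal_leI) (auto simp: borel_compact)
    show "ennreal (L (K \<union> K')) \<le> ennreal (L K) + ennreal (L K')" if "compact K" "compact K'" for K K'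
      using Lsub[OF that] L_nonneg by (simp flip: ennreal_plus add: ennreal_leI)
    show "ennreal (L K) + ennreal (L K') \<le> ennreal (L (K \<union> K'))" if "compact K" "compact K'" "K \<inter> K' = {}" for K K'
      using Ldisj[OF that] L_nonneg by (simp flip: ennreal_plus add: ennreal_leI)
  qed blast
  have le: "emeasure \<nu> U \<le> ennreal (L U)" if "open U" for U
    unfolding \<nu>(2)[OF that] using that Lmono by (intro SUP_least ennreal_leI) auto
  \<comment> \<open>Passing from the limits \<open>L\<close> to the inner content can only lose
    mass. Tightness rules this out: some compact set keeps mass at least \<open>1 - e\<close> in the
    limit.\<close>
  have "1 \<le> emeasure \<nu> UNIV"
  proof (rule ennreal_le_epsilon)
    fix e :: real assume "0 < e"
    obtain K where K: "compact K" "\<forall>\<^sub>F i in F. 1 - e \<le> measure (\<mu> i) K"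
      using tight[OF \<open>0 < e\<close>] by blast
    have "1 - e \<le> L K"
      by (rule tendsto_lowerbound[OF lim _ F'_bot]) (use K F'_le in \<open>auto simp: le_filter_def\<close>)
    then have "1 \<le> ennreal (L K + e)" by simp
    also have "\<dots> = ennreal (L K) + ennreal e" using L_nonneg \<open>0 < e\<close> by (simp add: ennreal_plus)
    also have "ennreal (L K) \<le> emeasure \<nu> UNIV"
      unfolding \<nu>(2)[OF open_UNIV] using K by (intro SUP_upper) auto
    finally show "1 \<le> emeasure \<nu> UNIV + ennreal e" by (simp add: add_right_mono)
  qed
  moreover have "emeasure \<nu> UNIV \<le> 1"
    using le[OF open_UNIV] L_le1[of UNIV] by (metis ennreal_1 ennreal_leI order_trans)
  ultimately have "emeasure \<nu> UNIV = 1" by simp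
  moreover have "space \<nu> = UNIV" using sets_eq_imp_space_eq[OF \<nu>(1)] by simp
  ultimately have prob\<nu>: "prob_space \<nu>" by (intro prob_spaceI) simp
  have "open_liminf_ge \<mu> \<nu> F'"
    unfolding open_liminf_ge_def
  proof (intro allI impI)
    fix U :: "'a set" and e :: real assume "open U" "0 < e"
    have "measure \<nu> U \<le> L U"
      using le[OF \<open>open U\<close>] L_nonneg[of U] by (simp add: measure_def enn2real_leI)
    then show "\<forall>\<^sub>F i in F'. measure \<nu> U - e < measure (\<mu> i) U"
      using \<open>0 < e\<close> by (intro order_tendstoD(1)[OF lim]) auto
  qed
  with F'_le F'_bot prob\<nu> \<nu>(1) show ?thesis by (rule that)
qed

section \<open>Lower semicontinuity of integrals\<close>

lemma borel_measurable_open_superlevel: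
  fixes h :: "'b::topological_space \<Rightarrow> real"
  assumes "\<And>t. open {x. t < h x}" and "sets M = sets borel"
  shows "h \<in> borel_measurable M"
proof -
  have "h \<in> borel_measurable borel"
    using assms(1) by (intro borel_measurableI_greater) (simp add: borel_open)
  then show ?thesis using measurable_cong_sets[OF assms(2) refl] by blast
qed

text \<open>A discrete layer-cake formula. For y > 0 the thresholds counted are the integers k \<ge>
  1 below N y, and there are \<lceil>N y\<rceil> - 1 of them. The inequality is strict so that the
  superlevel sets of a lower semicontinuous function are open.\<close>

lemma staircase_approx:
  fixes y :: real
  assumes y: "0 \<le> y" "y \<le> 1" and N: "0 < N"
  defines "s \<equiv> (\<Sum>k=1..N. if real k / real N < y then 1 else 0) / real N"
  shows "y - 1 / real N \<le> s" "s \<le> y"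
proof -
  define c where "c = real N * y"
  have c: "0 \<le> c" "c \<le> real N" using y by (auto simp: c_def mult_left_le)
  have "{k \<in> {1..N}. real k / real N < y} = {1..nat (\<lceil>c\<rceil> - 1)}"
  proof -
    have iff: "real k / real N < y \<longleftrightarrow> int k \<le> \<lceil>c\<rceil> - 1" for k
    proof -
      have "real k / real N < y \<longleftrightarrow> real k < c" using N by (simp add: c_def field_simps)
      also have "\<dots> \<longleftrightarrow> int k < \<lceil>c\<rceil>" by (simp add: less_ceiling_iff)
      finally show ?thesis by linarith
    qed
    have "\<lceil>c\<rceil> \<le> int N" using c by (simp add: ceiling_le_iff)
    then show ?thesis
      by (intro set_eqI, unfold mem_Collect_eq atLeastAtMost_iff iff) linarith
  qed
  moreover have "(\<Sum>k=1..N. if real k / real N < y then 1 else 0::real) = real (card {k \<in> {1..N}. real k / real N < y})"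
    using sum.inter_filter[of "{1..N}" "\<lambda>_. 1::real" "\<lambda>k. real k / real N < y"] by simp
  ultimately have s: "s = real (nat (\<lceil>c\<rceil> - 1)) / real N" by (simp add: s_def)
  have "c - 1 \<le> real (nat (\<lceil>c\<rceil> - 1))" "real (nat (\<lceil>c\<rceil> - 1)) \<le> c"
    using c by linarith+
  then have "(c - 1) / real N \<le> s" "s \<le> c / real N"
    unfolding s using N by (auto intro: divide_right_mono)
  then show "y - 1 / real N \<le> s" "s \<le> y"
    using N by (auto simp: c_def diff_divide_distrib)
qed

text \<open>The staircase turns the integral into an average of the measures of finitely many open
  superlevel sets, for which the convergence holds simultaneously. Half of \<open>e\<close> pays for
  the staircase, half for the measures.\<close>

lemma open_liminf_integral_unit:
  fixes h :: "'b::topological_space \<Rightarrow> real"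
  assumes lim: "open_liminf_ge \<mu> \<nu> F"
    and \<mu>: "\<And>i. prob_space (\<mu> i)" "\<And>i. sets (\<mu> i) = sets borel"
    and \<nu>: "prob_space \<nu>" "sets \<nu> = sets borel"
    and h: "\<And>t. open {x. t < h x}" "\<And>x. 0 \<le> h x" "\<And>x. h x \<le> 1"
    and "0 < e"
  shows "\<forall>\<^sub>F i in F. (LINT x|\<nu>. h x) - e < (LINT x|\<mu> i. h x)"
proof -
  obtain N :: nat where N: "0 < N" "1 / real N < e / 2"
    using reals_Archimedean[of "e/2"] \<open>0 < e\<close> by (metis half_gt_zero inverse_eq_divide of_nat_0_less_iff zero_less_Suc)
  define U where "U k = {x. real k / real N < h x}" for k :: nat
  define s where "s x = (\<Sum>k=1..N. indicator (U k) x) / real N" for x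
  have s_alt: "s x = (\<Sum>k=1..N. if real k / real N < h x then 1 else 0) / real N" for x
    unfolding s_def U_def by (intro arg_cong2[where f = "(/)"] sum.cong refl) (simp add: indicator_def)
  have s: "h x - 1 / real N \<le> s x" "s x \<le> h x" for x
    unfolding s_alt using staircase_approx[of "h x" N] h N by auto
  have openU: "open (U k)" for k by (simp add: U_def h)
  have int_h: "integrable M h" and int_s: "integrable M s"
    and int_s_eq: "(LINT x|M. s x) = (\<Sum>k=1..N. measure M (U k)) / real N"
    if M: "prob_space M" "sets M = sets borel" for M
  proof -
    interpret prob_space M by fact
    have [measurable]: "h \<in> borel_measurable M"
      using h M by (intro borel_measurable_open_superlevel) auto
    have U[measurable]: "U k \<in> sets M" for k using openU M by (simp add: borel_open)
    show "integrable M h"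
      by (rule integrable_const_bound[where B=1]) (use h in auto)
    show "integrable M s" unfolding s_def
      by (intro Bochner_Integration.integrable_divide Bochner_Integration.integrable_sum) (simp add: less_top[symmetric])
    have "space M = UNIV" using sets_eq_imp_space_eq[OF M(2)] by simp
    then show "(LINT x|M. s x) = (\<Sum>k=1..N. measure M (U k)) / real N"
      unfolding s_def by (subst Bochner_Integration.integral_divide_zero, subst Bochner_Integration.integral_sum) (auto simp: less_top[symmetric])
  qed
  have "\<forall>\<^sub>F i in F. \<forall>k\<in>{1..N}. measure \<nu> (U k) - e/2 < measure (\<mu> i) (U k)"
    using lim openU \<open>0 < e\<close> unfolding open_liminf_ge_def
    by (intro eventually_ball_finite) auto
  then show ?thesis
  proof (rule eventually_mono)
    fix i assume i: "\<forall>k\<in>{1..N}. measure \<nu> (U k) - e/2 < measure (\<mu> i) (U k)"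
    have "(LINT x|\<nu>. h x) \<le> (LINT x|\<nu>. s x + 1 / real N)"
      using s int_h[OF \<nu>] int_s[OF \<nu>] \<nu>(1)
      by (intro integral_mono) (auto simp: algebra_simps prob_space.finite_measure finite_measure.integrable_const)
    also have "\<dots> = (LINT x|\<nu>. s x) + 1 / real N"
      using int_s[OF \<nu>] \<nu>(1)
      by (subst Bochner_Integration.integral_add) (auto simp: prob_space.finite_measure finite_measure.integrable_const prob_space.prob_space)
    also have "(LINT x|\<nu>. s x) \<le> (\<Sum>k=1..N. measure (\<mu> i) (U k) + e/2) / real N"
      unfolding int_s_eq[OF \<nu>] using i by (intro divide_right_mono sum_mono) fastforce+
    also have "\<dots> = (LINT x|\<mu> i. s x) + e / 2"
      unfolding int_s_eq[OF \<mu>] using N by (simp add: sum.distrib add_divide_distrib)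
    also have "(LINT x|\<mu> i. s x) \<le> (LINT x|\<mu> i. h x)"
      using s int_h[OF \<mu>] int_s[OF \<mu>] by (intro integral_mono) auto
    finally show "(LINT x|\<nu>. h x) - e < (LINT x|\<mu> i. h x)" using N by simp
  qed
qed

lemma open_liminf_integral:
  fixes h :: "'b::topological_space \<Rightarrow> real"
  assumes lim: "open_liminf_ge \<mu> \<nu> F"
    and \<mu>: "\<And>i. prob_space (\<mu> i)" "\<And>i. sets (\<mu> i) = sets borel"
    and \<nu>: "prob_space \<nu>" "sets \<nu> = sets borel"
    and h: "\<And>t. open {x. t < h x}" "\<And>x. \<bar>h x\<bar> \<le> B"
    and "0 < e"
  shows "\<forall>\<^sub>F i in F. (LINT x|\<nu>. h x) - e < (LINT x|\<mu> i. h x)"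
proof -
  \<comment> \<open>\<open>B\<close> may be 0; the additional 1 permits the division that rescales
    \<open>h\<close> to the unit interval.\<close>
  define C where "C = B + 1"
  have "0 \<le> B" using h(2)[of undefined] by linarith
  moreover have "\<bar>h x\<bar> \<le> C" for x using h(2)[of x] by (simp add: C_def)
  ultimately have C: "0 < C" "\<And>x. \<bar>h x\<bar> \<le> C" by (auto simp: C_def)
  define k where "k x = (h x + C) / (2 * C)" for x
  have k01: "0 \<le> k x" "k x \<le> 1" for x
    using C(1) C(2)[of x] by (auto simp: k_def field_simps abs_le_iff)
  have k_open: "open {x. t < k x}" for t
  proof -
    have "{x. t < k x} = {x. t * (2 * C) - C < h x}"
      using C(1) by (auto simp: k_def field_simps)
    then show ?thesis by (simp add: h)
  qed
  have hk: "(LINT x|M. k x) = ((LINT x|M. h x) + C) / (2 * C)"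
    if M: "prob_space M" "sets M = sets borel" for M
  proof -
    interpret prob_space M by fact
    have [measurable]: "h \<in> borel_measurable M"
      using h M by (intro borel_measurable_open_superlevel) auto
    have "integrable M h"
      by (rule integrable_const_bound[where B=C]) (use C in auto)
    then show ?thesis by (simp add: k_def prob_space)
  qed
  have "\<forall>\<^sub>F i in F. (LINT x|\<nu>. k x) - e / (2 * C) < (LINT x|\<mu> i. k x)"
    by (rule open_liminf_integral_unit[OF lim \<mu> \<nu> k_open k01]) (use C \<open>0 < e\<close> in auto)
  then show ?thesis
    by (rule eventually_mono) (use C in \<open>simp add: hk[OF \<mu>] hk[OF \<nu>] divide_simps\<close>)
qed

text \<open>The one-sided bound is applied to both g and -g, which are lower semicontinuous.\<close>

lemma open_liminf_tendsto:
  fixes g :: "'b::topological_space \<Rightarrow> real"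
  assumes lim: "open_liminf_ge \<mu> \<nu> F"
    and \<mu>: "\<And>i. prob_space (\<mu> i)" "\<And>i. sets (\<mu> i) = sets borel"
    and \<nu>: "prob_space \<nu>" "sets \<nu> = sets borel"
    and g: "continuous_on UNIV g" "bounded (range g)"
  shows "((\<lambda>i. LINT x|\<mu> i. g x) \<longlongrightarrow> (LINT x|\<nu>. g x)) F"
proof (rule tendstoI)
  fix e :: real assume "0 < e"
  obtain B where B: "\<And>x. \<bar>g x\<bar> \<le> B" using g(2) by (auto simp: bounded_iff)
  have *: "open {x. t < g x}" "open {x. t < - g x}" for t
    using g(1) by (auto intro!: open_Collect_less continuous_intros)
  have "\<forall>\<^sub>F i in F. (LINT x|\<nu>. g x) - e < (LINT x|\<mu> i. g x)"
    by (rule open_liminf_integral[OF lim \<mu> \<nu> *(1) B \<open>0 < e\<close>])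
  moreover have "\<forall>\<^sub>F i in F. (LINT x|\<nu>. - g x) - e < (LINT x|\<mu> i. - g x)"
    by (rule open_liminf_integral[OF lim \<mu> \<nu> *(2) _ \<open>0 < e\<close>]) (use B in auto)
  ultimately show "\<forall>\<^sub>F i in F. dist (LINT x|\<mu> i. g x) (LINT x|\<nu>. g x) < e"
    by eventually_elim (auto simp: dist_real_def)
qed

lemma limitin_weak_topologyI:
  assumes \<nu>: "\<nu> \<in> prob_measures"
    and \<mu>: "\<forall>\<^sub>F i in F. \<mu> i \<in> prob_measures"
    and lim: "\<And>g :: 'a::topological_space \<Rightarrow> real. continuous_on UNIV g \<Longrightarrow> bounded (range g) \<Longrightarrow>
       ((\<lambda>i. LINT x|\<mu> i. g x) \<longlongrightarrow> (LINT x|\<nu>. g x)) F"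
  shows "limitin weak_topology \<mu> \<nu> F"
  unfolding limitin_def
proof (intro conjI allI impI)
  show "\<nu> \<in> topspace weak_topology" using \<nu> by simp
  fix O' assume "openin weak_topology O' \<and> \<nu> \<in> O'"
  then have "generate_topology_on {{\<mu> \<in> prob_measures. (LINT x|\<mu>. g x) \<in> U} | (g :: 'a \<Rightarrow> real) (U :: real set).
        continuous_on UNIV g \<and> bounded (range g) \<and> open U} O'" "\<nu> \<in> O'"
    unfolding weak_topology_def openin_topology_generated_by_iff by auto
  then show "\<forall>\<^sub>F i in F. \<mu> i \<in> O'"
  proof (induction rule: generate_topology_on.induct)
    case (Int a b)
    then show ?case by (auto intro: eventually_conj)
  next
    case (UN K)
    then obtain k where "k \<in> K" "\<nu> \<in> k" by auto
    from UN.IH[OF this] show ?case by (rule eventually_mono) (use \<open>k \<in> K\<close> in auto)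
  next
    case (Basis s)
    then obtain g :: "'a \<Rightarrow> real" and U where g: "continuous_on UNIV g" "bounded (range g)" "open U"
      and s: "s = {\<mu> \<in> prob_measures. (LINT x|\<mu>. g x) \<in> U}" by auto
    from Basis s have "(LINT x|\<nu>. g x) \<in> U" by auto
    from topological_tendstoD[OF lim[OF g(1,2)] g(3) this] \<mu>
    show ?case by eventually_elim (auto simp: s)
  qed auto
qed

section \<open>Convergence of product measures\<close>

lemma measure_pair_eq_integral:
  assumes "prob_space M" and A: "A \<in> sets (M \<Otimes>\<^sub>M M)"
  shows "measure (M \<Otimes>\<^sub>M M) A = (LINT x|M. measure M (Pair x -` A))"
    and "(\<lambda>x. measure M (Pair x -` A)) \<in> borel_measurable M"
proof -
  interpret prob_space M by fact
  have m: "(\<lambda>x. emeasure M (Pair x -` A)) \<in> borel_measurable M"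
    by (rule measurable_emeasure_Pair[OF A])
  then show m': "(\<lambda>x. measure M (Pair x -` A)) \<in> borel_measurable M"
    unfolding measure_def by measurable
  have "measure (M \<Otimes>\<^sub>M M) A = enn2real (\<integral>\<^sup>+x. ennreal (measure M (Pair x -` A)) \<partial>M)"
    unfolding measure_def[of "M \<Otimes>\<^sub>M M"] emeasure_pair_measure_alt[OF A] by (simp add: emeasure_eq_measure)
  also have "\<dots> = (LINT x|M. measure M (Pair x -` A))"
    using m' by (intro integral_eq_nn_integral[symmetric]) auto
  finally show "measure (M \<Otimes>\<^sub>M M) A = (LINT x|M. measure M (Pair x -` A))" .
qed

text \<open>The section of \<open>R\<close> at x depends only on the set \<open>J x\<close> of
  rectangles whose first side contains x, so only finitely many open sets \<open>W K\<close> occur.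
  Their measures under \<mu> i can be compared with those under \<nu> uniformly in x. The remaining
  integrand \<phi> is lower semicontinuous, so \<open>open_liminf_integral\<close> moves the outer
  integral as well.\<close>

lemma open_liminf_rectangles:
  fixes A B :: "'j \<Rightarrow> 'a::second_countable_topology set" and \<mu> :: "'i \<Rightarrow> 'a measure"
  assumes lim: "open_liminf_ge \<mu> \<nu> F"
    and \<mu>: "\<And>i. prob_space (\<mu> i)" "\<And>i. sets (\<mu> i) = sets borel"
    and \<nu>: "prob_space \<nu>" "sets \<nu> = sets borel"
    and I: "finite I" and op: "\<And>j. j \<in> I \<Longrightarrow> open (A j)" "\<And>j. j \<in> I \<Longrightarrow> open (B j)"
    and "0 < e"
  defines "R \<equiv> (\<Union>j\<in>I. A j \<times> B j)"
  shows "\<forall>\<^sub>F i in F. measure (\<nu> \<Otimes>\<^sub>M \<nu>) R - e < measure (\<mu> i \<Otimes>\<^sub>M \<mu> i) R"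
proof -
  define W where "W J = (\<Union>j\<in>J. B j)" for J
  define J where "J x = {j\<in>I. x \<in> A j}" for x
  have sec: "Pair x -` R = W (J x)" for x
    by (auto simp: R_def W_def J_def)
  have R: "R \<in> sets (M \<Otimes>\<^sub>M M)" if "sets M = sets borel" for M
    unfolding R_def using op that I by (intro sets.finite_UN pair_measureI) (auto simp: borel_open)
  have openW: "open (W K)" if "K \<subseteq> I" for K
    unfolding W_def using that op by auto
  define \<phi> where "\<phi> x = measure \<nu> (W (J x))" for x
  interpret \<nu>: prob_space \<nu> by fact
  have \<phi>_bound: "\<bar>\<phi> x\<bar> \<le> 1" for x by (simp add: \<phi>_def)
  have \<phi>_open: "open {x. t < \<phi> x}" for t
  proof -
    \<comment> \<open>The measure of \<open>W K\<close> grows with \<open>K\<close>, and each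
      condition \<open>K \<subseteq> J x\<close> is open in x because it is a finite intersection of
      the sets \<open>A j\<close>.\<close>
    have "{x. t < \<phi> x} = (\<Union>K\<in>{K. K \<subseteq> I \<and> t < measure \<nu> (W K)}. \<Inter>j\<in>K. A j)"
    proof (intro set_eqI iffI)
      fix x assume "x \<in> {x. t < \<phi> x}"
      then show "x \<in> (\<Union>K\<in>{K. K \<subseteq> I \<and> t < measure \<nu> (W K)}. \<Inter>j\<in>K. A j)"
        by (intro UN_I[of "J x"]) (auto simp: \<phi>_def J_def)
    next
      fix x assume "x \<in> (\<Union>K\<in>{K. K \<subseteq> I \<and> t < measure \<nu> (W K)}. \<Inter>j\<in>K. A j)"
      then obtain K where K: "K \<subseteq> I" "t < measure \<nu> (W K)" "K \<subseteq> J x"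
        by (auto simp: J_def)
      have "measure \<nu> (W K) \<le> \<phi> x"
        unfolding \<phi>_def using K \<nu> openW[of "J x"]
        by (intro \<nu>.finite_measure_mono) (auto simp: W_def J_def borel_open)
      with K show "x \<in> {x. t < \<phi> x}" by simp
    qed
    moreover have "open (\<Inter>j\<in>K. A j)" if "K \<subseteq> I" for K
      using that I op by (intro open_INT) (auto intro: finite_subset)
    ultimately show ?thesis by auto
  qed
  have "\<forall>\<^sub>F i in F. \<forall>K\<in>Pow I. measure \<nu> (W K) - e/2 < measure (\<mu> i) (W K)"
    using lim openW \<open>0 < e\<close> I unfolding open_liminf_ge_def
    by (intro eventually_ball_finite) auto
  moreover have "\<forall>\<^sub>F i in F. (LINT x|\<nu>. \<phi> x) - e/2 < (LINT x|\<mu> i. \<phi> x)"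
    by (rule open_liminf_integral[OF lim \<mu> \<nu> \<phi>_open \<phi>_bound]) (use \<open>0 < e\<close> in simp)
  ultimately show ?thesis
  proof eventually_elim
    case (elim i)
    interpret \<mu>: prob_space "\<mu> i" by fact
    have [measurable]: "\<phi> \<in> borel_measurable (\<mu> i)"
      by (rule borel_measurable_open_superlevel[OF \<phi>_open \<mu>(2)])
    have int\<phi>: "integrable (\<mu> i) \<phi>"
      by (rule \<mu>.integrable_const_bound[where B=1]) (use \<phi>_bound in auto)
    have "measure (\<nu> \<Otimes>\<^sub>M \<nu>) R = (LINT x|\<nu>. \<phi> x)"
      by (simp add: measure_pair_eq_integral[OF \<nu>(1) R[OF \<nu>(2)]] sec \<phi>_def)
    also have "\<dots> - e < (LINT x|\<mu> i. \<phi> x) - e/2" using elim by simp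
    also have "\<dots> = (LINT x|\<mu> i. \<phi> x - e/2)"
      using int\<phi> by (simp add: \<mu>.prob_space)
    also have "\<dots> \<le> (LINT x|\<mu> i. measure (\<mu> i) (W (J x)))"
    proof (rule integral_mono)
      show "integrable (\<mu> i) (\<lambda>x. measure (\<mu> i) (W (J x)))"
        using measure_pair_eq_integral(2)[OF \<mu>(1) R[OF \<mu>(2)]]
        by (intro \<mu>.integrable_const_bound[where B=1]) (auto simp: sec)
      show "\<phi> x - e/2 \<le> measure (\<mu> i) (W (J x))" for x
        using elim(1)[rule_format, of "J x"] by (simp add: \<phi>_def J_def)
    qed (use int\<phi> in simp)
    also have "\<dots> = measure (\<mu> i \<Otimes>\<^sub>M \<mu> i) R"
      by (simp add: measure_pair_eq_integral[OF \<mu>(1) R[OF \<mu>(2)]] sec)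
    finally show ?case .
  qed
qed

lemma open_prod_rectangles:
  fixes U :: "('a::second_countable_topology \<times> 'a) set"
  assumes "open U"
  shows "\<exists>A B :: nat \<Rightarrow> 'a set. (\<forall>n. open (A n) \<and> open (B n)) \<and> U = (\<Union>n. A n \<times> B n)"
proof -
  obtain D :: "'a set set" where D: "countable D" "topological_basis D"
    using ex_countable_basis by blast
  \<comment> \<open>The pair of empty sets makes \<open>P\<close> nonempty, so that
    \<open>from_nat_into\<close> enumerates it, and it adds nothing to the union.\<close>
  define P where "P = insert ({},{}) {(a, b) \<in> D \<times> D. a \<times> b \<subseteq> U}"
  have "P \<subseteq> insert ({},{}) (D \<times> D)" by (auto simp: P_def)
  then have cP: "countable P" by (rule countable_subset) (use D in auto)
  have neP: "P \<noteq> {}" by (simp add: P_def)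
  have inP: "open (fst p) \<and> open (snd p) \<and> fst p \<times> snd p \<subseteq> U" if "p \<in> P" for p
    using that topological_basis_open[OF D(2)] by (auto simp: P_def)
  have "U = (\<Union>p\<in>P. fst p \<times> snd p)"
  proof (intro antisym subsetI)
    fix z assume z: "z \<in> U"
    obtain S T where ST: "open S" "open T" "z \<in> S \<times> T" "S \<times> T \<subseteq> U"
      using open_prod_elim[OF \<open>open U\<close> z] by metis
    obtain a where a: "a \<in> D" "fst z \<in> a" "a \<subseteq> S"
      using topological_basisE[OF D(2) ST(1), of "fst z"] ST(3) mem_Times_iff by metis
    obtain b where b: "b \<in> D" "snd z \<in> b" "b \<subseteq> T"
      using topological_basisE[OF D(2) ST(2), of "snd z"] ST(3) mem_Times_iff by metis
    show "z \<in> (\<Union>p\<in>P. fst p \<times> snd p)"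
    proof (rule UN_I[of "(a, b)"])
      show "(a, b) \<in> P" using a b ST(4) by (auto simp: P_def)
      show "z \<in> fst (a, b) \<times> snd (a, b)" using a b by (simp add: mem_Times_iff)
    qed
  qed (use inP in blast)
  also have "\<dots> = (\<Union>p\<in>range (from_nat_into P). fst p \<times> snd p)"
    by (simp only: range_from_nat_into[OF neP cP])
  also have "\<dots> = (\<Union>n. fst (from_nat_into P n) \<times> snd (from_nat_into P n))"
    by (simp only: image_image)
  finally have eq: "U = (\<Union>n. fst (from_nat_into P n) \<times> snd (from_nat_into P n))" .
  have op: "open (fst (from_nat_into P n)) \<and> open (snd (from_nat_into P n))" for n
    using inP[OF from_nat_into[OF neP]] by blast
  show ?thesis
    by (rule exI[of _ "\<lambda>n. fst (from_nat_into P n)"], rule exI[of _ "\<lambda>n. snd (from_nat_into P n)"],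
      rule conjI, rule allI, rule op, rule eq)
qed

lemma sets_pair_borel:
  fixes M :: "'a::second_countable_topology measure"
  assumes "sets M = sets borel"
  shows "sets (M \<Otimes>\<^sub>M M) = sets borel"
  using sets_pair_measure_cong[OF assms assms] unfolding borel_prod .

text \<open>An open set is an increasing union of finite unions of rectangles. Continuity from below
  is used only for the limit \<nu> \<otimes> \<nu>, where it fixes one finite union; for \<mu> i
  \<otimes> \<mu> i monotonicity then suffices.\<close>

lemma open_liminf_ge_pair:
  fixes \<mu> :: "'i \<Rightarrow> 'a::second_countable_topology measure"
  assumes lim: "open_liminf_ge \<mu> \<nu> F"
    and \<mu>: "\<And>i. prob_space (\<mu> i)" "\<And>i. sets (\<mu> i) = sets borel"
    and \<nu>: "prob_space \<nu>" "sets \<nu> = sets borel"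
  shows "open_liminf_ge (\<lambda>i. \<mu> i \<Otimes>\<^sub>M \<mu> i) (\<nu> \<Otimes>\<^sub>M \<nu>) F"
  unfolding open_liminf_ge_def
proof (intro allI impI)
  fix U :: "('a \<times> 'a) set" and e :: real assume "open U" "0 < e"
  obtain A B :: "nat \<Rightarrow> 'a set" where AB: "\<And>n. open (A n)" "\<And>n. open (B n)" and U: "U = (\<Union>n. A n \<times> B n)"
    using open_prod_rectangles[OF \<open>open U\<close>] by metis
  define R where "R n = (\<Union>j\<in>{..n}. A j \<times> B j)" for n :: nat
  have incR: "incseq R" unfolding incseq_def R_def by (intro allI impI UN_mono) auto
  have openR: "open (R n)" for n using AB by (auto simp: R_def open_Times)
  have UR: "U = (\<Union>n. R n)" by (auto simp: U R_def)
  have fm: "prob_space (M \<Otimes>\<^sub>M M)" if "prob_space M" for M :: "'a measure"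
  proof -
    interpret pair_prob_space M M using that by (simp add: pair_prob_space_def pair_sigma_finite_def prob_space_imp_sigma_finite)
    show ?thesis by unfold_locales
  qed
  interpret \<nu>2: prob_space "\<nu> \<Otimes>\<^sub>M \<nu>" by (rule fm[OF \<nu>(1)])
  have "(\<lambda>n. measure (\<nu> \<Otimes>\<^sub>M \<nu>) (R n)) \<longlonglongrightarrow> measure (\<nu> \<Otimes>\<^sub>M \<nu>) U"
    unfolding UR using openR sets_pair_borel[OF \<nu>(2)]
    by (intro \<nu>2.finite_Lim_measure_incseq) (auto simp: borel_open incR)
  then have "\<forall>\<^sub>F n in sequentially. measure (\<nu> \<Otimes>\<^sub>M \<nu>) U - e/2 < measure (\<nu> \<Otimes>\<^sub>M \<nu>) (R n)"
    by (rule order_tendstoD) (use \<open>0 < e\<close> in simp)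
  then obtain n where n: "measure (\<nu> \<Otimes>\<^sub>M \<nu>) U - e/2 < measure (\<nu> \<Otimes>\<^sub>M \<nu>) (R n)"
    by (auto simp: eventually_sequentially)
  have "\<forall>\<^sub>F i in F. measure (\<nu> \<Otimes>\<^sub>M \<nu>) (R n) - e/2 < measure (\<mu> i \<Otimes>\<^sub>M \<mu> i) (R n)"
    unfolding R_def by (rule open_liminf_rectangles[OF lim \<mu> \<nu>]) (use AB \<open>0 < e\<close> in auto)
  then show "\<forall>\<^sub>F i in F. measure (\<nu> \<Otimes>\<^sub>M \<nu>) U - e < measure (\<mu> i \<Otimes>\<^sub>M \<mu> i) U"
  proof eventually_elim
    case (elim i)
    have "measure (\<mu> i \<Otimes>\<^sub>M \<mu> i) (R n) \<le> measure (\<mu> i \<Otimes>\<^sub>M \<mu> i) U"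
      using \<open>open U\<close> sets_pair_borel[OF \<mu>(2)] UR
      by (intro finite_measure.finite_measure_mono[OF prob_space.finite_measure[OF fm[OF \<mu>(1)]]]) (auto simp: borel_open)
    with elim n show ?case by simp
  qed
qed

section \<open>Finite products of arbitrary measures\<close>

text \<open>Integrating out one coordinate at a time shows that the product of the factor measures is
  countably additive on boxes, without any \<open>\<sigma>\<close>-finiteness.\<close>

lemma prod_emeasure_eq_suminf:
  fixes A :: "'i \<Rightarrow> 'b set" and B :: "nat \<Rightarrow> 'i \<Rightarrow> 'b set" and c :: ennreal
  assumes "finite I" and "\<And>i. i \<in> I \<Longrightarrow> A i \<in> sets (M i)" and "\<And>k i. i \<in> I \<Longrightarrow> B k i \<in> sets (M i)"
    and "\<And>x. (\<And>i. i \<in> I \<Longrightarrow> x i \<in> space (M i)) \<Longrightarrow>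
      c * (\<Prod>i\<in>I. indicator (A i) (x i)) = (\<Sum>k. c' k * (\<Prod>i\<in>I. indicator (B k i) (x i)))"
  shows "c * (\<Prod>i\<in>I. emeasure (M i) (A i)) = (\<Sum>k. c' k * (\<Prod>i\<in>I. emeasure (M i) (B k i)))"
  using assms
proof (induction I arbitrary: c c' rule: finite_induct)
  case empty
  from empty(3)[of undefined] show ?case by simp
next
  case (insert j I)
  \<comment> \<open>With the coordinates in \<open>I\<close> fixed, the hypothesis is an identity
    between functions of coordinate j alone. Integrating it moves the factors of \<open>M j\<close>
    into the coefficients, which is why the induction keeps \<open>c\<close> and \<open>c'\<close>
    arbitrary.\<close>
  have "(c * emeasure (M j) (A j)) * (\<Prod>i\<in>I. emeasure (M i) (A i)) =
      (\<Sum>k. (c' k * emeasure (M j) (B k j)) * (\<Prod>i\<in>I. emeasure (M i) (B k i)))"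
  proof (rule insert.IH)
    fix x assume x: "\<And>i. i \<in> I \<Longrightarrow> x i \<in> space (M i)"
    let ?a = "\<Prod>i\<in>I. indicator (A i) (x i) :: ennreal"
    let ?b = "\<lambda>k. \<Prod>i\<in>I. indicator (B k i) (x i) :: ennreal"
    have [measurable]: "A j \<in> sets (M j)" "\<And>k. B k j \<in> sets (M j)" using insert.prems by auto
    have eq: "(c * ?a) * indicator (A j) y = (\<Sum>k. (c' k * ?b k) * indicator (B k j) y)"
      if y: "y \<in> space (M j)" for y
    proof -
      have upd: "(\<Prod>i\<in>I. indicator (D i) ((x(j := y)) i)) = (\<Prod>i\<in>I. indicator (D i) (x i) :: ennreal)" for D
        using insert.hyps by (intro prod.cong) auto
      have "\<And>i. i \<in> insert j I \<Longrightarrow> (x(j := y)) i \<in> space (M i)" using x y by auto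
      from insert.prems(3)[OF this] show ?thesis
        using insert.hyps by (simp add: upd fun_upd_same mult_ac del: fun_upd_apply)
    qed
    have "(c * ?a) * emeasure (M j) (A j) = (\<integral>\<^sup>+ y. (c * ?a) * indicator (A j) y \<partial>M j)"
      by (simp add: nn_integral_cmult_indicator)
    also have "\<dots> = (\<integral>\<^sup>+ y. (\<Sum>k. (c' k * ?b k) * indicator (B k j) y) \<partial>M j)"
      by (intro nn_integral_cong eq)
    also have "\<dots> = (\<Sum>k. (c' k * ?b k) * emeasure (M j) (B k j))"
      by (subst nn_integral_suminf) (simp_all add: nn_integral_cmult_indicator)
    finally show "c * emeasure (M j) (A j) * ?a = (\<Sum>k. c' k * emeasure (M j) (B k j) * ?b k)"
      by (simp add: mult_ac)
  qed (use insert.prems in auto)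
  then show ?case using insert.hyps by (simp add: mult_ac)
qed

lemma indicator_PiE_eq_prod:
  assumes "finite I" "x \<in> extensional I"
  shows "(indicator (PiE I A) x :: ennreal) = (\<Prod>i\<in>I. indicator (A i) (x i))"
proof (cases "x \<in> PiE I A")
  case True
  then show ?thesis by (auto simp: PiE_def Pi_def)
next
  case False
  then obtain i where "i \<in> I" "x i \<notin> A i" using assms(2) by (auto simp: PiE_def)
  then have "(\<Prod>i\<in>I. indicator (A i) (x i) :: ennreal) = 0"
    using assms(1) \<open>i \<in> I\<close> \<open>x i \<notin> A i\<close> by (intro prod_zero) (auto intro!: bexI[of _ i])
  then show ?thesis using False by simp
qed

text \<open>The difference of two boxes splits according to the set of coordinates in which the point
  leaves the smaller box.\<close>

lemma semiring_of_sets_boxes: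
  assumes "finite I" "I \<noteq> {}"
  shows "semiring_of_sets (\<Pi>\<^sub>E i\<in>I. space (M i)) {PiE I Y | Y. \<forall>i\<in>I. Y i \<in> sets (M i)}"
    (is "semiring_of_sets ?\<Omega> ?S")
proof
    show "?S \<subseteq> Pow ?\<Omega>"
      by (auto simp: PiE_def Pi_def dest: sets.sets_into_space)
    show "{} \<in> ?S"
      using assms by (intro CollectI exI[of _ "\<lambda>_. {}"]) (auto simp: PiE_eq_empty_iff)
    show "a \<inter> b \<in> ?S" if "a \<in> ?S" "b \<in> ?S" for a b
    proof -
      obtain Y Z where "a = PiE I Y" "b = PiE I Z" "\<forall>i\<in>I. Y i \<in> sets (M i)" "\<forall>i\<in>I. Z i \<in> sets (M i)"
        using \<open>a \<in> ?S\<close> \<open>b \<in> ?S\<close> by auto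
      then show ?thesis
        by (intro CollectI exI[of _ "\<lambda>i. Y i \<inter> Z i"]) (auto simp: PiE_Int)
    qed
    show "\<exists>C\<subseteq>?S. finite C \<and> disjoint C \<and> a - b = \<Union>C" if "a \<in> ?S" "b \<in> ?S" for a b
    proof -
      obtain Y Z where a: "a = PiE I Y" and b: "b = PiE I Z"
        and YZ: "\<And>i. i \<in> I \<Longrightarrow> Y i \<in> sets (M i)" "\<And>i. i \<in> I \<Longrightarrow> Z i \<in> sets (M i)"
        using \<open>a \<in> ?S\<close> \<open>b \<in> ?S\<close> by auto
      define E where "E J = PiE I (\<lambda>i. if i \<in> J then Y i - Z i else Y i \<inter> Z i)" for J
      \<comment> \<open>A point of \<open>E J\<close> determines \<open>J\<close>, hence the pieces
        are disjoint. The piece with \<open>J = {}\<close> is the intersection of the two boxes and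
        is left out of the difference.\<close>
      have J_eq: "J = {i\<in>I. x i \<notin> Z i}" if "x \<in> E J" "J \<subseteq> I" for x J
        using that by (fastforce simp: E_def PiE_def Pi_def split: if_splits)
      let ?C = "E ` (Pow I - {{}})"
      have "?C \<subseteq> ?S"
      proof (rule image_subsetI)
        fix J
        show "E J \<in> ?S"
          unfolding E_def using YZ by (intro CollectI exI conjI refl) auto
      qed
      moreover have "finite ?C" using assms by simp
      moreover have "disjoint ?C"
      proof (rule disjointI)
        fix a' b' assume ab: "a' \<in> ?C" "b' \<in> ?C" "a' \<noteq> b'"
        from ab(1) obtain J where J: "a' = E J" "J \<subseteq> I" by blast
        from ab(2) obtain J' where J': "b' = E J'" "J' \<subseteq> I" by blast
        show "a' \<inter> b' = {}"
        proof (rule ccontr)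
          assume "a' \<inter> b' \<noteq> {}"
          then obtain x where x: "x \<in> E J" "x \<in> E J'" using J J' by blast
          have "J = J'" by (rule trans[OF J_eq[OF x(1) J(2)] J_eq[OF x(2) J'(2), symmetric]])
          then show False using ab(3) J J' by simp
        qed
      qed
      moreover have "a - b = \<Union>?C"
      proof (intro set_eqI iffI)
        fix x assume x: "x \<in> a - b"
        define J where "J = {i\<in>I. x i \<notin> Z i}"
        have "x \<in> E J" "J \<noteq> {}" using x by (auto simp: a b J_def E_def PiE_def Pi_def)
        then show "x \<in> \<Union>?C" by (auto simp: J_def)
      next
        fix x assume "x \<in> \<Union>?C"
        then obtain J where J: "x \<in> E J" "J \<subseteq> I" "J \<noteq> {}" by auto
        then have xi: "\<And>i. i \<in> I \<Longrightarrow> x i \<in> (if i \<in> J then Y i - Z i else Y i \<inter> Z i)" "x \<in> extensional I"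
          by (auto simp: E_def PiE_def Pi_def)
        have "x \<in> a" unfolding a
        proof (rule PiE_I)
          show "x i \<in> Y i" if "i \<in> I" for i using xi(1)[OF that] by (auto split: if_splits)
        qed (use xi(2) in \<open>auto simp: extensional_def\<close>)
        moreover obtain i where "i \<in> J" using J by blast
        then have "x i \<notin> Z i" "i \<in> I" using xi(1)[of i] J by auto
        then have "x \<notin> b" unfolding b by blast
        ultimately show "x \<in> a - b" by simp
      qed
      ultimately show ?thesis by blast
    qed
qed

text \<open>\<open>PiM\<close> is an \<open>extend_measure\<close>: its values on generators are the
  intended ones as soon as these are consistent and countably additive on the semiring of boxes.
  Both follow from \<open>prod_emeasure_eq_suminf\<close>, which works for arbitrary
  factors.\<close>

lemma emeasure_PiM_boxes:
  fixes M :: "'i \<Rightarrow> 'b measure"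
  assumes I: "finite I" "I \<noteq> {}" and A: "\<And>i. i \<in> I \<Longrightarrow> A i \<in> sets (M i)"
  shows "emeasure (PiM I M) (PiE I A) = (\<Prod>i\<in>I. emeasure (M i) (A i))"
proof -
  let ?\<Omega> = "\<Pi>\<^sub>E i\<in>I. space (M i)"
  let ?K = "{(J, X). (J \<noteq> {} \<or> I = {}) \<and> finite J \<and> J \<subseteq> I \<and> X \<in> (\<Pi> j\<in>J. sets (M j))}"
  let ?G = "\<lambda>(J, X). prod_emb I M J (\<Pi>\<^sub>E j\<in>J. X j)"
  let ?m = "\<lambda>(J, X). \<Prod>j\<in>J \<union> {i\<in>I. emeasure (M i) (space (M i)) \<noteq> 1}.
      if j \<in> J then emeasure (M j) (X j) else emeasure (M j) (space (M j))"
  \<comment> \<open>Padding with the whole space makes every generator a box over the full index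
    set, so that generators with different \<open>J\<close> become comparable.\<close>
  define Y where "Y = (\<lambda>(J, X) i. if i \<in> J then X i else space (M i))"
  have Y: "Y p i \<in> sets (M i)" if "p \<in> ?K" "i \<in> I" for p i
    using that by (auto simp: Y_def split: prod.splits)
  have G: "?G p = PiE I (Y p)" if "p \<in> ?K" for p
  proof -
    obtain J X where p: "p = (J, X)" by (cases p)
    have J: "J \<subseteq> I" "\<And>i. i \<in> J \<Longrightarrow> X i \<subseteq> space (M i)"
      using that sets.sets_into_space by (auto simp: p Pi_iff)
    have "prod_emb I M J (PiE J X) = PiE I (\<lambda>i. if i \<in> J then X i else space (M i))"
      by (rule prod_emb_PiE) (use I J in \<open>auto intro: finite_subset\<close>)
    then show ?thesis by (simp add: p Y_def)
  qed
  have m: "?m p = (\<Prod>i\<in>I. emeasure (M i) (Y p i))" if "p \<in> ?K" for p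
  proof -
    obtain J X where p: "p = (J, X)" by (cases p)
    have "?m p = (\<Prod>j\<in>J \<union> {i\<in>I. emeasure (M i) (space (M i)) \<noteq> 1}. emeasure (M j) (Y p j))"
      by (simp add: p Y_def if_distrib cong: if_cong)
    also have "\<dots> = (\<Prod>i\<in>I. emeasure (M i) (Y p i))"
      using that I by (intro prod.mono_neutral_left) (auto simp: p Y_def)
    finally show ?thesis .
  qed
  have ind: "(indicator (?G p) x :: ennreal) = (\<Prod>i\<in>I. indicator (Y p i) (x i))"
    if "p \<in> ?K" "x \<in> ?\<Omega>" for p x
    unfolding G[OF that(1)] using that I by (intro indicator_PiE_eq_prod) (auto simp: PiE_def)
  have full: "?G ` ?K = {PiE I Z | Z. \<forall>i\<in>I. Z i \<in> sets (M i)}"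
  proof (intro antisym subsetI)
    fix a assume "a \<in> ?G ` ?K"
    then obtain p where p: "p \<in> ?K" "a = ?G p" by (rule imageE)
    have "a = PiE I (Y p)" unfolding p(2) by (rule G[OF p(1)])
    moreover have "\<forall>i\<in>I. Y p i \<in> sets (M i)" using Y[OF p(1)] by simp
    ultimately show "a \<in> {PiE I Z | Z. \<forall>i\<in>I. Z i \<in> sets (M i)}" by (intro CollectI exI conjI)
  next
    fix a assume "a \<in> {PiE I Z | Z. \<forall>i\<in>I. Z i \<in> sets (M i)}"
    then obtain Z where Z: "a = PiE I Z" "\<forall>i\<in>I. Z i \<in> sets (M i)" by auto
    have K: "(I, Z) \<in> ?K" using Z I by auto
    have "a = ?G (I, Z)"
      unfolding G[OF K] Z(1) by (intro PiE_cong) (simp add: Y_def)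
    then show "a \<in> ?G ` ?K" using K by (rule image_eqI)
  qed
  have restr: "restrict x I \<in> ?\<Omega>" if "\<And>i. i \<in> I \<Longrightarrow> x i \<in> space (M i)" for x
    using that by auto
  \<comment> \<open>The weights \<open>c\<close> let one identity serve three times: weights 0 give
    the value on an empty box, the weight concentrated at 0 gives independence of the
    representation, and weights 1 give countable additivity.\<close>
  have add: "(\<Sum>k. c k * ?m (B k)) = ?m j"
    if B: "\<And>k. B k \<in> ?K" and j: "j \<in> ?K"
      and eq: "\<And>x. x \<in> ?\<Omega> \<Longrightarrow> indicator (?G j) x = (\<Sum>k. c k * indicator (?G (B k)) x)"
    for B :: "nat \<Rightarrow> _" and j and c :: "nat \<Rightarrow> ennreal"
  proof -
    have "1 * (\<Prod>i\<in>I. emeasure (M i) (Y j i)) = (\<Sum>k. c k * (\<Prod>i\<in>I. emeasure (M i) (Y (B k) i)))"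
    proof (rule prod_emeasure_eq_suminf)
      fix x assume x: "\<And>i. i \<in> I \<Longrightarrow> x i \<in> space (M i)"
      show "1 * (\<Prod>i\<in>I. indicator (Y j i) (x i)) = (\<Sum>k. c k * (\<Prod>i\<in>I. indicator (Y (B k) i) (x i) :: ennreal))"
        using eq[OF restr[OF x]] by (simp only: ind[OF j restr[OF x]] ind[OF B restr[OF x]]) simp
    qed (use I Y B j in auto)
    then show ?thesis by (simp only: m[OF j] m[OF B]) simp
  qed
  have K: "(I, A) \<in> ?K" using A I by auto
  have "emeasure (PiM I M) (?G (I, A)) = ?m (I, A)"
  proof (rule extend_measure_caratheodory[OF PiM_def K])
    show "semiring_of_sets ?\<Omega> (?G ` ?K)"
      unfolding full by (rule semiring_of_sets_boxes[OF I])
    show "?m i = 0" if "i \<in> ?K" "?G i = {}" for i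
      using add[of "\<lambda>_. i" i "\<lambda>_. 0"] that by simp
    show "?m i = ?m j" if "i \<in> ?K" "j \<in> ?K" "?G i = ?G j" for i j
    proof -
      have "(\<Sum>k. (if k = (0::nat) then 1 else 0) * z) = (z::ennreal)" for z
        by (subst suminf_finite[of "{0}"]) auto
      then show ?thesis
        using add[of "\<lambda>_. i" j "\<lambda>k. if k = 0 then 1 else 0"] that by simp
    qed
    show "(\<Sum>n. ?m (B n)) = ?m j"
      if "B \<in> UNIV \<rightarrow> ?K" "j \<in> ?K" "disjoint_family (?G \<circ> B)" "(\<Union>i. ?G (B i)) = ?G j" for B j
    proof -
      have "(\<Sum>n. indicator (?G (B n)) x :: ennreal) = indicator (?G j) x" for x
        using suminf_indicator[of "?G \<circ> B" x] that(3,4) by (simp add: comp_def)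
      then show ?thesis
        using add[of B j "\<lambda>_. 1"] that(1,2) by (simp add: Pi_iff)
    qed
  qed auto
  then show ?thesis unfolding G[OF K] m[OF K] by (simp add: Y_def cong: PiE_cong)
qed

text \<open>Uniqueness of product measures is available for sigma-finite factors only. So l is first
  restricted to S = {f \<noteq> 0}, where it is sigma-finite because f is integrable. Multiplication
  by the indicators of S turns the power of l into the power of this restriction, by the box
  formula; multiplication by f then gives the power of the finite measure
  \<open>density l f\<close>.\<close>

lemma PiM_density:
  fixes l :: "'b measure" and f :: "'b \<Rightarrow> ennreal"
  assumes I: "finite I" "I \<noteq> {}" and f[measurable]: "f \<in> borel_measurable l"
    and fin: "(\<integral>\<^sup>+ x. f x \<partial>l) < \<infinity>" and ftop: "\<And>x. f x \<noteq> \<infinity>"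
  shows "PiM I (\<lambda>_. density l f) = density (PiM I (\<lambda>_. l)) (\<lambda>x. \<Prod>i\<in>I. f (x i))"
proof -
  define S where "S = {x\<in>space l. f x \<noteq> 0}"
  have S[measurable]: "S \<in> sets l" unfolding S_def by measurable
  define m where "m = density l f"
  define s where "s = density l (indicator S)"
  have "finite_measure m"
  proof
    show "emeasure m (space m) \<noteq> \<infinity>"
      using fin by (simp add: m_def emeasure_density cong: nn_integral_cong)
  qed
  then have sfm: "sigma_finite_measure m" by (simp add: finite_measure.sigma_finite_measure)
  \<comment> \<open>The density \<open>1 / f\<close> undoes \<open>f\<close> on \<open>S\<close>. It
    is finite almost everywhere for the finite measure \<open>m\<close>, which makes
    \<open>s\<close> sigma-finite.\<close>
  have s_eq: "s = density m (\<lambda>x. 1 / f x)"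
    unfolding s_def m_def using ftop
    by (subst density_density_eq)
       (auto intro!: density_cong AE_I2 simp: S_def ennreal_times_divide ennreal_divide_self indicator_def less_top)
  have sfs: "sigma_finite_measure s"
    unfolding s_eq
  proof (subst sigma_finite_measure.sigma_finite_iff_density_finite[OF sfm])
    show "(\<lambda>x. 1 / f x) \<in> borel_measurable m" unfolding m_def by measurable
    show "AE x in m. 1 / f x \<noteq> \<infinity>"
      unfolding m_def by (subst AE_density) (auto simp: ennreal_divide_eq_top_iff)
  qed
  interpret m: product_sigma_finite "\<lambda>_. m" by (intro product_sigma_finite.intro sfm)
  interpret s: product_sigma_finite "\<lambda>_. s" by (intro product_sigma_finite.intro sfs)
  have sets_m: "sets (PiM I (\<lambda>_. m)) = sets (PiM I (\<lambda>_. l))"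
    by (intro sets_PiM_cong) (simp_all add: m_def)
  have sets_s: "sets (PiM I (\<lambda>_. s)) = sets (PiM I (\<lambda>_. l))"
    by (intro sets_PiM_cong) (simp_all add: s_def)
  have m_s: "m = density s f"
    unfolding s_def m_def
    by (subst density_density_eq) (auto intro!: density_cong AE_I2 simp: S_def indicator_def)
  have box: "indicator (PiE I A) x = (\<Prod>i\<in>I. indicator (A i) (x i) :: ennreal)"
    if "x \<in> space (PiM I (\<lambda>_. N))" for A :: "'a \<Rightarrow> 'b set" and x and N :: "'b measure"
    using that I(1) by (intro indicator_PiE_eq_prod) (simp_all add: space_PiM PiE_def)
  have PiE_sets: "PiE I A \<in> sets (PiM I (\<lambda>_. N))" if "\<And>i. i \<in> I \<Longrightarrow> A i \<in> sets N" for A and N :: "'b measure"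
    using that I by (intro sets_PiM_I_finite) auto
  have 1: "density (PiM I (\<lambda>_. l)) (\<lambda>x. \<Prod>i\<in>I. indicator S (x i)) = PiM I (\<lambda>_. s)"
  proof (rule s.PiM_eqI[OF I(1)])
    fix A assume "\<And>i. i \<in> I \<Longrightarrow> A i \<in> sets s"
    then have A[measurable]: "\<And>i. i \<in> I \<Longrightarrow> A i \<in> sets l" by (simp add: s_def)
    have "emeasure (density (PiM I (\<lambda>_. l)) (\<lambda>x. \<Prod>i\<in>I. indicator S (x i))) (PiE I A) =
      (\<integral>\<^sup>+ x. (\<Prod>i\<in>I. indicator S (x i)) * indicator (PiE I A) x \<partial>PiM I (\<lambda>_. l))"
      using A PiE_sets by (subst emeasure_density) auto
    also have "\<dots> = (\<integral>\<^sup>+ x. indicator (PiE I (\<lambda>i. A i \<inter> S)) x \<partial>PiM I (\<lambda>_. l))"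
      by (intro nn_integral_cong) (simp add: box prod.distrib[symmetric] indicator_inter_arith mult.commute)
    also have "\<dots> = (\<Prod>i\<in>I. emeasure l (A i \<inter> S))"
      using A by (subst nn_integral_indicator) (auto intro!: PiE_sets emeasure_PiM_boxes[OF I])
    also have "\<dots> = (\<Prod>i\<in>I. emeasure s (A i))"
      using A by (intro prod.cong refl) (auto simp: s_def emeasure_density indicator_inter_arith[symmetric] Int_commute)
    finally show "emeasure (density (PiM I (\<lambda>_. l)) (\<lambda>x. \<Prod>i\<in>I. indicator S (x i))) (PiE I A) = (\<Prod>i\<in>I. emeasure s (A i))" .
  qed (simp add: sets_s)
  have 2: "density (PiM I (\<lambda>_. s)) (\<lambda>x. \<Prod>i\<in>I. f (x i)) = PiM I (\<lambda>_. m)"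
  proof (rule m.PiM_eqI[OF I(1)])
    fix A assume "\<And>i. i \<in> I \<Longrightarrow> A i \<in> sets m"
    then have A[measurable]: "\<And>i. i \<in> I \<Longrightarrow> A i \<in> sets s" by (simp add: s_def m_def)
    have [measurable]: "f \<in> borel_measurable s" by (simp add: s_def)
    have "emeasure (density (PiM I (\<lambda>_. s)) (\<lambda>x. \<Prod>i\<in>I. f (x i))) (PiE I A) =
      (\<integral>\<^sup>+ x. (\<Prod>i\<in>I. f (x i)) * indicator (PiE I A) x \<partial>PiM I (\<lambda>_. s))"
      using A PiE_sets by (subst emeasure_density) auto
    also have "\<dots> = (\<integral>\<^sup>+ x. (\<Prod>i\<in>I. f (x i) * indicator (A i) (x i)) \<partial>PiM I (\<lambda>_. s))"
      by (intro nn_integral_cong) (simp add: box prod.distrib)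
    also have "\<dots> = (\<Prod>i\<in>I. \<integral>\<^sup>+ x. f x * indicator (A i) x \<partial>s)"
      using A by (intro s.product_nn_integral_prod I) auto
    also have "\<dots> = (\<Prod>i\<in>I. emeasure m (A i))"
      using A by (intro prod.cong refl) (simp add: m_s emeasure_density)
    finally show "emeasure (density (PiM I (\<lambda>_. s)) (\<lambda>x. \<Prod>i\<in>I. f (x i))) (PiE I A) = (\<Prod>i\<in>I. emeasure m (A i))" .
  qed (simp add: sets_s sets_m)
  have "PiM I (\<lambda>_. m) = density (density (PiM I (\<lambda>_. l)) (\<lambda>x. \<Prod>i\<in>I. indicator S (x i))) (\<lambda>x. \<Prod>i\<in>I. f (x i))"
    by (simp only: 1 2)
  also have "\<dots> = density (PiM I (\<lambda>_. l)) (\<lambda>x. (\<Prod>i\<in>I. indicator S (x i)) * (\<Prod>i\<in>I. f (x i)))"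
    using I(1) by (intro density_density_eq) auto
  also have "\<dots> = density (PiM I (\<lambda>_. l)) (\<lambda>x. \<Prod>i\<in>I. f (x i))"
    using I(1)
    by (intro density_cong AE_I2)
       (auto simp: prod.distrib[symmetric] space_PiM S_def indicator_def PiE_def Pi_def intro!: prod.cong)
  finally show ?thesis by (simp add: m_def)
qed

section \<open>The Hamiltonian as a sum over pairs\<close>

definition pairs :: "nat \<Rightarrow> (nat \<times> nat) set" where
  "pairs n = {(i, j). 1 \<le> i \<and> i < j \<and> j \<le> n}"

lemma finite_pairs [simp]: "finite (pairs n)"
  by (rule finite_subset[of _ "{..n} \<times> {..n}"]) (auto simp: pairs_def)

lemma sum_pairs_Suc:
  fixes f :: "nat \<times> nat \<Rightarrow> 'c::comm_monoid_add"
  shows "sum f (pairs (Suc n)) = sum f (pairs n) + (\<Sum>i=1..n. f (i, Suc n))"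
proof -
  have "pairs (Suc n) = pairs n \<union> (\<lambda>i. (i, Suc n)) ` {1..n}"
    by (auto simp: pairs_def image_iff)
  moreover have "pairs n \<inter> (\<lambda>i. (i, Suc n)) ` {1..n} = {}"
    by (auto simp: pairs_def)
  ultimately have "sum f (pairs (Suc n)) = sum f (pairs n) + sum f ((\<lambda>i. (i, Suc n)) ` {1..n})"
    by (simp add: sum.union_disjoint)
  also have "sum f ((\<lambda>i. (i, Suc n)) ` {1..n}) = (\<Sum>i=1..n. f (i, Suc n))"
    by (subst sum.reindex) (auto simp: inj_on_def)
  finally show ?thesis .
qed

lemma pairs_0 [simp]: "pairs 0 = {}"
  by (auto simp: pairs_def)

lemma card_pairs: "real (card (pairs n)) = real n * (real n - 1) / 2"
proof -
  have "(\<Sum>p\<in>pairs n. 1) = real n * (real n - 1) / 2"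
  proof (induction n)
    case (Suc n)
    then show ?case unfolding sum_pairs_Suc by (simp add: field_simps)
  qed simp
  then show ?thesis by simp
qed

text \<open>Each index lies in n - 1 pairs. The one copy of \<Sum> V that is missing from n \<Sum> V
  is the one absorbed into the reference measure.\<close>

lemma sum_pairs_add:
  fixes v :: "nat \<Rightarrow> real"
  shows "(\<Sum>(i, j)\<in>pairs n. v i + v j) = (real n - 1) * (\<Sum>i=1..n. v i)"
  by (induction n) (auto simp: sum_pairs_Suc sum.distrib algebra_simps)

lemma sum_symmetric_pairs:
  fixes a :: "nat \<Rightarrow> nat \<Rightarrow> ennreal"
  assumes "\<And>i j. a i j = a j i"
  shows "(\<Sum>i=1..n. \<Sum>j=1..n. a i j) =
    (\<Sum>(i, j)\<in>pairs n. a i j) + (\<Sum>(i, j)\<in>pairs n. a i j) + (\<Sum>i=1..n. a i i)"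
proof (induction n)
  case (Suc n)
  have "(\<Sum>j=1..n. a (Suc n) j) = (\<Sum>j=1..n. a j (Suc n))"
    by (intro sum.cong refl assms)
  with Suc show ?case by (simp add: sum_pairs_Suc sum.distrib algebra_simps)
qed simp

text \<open>If -d is a lower bound of the interaction, the shift makes its argument nonnegative;
  \<open>e2ennreal\<close> then truncates nothing and nonnegative integration applies.\<close>

definition pair_cost :: "('a \<Rightarrow> 'a \<Rightarrow> ereal) \<Rightarrow> ('a \<Rightarrow> ereal) \<Rightarrow> real \<Rightarrow> 'a \<times> 'a \<Rightarrow> ennreal" where
  "pair_cost G V d = (\<lambda>(x, y). e2ennreal (G x y + V x + V y + ereal d))"

definition total_cost :: "('a \<times> 'a \<Rightarrow> ennreal) \<Rightarrow> nat \<Rightarrow> (nat \<Rightarrow> 'a) \<Rightarrow> ennreal" where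
  "total_cost q n x = (\<Sum>(i, j)\<in>pairs n. q (x i, x j))"

definition exp_neg :: "ennreal \<Rightarrow> ennreal" where
  "exp_neg z = exp_ereal (- enn2ereal z)"

lemma exp_neg_ennreal [simp]: "0 \<le> r \<Longrightarrow> exp_neg (ennreal r) = ennreal (exp (- r))"
  by (simp add: exp_neg_def exp_ereal_def)

lemma exp_neg_top [simp]: "exp_neg top = 0"
  by (simp add: exp_neg_def exp_ereal_def)

lemma sum_ereal_ne_minfty:
  fixes a :: "'i \<Rightarrow> ereal"
  assumes "\<And>i. i \<in> I \<Longrightarrow> a i \<noteq> -\<infinity>"
  shows "sum a I \<noteq> -\<infinity>"
  using assms by (induction I rule: infinite_finite_induct) auto

text \<open>The shift adds d for each of the n(n-1)/2 pairs, which the explicit exponential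
  compensates. Infinite values are treated apart, since the rearrangement needs finite terms: if
  some V (x i) is infinite, the product of the one-body factors vanishes; if only some G is
  infinite, the total cost is infinite. In both cases both sides are 0.\<close>

lemma exp_neg_hamiltonian:
  fixes G :: "'a \<Rightarrow> 'a \<Rightarrow> ereal" and V :: "'a \<Rightarrow> ereal"
  assumes V: "\<And>x. V x \<noteq> -\<infinity>" and G: "\<And>x y. G x y \<noteq> -\<infinity>"
    and d: "\<And>x y. ereal (- d) \<le> G x y + V x + V y" and n: "0 < n"
  shows "exp_ereal (- hamiltonian G V n x) =
    (\<Prod>i=1..n. exp_ereal (- V (x i))) *
      (ennreal (exp (d * (real n * (real n - 1) / 2))) * exp_neg (total_cost (pair_cost G V d) n x))"
proof -
  have H: "hamiltonian G V n x = (\<Sum>(i, j)\<in>pairs n. G (x i) (x j)) + ereal (real n) * (\<Sum>i=1..n. V (x i))"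
    by (simp add: hamiltonian_def pairs_def)
  have SG: "(\<Sum>(i, j)\<in>pairs n. G (x i) (x j)) \<noteq> -\<infinity>"
    by (rule sum_ereal_ne_minfty) (use G in auto)
  have SV: "(\<Sum>i=1..n. V (x i)) \<noteq> -\<infinity>"
    by (rule sum_ereal_ne_minfty) (use V in auto)
  show ?thesis
  proof (cases "\<exists>i\<in>{1..n}. V (x i) = \<infinity>")
    case True
    then have "(\<Sum>i=1..n. V (x i)) = \<infinity>"
      by (subst sum_Pinfty) auto
    then have "hamiltonian G V n x = \<infinity>"
      unfolding H using SG n by (simp add: ereal_mult_infty)
    moreover have "(\<Prod>i=1..n. exp_ereal (- V (x i))) = 0"
      using True by (auto simp: exp_ereal_def intro!: prod_zero bexI)
    ultimately show ?thesis by (simp add: exp_ereal_def)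
  next
    case False
    define v where "v i = real_of_ereal (V (x i))" for i
    have v: "V (x i) = ereal (v i)" if "i \<in> {1..n}" for i
      using False V[of "x i"] that by (cases "V (x i)") (auto simp: v_def)
    have SV': "(\<Sum>i=1..n. V (x i)) = ereal (\<Sum>i=1..n. v i)"
      unfolding sum_ereal[symmetric] by (intro sum.cong refl v)
    show ?thesis
    proof (cases "\<exists>(i, j)\<in>pairs n. G (x i) (x j) = \<infinity>")
      case True
      then obtain i j where ij: "(i, j) \<in> pairs n" "G (x i) (x j) = \<infinity>" by auto
      then have "(\<Sum>(i, j)\<in>pairs n. G (x i) (x j)) = \<infinity>"
        by (subst sum_Pinfty) force
      then have "hamiltonian G V n x = \<infinity>"
        unfolding H SV' by simp
      moreover have "total_cost (pair_cost G V d) n x = top"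
      proof -
        have "pair_cost G V d (x i, x j) = top"
          using ij v[of i] v[of j] by (auto simp: pair_cost_def pairs_def)
        then have "top \<le> total_cost (pair_cost G V d) n x"
          unfolding total_cost_def
          using member_le_sum[of "(i, j)" "pairs n" "\<lambda>(i, j). pair_cost G V d (x i, x j)"] ij by simp
        then show ?thesis by (simp add: top_unique)
      qed
      ultimately show ?thesis by (simp add: exp_ereal_def)
    next
      case noG: False
      define g where "g i j = real_of_ereal (G (x i) (x j))" for i j
      have g: "G (x i) (x j) = ereal (g i j)" if "(i, j) \<in> pairs n" for i j
        using noG G[of "x i" "x j"] that by (cases "G (x i) (x j)") (auto simp: g_def)
      have pv: "V (x i) = ereal (v i)" "V (x j) = ereal (v j)" if "(i, j) \<in> pairs n" for i j
        using that v[of i] v[of j] by (auto simp: pairs_def)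
      have SG': "(\<Sum>(i, j)\<in>pairs n. G (x i) (x j)) = ereal (\<Sum>(i, j)\<in>pairs n. g i j)"
        unfolding sum_ereal[symmetric] by (intro sum.cong refl) (auto simp: g)
      have H': "hamiltonian G V n x = ereal ((\<Sum>(i, j)\<in>pairs n. g i j) + real n * (\<Sum>i=1..n. v i))"
        unfolding H SG' SV' by simp
      have nn: "0 \<le> g i j + v i + v j + d" if "(i, j) \<in> pairs n" for i j
        using d[of "x i" "x j"] g[OF that] pv[OF that] by simp
      have "total_cost (pair_cost G V d) n x = (\<Sum>(i, j)\<in>pairs n. ennreal (g i j + v i + v j + d))"
        unfolding total_cost_def by (intro sum.cong refl) (auto simp: pair_cost_def g pv)
      also have "\<dots> = ennreal (\<Sum>(i, j)\<in>pairs n. g i j + v i + v j + d)"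
        using nn by (subst sum_ennreal[symmetric]) (auto simp: case_prod_beta')
      also have "(\<Sum>(i, j)\<in>pairs n. g i j + v i + v j + d) =
          (\<Sum>(i, j)\<in>pairs n. g i j) + (\<Sum>(i, j)\<in>pairs n. v i + v j) + d * real (card (pairs n))"
        by (simp add: case_prod_beta' sum.distrib)
      also have "\<dots> = (\<Sum>(i, j)\<in>pairs n. g i j) + (real n - 1) * (\<Sum>i=1..n. v i) + d * (real n * (real n - 1) / 2)"
        by (simp only: card_pairs sum_pairs_add)
      finally have T: "total_cost (pair_cost G V d) n x = ennreal \<dots>" .
      have nnT: "0 \<le> (\<Sum>(i, j)\<in>pairs n. g i j) + (real n - 1) * (\<Sum>i=1..n. v i) + d * (real n * (real n - 1) / 2)"
      proof -
        have "0 \<le> (\<Sum>(i, j)\<in>pairs n. g i j + v i + v j + d)"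
          using nn by (intro sum_nonneg) auto
        also have "\<dots> = (\<Sum>(i, j)\<in>pairs n. g i j) + (\<Sum>(i, j)\<in>pairs n. v i + v j) + d * real (card (pairs n))"
          by (simp add: case_prod_beta' sum.distrib)
        finally show ?thesis by (simp only: card_pairs sum_pairs_add)
      qed
      have "(\<Prod>i=1..n. exp_ereal (- V (x i))) = (\<Prod>i=1..n. ennreal (exp (- v i)))"
        by (intro prod.cong refl) (simp add: v exp_ereal_def)
      also have "\<dots> = ennreal (exp (- (\<Sum>i=1..n. v i)))"
        by (subst prod_ennreal) (auto simp: exp_sum sum_negf[symmetric])
      finally have P: "(\<Prod>i=1..n. exp_ereal (- V (x i))) = \<dots>" .
      show ?thesis
        unfolding P T exp_neg_ennreal[OF nnT] H'
        by (simp add: exp_ereal_def ennreal_mult[symmetric] exp_add[symmetric] algebra_simps)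
    qed
  qed
qed

section \<open>Energies, logarithms and empirical measures\<close>

lemma lower_semicontinuous_add:
  fixes f g :: "'b::topological_space \<Rightarrow> ereal"
  assumes "lower_semicontinuous f" "lower_semicontinuous g"
    and "\<And>x. f x \<noteq> -\<infinity>" "\<And>x. g x \<noteq> -\<infinity>"
  shows "lower_semicontinuous (\<lambda>x. f x + g x)"
  unfolding lower_semicontinuous_def
proof
  fix c
  show "open {x. c < f x + g x}"
  proof (subst open_subopen, intro ballI)
    fix x assume "x \<in> {x. c < f x + g x}"
    then obtain r where r: "c < ereal r" "ereal r < f x + g x"
      using ereal_dense2[of c "f x + g x"] by auto
    \<comment> \<open>For finite summands the slack \<open>u + v - r\<close> is shared equally; an
      infinite summand can take up whatever the other leaves.\<close>
    obtain a b :: real where ab: "ereal a < f x" "ereal b < g x" "r \<le> a + b"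
    proof (cases "f x" "g x" rule: ereal2_cases)
      case (real_real u v)
      then show ?thesis
        using that[of "u - (u + v - r) / 2" "v - (u + v - r) / 2"] r by (auto simp: field_simps)
    next
      case (real_PInf u)
      then show ?thesis using that[of "u - 1" "r - u + 1"] by simp
    next
      case (PInf_real v)
      then show ?thesis using that[of "r - v + 1" "v - 1"] by simp
    next
      case PInf_PInf
      then show ?thesis using that[of r 0] by simp
    qed (use assms in auto)
    have "c < f y + g y" if "ereal a < f y" "ereal b < g y" for y
    proof -
      have "c < ereal a + ereal b" using r(1) ab(3) by (metis ereal_less_eq(3) less_le_trans plus_ereal.simps(1))
      also have "\<dots> \<le> f y + g y" using that by (intro add_mono) auto
      finally show ?thesis .
    qed
    then show "\<exists>T. open T \<and> x \<in> T \<and> T \<subseteq> {x. c < f x + g x}"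
      using assms(1,2) ab unfolding lower_semicontinuous_def
      by (intro exI[of _ "{y. ereal a < f y} \<inter> {y. ereal b < g y}"]) auto
  qed
qed

lemma lower_semicontinuous_compose:
  assumes "lower_semicontinuous f" "continuous_on UNIV g"
  shows "lower_semicontinuous (\<lambda>x. f (g x))"
  unfolding lower_semicontinuous_def
proof
  fix c
  have "open (g -` {y. c < f y})"
    using assms by (intro open_vimage) (simp_all add: lower_semicontinuous_def)
  then show "open {x. c < f (g x)}" by (simp add: vimage_def)
qed

lemma lower_semicontinuous_const: "lower_semicontinuous (\<lambda>_. c)"
  by (simp add: lower_semicontinuous_def)

lemma borel_measurable_lower_semicontinuous:
  "lower_semicontinuous f \<Longrightarrow> f \<in> borel_measurable borel"
  unfolding lower_semicontinuous_def by (intro borel_measurableI_greater) (simp add: borel_open)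

lemma lower_semicontinuous_interaction:
  fixes G :: "'a::topological_space \<Rightarrow> 'a \<Rightarrow> ereal"
  assumes "\<And>x. V x \<noteq> -\<infinity>" "lower_semicontinuous V"
    and "\<And>x y. G x y \<noteq> -\<infinity>" "lower_semicontinuous (\<lambda>(x, y). G x y)"
  shows "lower_semicontinuous (\<lambda>(x, y). G x y + V x + V y)"
proof -
  have V1: "lower_semicontinuous (\<lambda>z. V (fst z) :: ereal)"
    by (rule lower_semicontinuous_compose[OF assms(2)]) (intro continuous_intros)
  have V2: "lower_semicontinuous (\<lambda>z. V (snd z) :: ereal)"
    by (rule lower_semicontinuous_compose[OF assms(2)]) (intro continuous_intros)
  have GV: "lower_semicontinuous (\<lambda>z. (case z of (x, y) \<Rightarrow> G x y) + V (fst z))"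
    by (rule lower_semicontinuous_add[OF assms(4) V1]) (use assms(1,3) in auto)
  have "lower_semicontinuous (\<lambda>z. (case z of (x, y) \<Rightarrow> G x y) + V (fst z) + V (snd z))"
    by (rule lower_semicontinuous_add[OF GV V2]) (use assms(1,3) in auto)
  then show ?thesis by (simp add: case_prod_beta')
qed

lemma open_pair_cost:
  assumes "lower_semicontinuous (\<lambda>(x, y). G x y + V x + V y)"
    and "\<And>x. V x \<noteq> -\<infinity>" "\<And>x y. G x y \<noteq> -\<infinity>"
  shows "open {z. t < pair_cost G V d z}"
proof -
  have "lower_semicontinuous (\<lambda>z. (case z of (x, y) \<Rightarrow> G x y + V x + V y) + ereal d)"
    by (intro lower_semicontinuous_add assms lower_semicontinuous_const) (use assms(2,3) in auto)
  then have "open {z. enn2ereal t < (case z of (x, y) \<Rightarrow> G x y + V x + V y) + ereal d}"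
    by (auto simp: lower_semicontinuous_def)
  moreover have "t < e2ennreal y \<longleftrightarrow> enn2ereal t < y" for y
  proof (cases "0 \<le> y")
    case True
    then show ?thesis by (metis enn2ereal_e2ennreal less_ennreal.rep_eq)
  next
    case False
    then have "e2ennreal y = 0" by (simp add: e2ennreal_neg)
    moreover have "\<not> enn2ereal t < y" using False enn2ereal_nonneg[of t] by (meson less_imp_le order_trans)
    ultimately show ?thesis by simp
  qed
  ultimately show ?thesis by (simp add: pair_cost_def case_prod_beta')
qed

lemma ereal_integral_shift:
  assumes "prob_space N" and h[measurable]: "h \<in> borel_measurable N"
    and "0 \<le> d" and hd: "\<And>x. ereal (- d) \<le> h x"
  shows "ereal_integral N h = enn2ereal (\<integral>\<^sup>+ x. e2ennreal (h x + ereal d) \<partial>N) - ereal d"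
proof -
  interpret prob_space N by fact
  have pt: "e2ennreal (h x + ereal d) + e2ennreal (- h x) = e2ennreal (h x) + ennreal d" for x
  proof (cases "h x")
    case (real r)
    then show ?thesis
      using hd[of x] \<open>0 \<le> d\<close> by (cases "0 \<le> r") (auto simp: ennreal_neg simp flip: ennreal_plus)
  qed (use hd[of x] in auto)
  have neg: "e2ennreal (- h x) \<le> ennreal d" for x
    using hd[of x] e2ennreal_mono[of "- h x" "ereal d"] by (cases "h x") auto
  have "(\<integral>\<^sup>+ x. e2ennreal (- h x) \<partial>N) \<le> (\<integral>\<^sup>+ x. ennreal d \<partial>N)"
    by (intro nn_integral_mono neg)
  then have B: "(\<integral>\<^sup>+ x. e2ennreal (- h x) \<partial>N) \<le> ennreal d"
    by (simp add: emeasure_space_1)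
  have "(\<integral>\<^sup>+ x. e2ennreal (h x + ereal d) \<partial>N) + (\<integral>\<^sup>+ x. e2ennreal (- h x) \<partial>N) =
     (\<integral>\<^sup>+ x. e2ennreal (h x + ereal d) + e2ennreal (- h x) \<partial>N)"
    by (rule nn_integral_add[symmetric]) measurable
  also have "\<dots> = (\<integral>\<^sup>+ x. e2ennreal (h x) \<partial>N) + ennreal d"
    unfolding pt by (subst nn_integral_add) (auto simp: emeasure_space_1)
  finally have eq: "(\<integral>\<^sup>+ x. e2ennreal (h x + ereal d) \<partial>N) + (\<integral>\<^sup>+ x. e2ennreal (- h x) \<partial>N) =
     (\<integral>\<^sup>+ x. e2ennreal (h x) \<partial>N) + ennreal d" .
  obtain b where b: "(\<integral>\<^sup>+ x. e2ennreal (- h x) \<partial>N) = ennreal b" "0 \<le> b"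
    using B by (metis ennreal_cases ennreal_less_top leD)
  show ?thesis
    using eq b \<open>0 \<le> d\<close> unfolding ereal_integral_def b(1)
    by (cases "\<integral>\<^sup>+ x. e2ennreal (h x + ereal d) \<partial>N"; cases "\<integral>\<^sup>+ x. e2ennreal (h x) \<partial>N")
       (auto simp: top_unique simp flip: ennreal_plus)
qed

lemma prob_space_pair:
  assumes "prob_space M" shows "prob_space (M \<Otimes>\<^sub>M M)"
proof -
  interpret pair_prob_space M M
    using assms by (simp add: pair_prob_space_def pair_sigma_finite_def prob_space_imp_sigma_finite)
  show ?thesis by unfold_locales
qed

lemma energy_eq:
  fixes G :: "'a::second_countable_topology \<Rightarrow> 'a \<Rightarrow> ereal"
  assumes "\<mu> \<in> prob_measures" "lower_semicontinuous (\<lambda>(x, y). G x y + V x + V y)"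
    and "0 \<le> d" "\<And>x y. ereal (- d) \<le> G x y + V x + V y"
  shows "energy G V \<mu> = ereal (1/2) * (enn2ereal (\<integral>\<^sup>+ z. pair_cost G V d z \<partial>(\<mu> \<Otimes>\<^sub>M \<mu>)) - ereal d)"
proof -
  have \<mu>: "prob_space \<mu>" "sets \<mu> = sets borel" using assms(1) by (auto simp: prob_measures_def)
  have "(\<lambda>(x, y). G x y + V x + V y) \<in> borel_measurable (\<mu> \<Otimes>\<^sub>M \<mu>)"
    using borel_measurable_lower_semicontinuous[OF assms(2)] measurable_cong_sets[OF sets_pair_borel[OF \<mu>(2)] refl]
    by blast
  from ereal_integral_shift[OF prob_space_pair[OF \<mu>(1)] this assms(3)] assms(4)
  show ?thesis by (simp add: energy_def pair_cost_def case_prod_beta')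
qed

lemma scaled_ln_le:
  assumes "0 < c" "Z \<le> ennreal (exp (c * t))"
  shows "ereal (1 / c) * ln_ennreal Z \<le> ereal t"
proof (cases Z)
  case (real r)
  show ?thesis
  proof (cases "r = 0")
    case False
    with real have "0 < r" by simp
    then have "ln r \<le> c * t" using assms(2) real by (metis exp_gt_zero exp_ge_zero ennreal_le_iff ln_exp ln_le_cancel_iff)
    then show ?thesis using real \<open>0 < r\<close> \<open>0 < c\<close> by (simp add: ln_ennreal_def field_simps)
  qed (use real \<open>0 < c\<close> in \<open>simp add: ln_ennreal_def\<close>)
qed (use assms in \<open>simp add: top_unique\<close>)

lemma scaled_ln_ge:
  assumes "0 < c" "ennreal (exp (c * t)) \<le> Z"
  shows "ereal t \<le> ereal (1 / c) * ln_ennreal Z"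
proof (cases Z)
  case (real r)
  have "exp (c * t) \<le> r" using assms(2) real by (simp add: ennreal_le_iff)
  then have "0 < r" by (metis exp_gt_zero less_le_trans)
  then have "c * t \<le> ln r" using \<open>exp (c * t) \<le> r\<close> by (simp add: ln_ge_iff)
  then show ?thesis using real \<open>0 < r\<close> \<open>0 < c\<close> by (simp add: ln_ennreal_def field_simps)
qed (use assms in \<open>simp add: ln_ennreal_def\<close>)

text \<open>As an image of the uniform law on the indices, the empirical measure counts repeated
  points with multiplicity, and integrals against it become finite sums by change of
  variables.\<close>

lemma empirical_measure_eq_distr:
  assumes "0 < n"
  shows "empirical_measure n x = distr (uniform_count_measure {1..n}) borel x"
proof (rule measure_eqI)
  fix A assume "A \<in> sets (empirical_measure n x)"
  then have A: "A \<in> sets borel" by simp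
  have "(\<Sum>i=1..n. indicator A (x i) :: ennreal) = of_nat (card ({1..n} \<inter> {i. x i \<in> A}))"
    by (simp add: indicator_def)
  moreover have "x -` A \<inter> {1..n} = {1..n} \<inter> {i. x i \<in> A}" by auto
  ultimately show "emeasure (empirical_measure n x) A = emeasure (distr (uniform_count_measure {1..n}) borel x) A"
    using A assms
    by (subst emeasure_distr)
       (auto simp: emeasure_empirical_measure space_uniform_count_measure emeasure_uniform_count_measure
         measurable_def sets_uniform_count_measure divide_ennreal[symmetric] ennreal_of_nat_eq_real_of_nat)
qed simp

lemma nn_integral_empirical_measure:
  assumes "0 < n" "h \<in> borel_measurable borel"
  shows "(\<integral>\<^sup>+ y. h y \<partial>empirical_measure n x) = (\<Sum>i=1..n. h (x i)) / of_nat n"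
proof -
  have "(\<integral>\<^sup>+ y. h y \<partial>empirical_measure n x) = (\<integral>\<^sup>+ i. h (x i) \<partial>uniform_count_measure {1..n})"
    unfolding empirical_measure_eq_distr[OF assms(1)] using assms(2)
    by (subst nn_integral_distr) (auto simp: measurable_def space_uniform_count_measure sets_uniform_count_measure)
  also have "\<dots> = (\<Sum>i=1..n. h (x i)) / of_nat n"
    using assms(1)
    by (simp add: uniform_count_measure_def nn_integral_point_measure_finite sum_distrib_right[symmetric]
       divide_ennreal_def ennreal_of_nat_eq_real_of_nat inverse_ennreal inverse_eq_divide[symmetric] mult.commute flip: sum_distrib_left)
  finally show ?thesis .
qed

lemma integral_empirical_measure:
  fixes h :: "'a::topological_space \<Rightarrow> real"
  assumes "0 < n" "h \<in> borel_measurable borel"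
  shows "(LINT y|empirical_measure n x. h y) = (\<Sum>i=1..n. h (x i)) / real n"
proof -
  have "(LINT y|empirical_measure n x. h y) = (LINT i|uniform_count_measure {1..n}. h (x i))"
    unfolding empirical_measure_eq_distr[OF assms(1)] using assms(2)
    by (subst integral_distr) (auto simp: measurable_def space_uniform_count_measure sets_uniform_count_measure)
  also have "\<dots> = (\<Sum>i=1..n. h (x i)) / real n"
    by (subst integral_uniform_count_measure) auto
  finally show ?thesis .
qed

section \<open>Limit points of empirical measures with bounded energy\<close>

text \<open>Used twice: with A the complement of a compact set it gives tightness from bounded
  energy, and with c = \<open>top\<close> it shows that finite energy forces V to be finite almost
  everywhere.\<close>

lemma emeasure_times_le_nn_integral:
  assumes "prob_space \<mu>" and A: "A \<in> sets \<mu>" and le: "\<And>z. z \<in> A \<times> A \<Longrightarrow> c \<le> h z"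
  shows "c * (emeasure \<mu> A)\<^sup>2 \<le> (\<integral>\<^sup>+ z. h z \<partial>(\<mu> \<Otimes>\<^sub>M \<mu>))"
proof -
  interpret prob_space \<mu> by fact
  have "c * (emeasure \<mu> A)\<^sup>2 = (\<integral>\<^sup>+ z. c * indicator (A \<times> A) z \<partial>(\<mu> \<Otimes>\<^sub>M \<mu>))"
    using A by (subst nn_integral_cmult_indicator) (auto simp: emeasure_pair_measure_Times power2_eq_square)
  also have "\<dots> \<le> (\<integral>\<^sup>+ z. h z \<partial>(\<mu> \<Otimes>\<^sub>M \<mu>))"
    using le by (intro nn_integral_mono) (auto simp: indicator_def)
  finally show ?thesis .
qed

lemma nn_integral_pair_empirical_measure:
  fixes h :: "'a::second_countable_topology \<times> 'a \<Rightarrow> ennreal"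
  assumes n: "0 < n" and h[measurable]: "h \<in> borel_measurable borel"
  shows "(\<integral>\<^sup>+ z. h z \<partial>(empirical_measure n x \<Otimes>\<^sub>M empirical_measure n x)) =
    (\<Sum>i=1..n. \<Sum>j=1..n. h (x i, x j)) / of_nat n / of_nat n"
proof -
  let ?e = "empirical_measure n x"
  interpret prob_space ?e using empirical_measure_in_prob_measures[OF n] by (auto simp: prob_measures_def)
  have [measurable]: "h \<in> borel_measurable (borel \<Otimes>\<^sub>M borel)" unfolding borel_prod by fact
  have h': "h \<in> borel_measurable (?e \<Otimes>\<^sub>M ?e)"
    using h measurable_cong_sets[OF sets_pair_borel[OF sets_empirical_measure] refl] by blast
  have "(\<integral>\<^sup>+ z. h z \<partial>(?e \<Otimes>\<^sub>M ?e)) = (\<integral>\<^sup>+ u. \<integral>\<^sup>+ v. h (u, v) \<partial>?e \<partial>?e)"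
    by (rule nn_integral_fst[symmetric, OF h'])
  also have "\<dots> = (\<integral>\<^sup>+ u. (\<Sum>j=1..n. h (u, x j)) / of_nat n \<partial>?e)"
    by (intro nn_integral_cong nn_integral_empirical_measure n) measurable
  also have "\<dots> = (\<Sum>i=1..n. (\<Sum>j=1..n. h (x i, x j)) / of_nat n) / of_nat n"
    by (intro nn_integral_empirical_measure n) measurable
  finally show ?thesis by (simp add: divide_ennreal_def sum_distrib_right)
qed

text \<open>Truncating the cost makes the diagonal terms, which the Hamiltonian omits, of lower order.\<close>

lemma truncated_energy_empirical_le:
  fixes q :: "'a::second_countable_topology \<times> 'a \<Rightarrow> ennreal"
  assumes n: "0 < n" and q: "q \<in> borel_measurable borel" and sym: "\<And>x y. q (x, y) = q (y, x)"
    and T: "total_cost q n x = ennreal T" "0 \<le> T" and C: "0 \<le> C"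
  shows "(\<integral>\<^sup>+ z. min (q z) (ennreal C) \<partial>(empirical_measure n x \<Otimes>\<^sub>M empirical_measure n x))
    \<le> ennreal (2 * T / (real n)\<^sup>2 + C / real n)"
proof -
  define a where "a i j = min (q (x i, x j)) (ennreal C)" for i j
  have "(\<integral>\<^sup>+ z. min (q z) (ennreal C) \<partial>(empirical_measure n x \<Otimes>\<^sub>M empirical_measure n x)) =
      (\<Sum>i=1..n. \<Sum>j=1..n. a i j) / of_nat n / of_nat n"
    unfolding a_def by (rule nn_integral_pair_empirical_measure[OF n]) (use q in measurable)
  also have "(\<Sum>i=1..n. \<Sum>j=1..n. a i j) = (\<Sum>(i, j)\<in>pairs n. a i j) + (\<Sum>(i, j)\<in>pairs n. a i j) + (\<Sum>i=1..n. a i i)"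
    by (rule sum_symmetric_pairs) (simp add: a_def sym)
  also have "\<dots> \<le> ennreal T + ennreal T + (\<Sum>i=1..n. ennreal C)"
    unfolding T(1)[symmetric] total_cost_def
    by (intro add_mono sum_mono) (auto simp: a_def)
  also have "\<dots> = ennreal (2 * T + C * real n)"
    using T C by (simp add: ennreal_mult[symmetric] ennreal_of_nat_eq_real_of_nat mult.commute flip: ennreal_plus)
  finally have "(\<integral>\<^sup>+ z. min (q z) (ennreal C) \<partial>(empirical_measure n x \<Otimes>\<^sub>M empirical_measure n x))
      \<le> ennreal (2 * T + C * real n) / of_nat n / of_nat n"
    by (auto intro!: divide_right_mono_ennreal)
  also have "\<dots> = ennreal ((2 * T + C * real n) / real n / real n)"
    using n T C by (simp add: ennreal_of_nat_eq_real_of_nat divide_ennreal del: ennreal_plus)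
  also have "(2 * T + C * real n) / real n / real n = 2 * T / (real n)\<^sup>2 + C / real n"
    using n by (simp add: field_simps power2_eq_square)
  finally show ?thesis .
qed

text \<open>The factor 2 arises because the total cost counts unordered pairs while the product
  measure counts ordered ones. Along the good configurations the truncated energies are at most
  \<open>2 * (a - f) + C / n\<close>. This gives tightness and a cluster measure \<nu>. Continuity
  of f and lower semicontinuity carry the bound to \<nu> for each C, and monotone convergence
  removes the truncation.\<close>

lemma empirical_energy_cluster:
  fixes q :: "'a::polish_space \<times> 'a \<Rightarrow> ennreal" and f :: "'a measure \<Rightarrow> real"
  assumes q_open: "\<And>t. open {z. t < q z}" and sym: "\<And>x y. q (x, y) = q (y, x)"
    and confining: "\<And>C. 0 \<le> C \<Longrightarrow> \<exists>K. compact K \<and> (\<forall>x\<in>-K. \<forall>y\<in>-K. ennreal C \<le> q (x, y))"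
    and f: "continuous_map weak_topology euclideanreal f" and B: "\<And>\<mu>. \<mu> \<in> prob_measures \<Longrightarrow> \<bar>f \<mu>\<bar> \<le> B"
    and freq: "\<exists>\<^sub>F n in sequentially. \<exists>x T. 0 \<le> T \<and> total_cost q n x = ennreal T \<and>
        f (empirical_measure n x) + T / (real n)\<^sup>2 \<le> a"
  obtains \<nu> where "\<nu> \<in> prob_measures" "f \<nu> \<le> a"
    "(\<integral>\<^sup>+ z. q z \<partial>(\<nu> \<Otimes>\<^sub>M \<nu>)) \<le> ennreal (2 * (a - f \<nu>))"
proof -
  define P where "P n \<longleftrightarrow> 0 < n \<and> (\<exists>x T. 0 \<le> T \<and> total_cost q n x = ennreal T \<and>
        f (empirical_measure n x) + T / (real n)\<^sup>2 \<le> a)" for n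
  have "\<exists>\<^sub>F n in sequentially. P n"
    using frequently_eventually_frequently[OF freq eventually_gt_at_top[of 0]]
    by (rule frequently_elim1) (auto simp: P_def)
  then have F0: "inf sequentially (principal {n. P n}) \<noteq> bot"
    by (auto simp: trivial_limit_def eventually_inf_principal frequently_def)
  define F where "F = inf sequentially (principal {n. P n})"
  have evP: "\<forall>\<^sub>F n in F. P n" by (simp add: F_def eventually_inf_principal)
  have F_le: "F \<le> sequentially" by (simp add: F_def)
  have "\<exists>x T. P n \<longrightarrow> 0 \<le> T \<and> total_cost q n x = ennreal T \<and>
        f (empirical_measure n x) + T / (real n)\<^sup>2 \<le> a" for n
    by (auto simp: P_def)
  then obtain X T where XT: "\<And>n. P n \<Longrightarrow> 0 \<le> T n \<and> total_cost q n (X n) = ennreal (T n) \<and>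
        f (empirical_measure n (X n)) + T n / (real n)\<^sup>2 \<le> a"
    by metis
  \<comment> \<open>\<open>Suc (n - 1)\<close> equals n for n > 0 and replaces n = 0, where the
    empirical measure is not a probability, by 1. Thus every \<mu> n is a probability
    measure.\<close>
  define \<mu> where "\<mu> n = empirical_measure (Suc (n - 1)) (X n)" for n
  have \<mu>_eq: "\<mu> n = empirical_measure n (X n)" if "P n" for n
    using that by (simp add: \<mu>_def P_def)
  have \<mu>_in: "\<mu> n \<in> prob_measures" for n
    unfolding \<mu>_def by (rule empirical_measure_in_prob_measures) simp
  then have \<mu>: "\<And>n. prob_space (\<mu> n)" "\<And>n. sets (\<mu> n) = sets borel"
    by (auto simp: prob_measures_def)
  have q_meas: "q \<in> borel_measurable borel"
    using q_open by (intro borel_measurableI_greater) (simp add: borel_open)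
  have qC_meas: "(\<lambda>z. min (q z) (ennreal C)) \<in> borel_measurable borel" for C
    using q_meas by measurable
  have trunc: "(\<integral>\<^sup>+ z. min (q z) (ennreal C) \<partial>(\<mu> n \<Otimes>\<^sub>M \<mu> n)) \<le> ennreal (2 * (a - f (\<mu> n)) + C / real n)"
    if "P n" "0 \<le> C" for n C
  proof -
    have "(\<integral>\<^sup>+ z. min (q z) (ennreal C) \<partial>(\<mu> n \<Otimes>\<^sub>M \<mu> n)) \<le> ennreal (2 * T n / (real n)\<^sup>2 + C / real n)"
      unfolding \<mu>_eq[OF that(1)] using XT[OF that(1)] that
      by (intro truncated_energy_empirical_le q_meas sym) (auto simp: P_def)
    also have "\<dots> \<le> ennreal (2 * (a - f (\<mu> n)) + C / real n)"
      using XT[OF that(1)] by (intro ennreal_leI) (simp add: \<mu>_eq[OF that(1)])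
    finally show ?thesis .
  qed
  define D where "D = max 0 (2 * (a + B))"
  have D: "2 * (a - f (\<mu> n)) \<le> D" for n
    using B[OF \<mu>_in[of n]] by (auto simp: D_def)
  have D0: "0 \<le> D" by (simp add: D_def)
  have tight: "\<exists>K. compact K \<and> (\<forall>\<^sub>F n in F. 1 - e \<le> measure (\<mu> n) K)" if "0 < e" for e :: real
  proof -
    \<comment> \<open>For n > C the truncated energy is at most \<open>D + 1\<close>, where the 1
      covers the diagonal term \<open>C / n\<close>. Outside K \<times> K-neighbouring pairs, namely
      on \<open>-K \<times> -K\<close>, the truncated cost equals C, so
      \<open>C * measure (\<mu> n) (- K) ^ 2 \<le> D + 1\<close>, and this C makes the square at
      most half of the square of e.\<close>
    define C where "C = 2 * (D + 1) / e\<^sup>2"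
    have C: "0 < C" using \<open>0 < e\<close> by (auto simp: C_def D_def intro!: divide_pos_pos add_nonneg_pos)
    obtain K where K: "compact K" "\<And>x y. x \<notin> K \<Longrightarrow> y \<notin> K \<Longrightarrow> ennreal C \<le> q (x, y)"
      using confining[of C] C by auto
    have "\<forall>\<^sub>F n in sequentially. C < real n"
      using eventually_gt_at_top[of "nat \<lceil>C\<rceil>"] by eventually_elim linarith
    then have "\<forall>\<^sub>F n in F. C < real n" by (rule filter_leD[OF F_le])
    with evP have "\<forall>\<^sub>F n in F. 1 - e \<le> measure (\<mu> n) K"
    proof eventually_elim
      case (elim n)
      interpret \<mu>: prob_space "\<mu> n" by (rule \<mu>)
      have Kc: "- K \<in> sets (\<mu> n)" and Ks: "K \<in> sets (\<mu> n)" using K \<mu>(2) by (auto simp: borel_compact borel_comp)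
      have sp: "space (\<mu> n) = UNIV" using sets_eq_imp_space_eq[OF \<mu>(2)] by simp
      have "ennreal C * (emeasure (\<mu> n) (- K))\<^sup>2 \<le> (\<integral>\<^sup>+ z. min (q z) (ennreal C) \<partial>(\<mu> n \<Otimes>\<^sub>M \<mu> n))"
        using K by (intro emeasure_times_le_nn_integral \<mu> Kc) auto
      also have "\<dots> \<le> ennreal (2 * (a - f (\<mu> n)) + C / real n)"
        using elim C by (intro trunc) auto
      also have "\<dots> \<le> ennreal (D + 1)"
        using D[of n] elim C by (intro ennreal_leI add_mono) auto
      finally have "ennreal (C * (measure (\<mu> n) (- K))\<^sup>2) \<le> ennreal (D + 1)"
        using C by (simp add: \<mu>.emeasure_eq_measure ennreal_mult[symmetric] ennreal_power del: ennreal_plus)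
      then have "C * (measure (\<mu> n) (- K))\<^sup>2 \<le> D + 1"
        using D0 by (subst (asm) ennreal_le_iff) auto
      then have "2 * (D + 1) * (measure (\<mu> n) (- K))\<^sup>2 \<le> (D + 1) * e\<^sup>2"
        using \<open>0 < e\<close> by (simp add: C_def field_simps)
      then have "(D + 1) * (2 * (measure (\<mu> n) (- K))\<^sup>2) \<le> (D + 1) * e\<^sup>2" by (simp add: algebra_simps)
      then have "2 * (measure (\<mu> n) (- K))\<^sup>2 \<le> e\<^sup>2"
        by (rule mult_left_le_imp_le) (simp add: D_def add_nonneg_pos)
      then have "(measure (\<mu> n) (- K))\<^sup>2 \<le> e\<^sup>2" by (smt (verit) zero_le_power2)
      then have "measure (\<mu> n) (- K) \<le> e"
        by (rule power2_le_imp_le) (use \<open>0 < e\<close> in simp)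
      then show ?case
        using \<mu>.prob_compl[OF Ks] by (simp add: sp Compl_eq_Diff_UNIV)
    qed
    with K show ?thesis by blast
  qed
  have "F \<noteq> bot" using F0 by (simp add: F_def)
  then obtain \<nu> F' where F': "F' \<le> F" "F' \<noteq> bot" and \<nu>: "prob_space \<nu>" "sets \<nu> = sets borel"
    and lim: "open_liminf_ge \<mu> \<nu> F'"
    by (rule tight_imp_cluster_measure[OF _ \<mu> tight])
  have \<nu>_in: "\<nu> \<in> prob_measures" using \<nu> by (simp add: prob_measures_def)
  have "limitin weak_topology \<mu> \<nu> F'"
    using \<mu>_in \<nu>_in open_liminf_tendsto[OF lim \<mu> \<nu>] by (intro limitin_weak_topologyI) auto
  from continuous_map_limit[OF f this]
  have f_lim: "((\<lambda>n. f (\<mu> n)) \<longlongrightarrow> f \<nu>) F'" by (simp add: comp_def)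
  have evP': "\<forall>\<^sub>F n in F'. P n" using evP F'(1) by (rule filter_leD[rotated])
  have pair_\<mu>: "prob_space (\<mu> n \<Otimes>\<^sub>M \<mu> n)" "sets (\<mu> n \<Otimes>\<^sub>M \<mu> n) = sets borel" for n
    by (intro prob_space_pair \<mu>) (intro sets_pair_borel \<mu>)
  have pair_\<nu>: "prob_space (\<nu> \<Otimes>\<^sub>M \<nu>)" "sets (\<nu> \<Otimes>\<^sub>M \<nu>) = sets borel"
    by (intro prob_space_pair \<nu>) (intro sets_pair_borel \<nu>)
  have inv_lim: "((\<lambda>n. C / real n) \<longlongrightarrow> 0) F'" for C
    using filterlim_mono[OF lim_const_over_n order_refl order_trans[OF F'(1) F_le]] .
  \<comment> \<open>The sign is recorded too: \<open>ennreal\<close> sends negative numbers to 0, so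
    the second inequality alone would not give \<open>f \<nu> \<le> a\<close>.\<close>
  have bound: "0 \<le> 2 * (a - f \<nu>) \<and> (\<integral>\<^sup>+ z. min (q z) (ennreal C) \<partial>(\<nu> \<Otimes>\<^sub>M \<nu>)) \<le> ennreal (2 * (a - f \<nu>))"
    if C: "0 \<le> C" for C
  proof -
    \<comment> \<open>Truncation makes the cost a bounded real function with open superlevel sets,
      the form to which \<open>open_liminf_integral\<close> applies.\<close>
    define h where "h z = enn2real (min (q z) (ennreal C))" for z
    have h_enn: "ennreal (h z) = min (q z) (ennreal C)" for z
      unfolding h_def by (rule ennreal_enn2real) (simp add: min_less_iff_disj)
    have h_bound: "0 \<le> h z" "\<bar>h z\<bar> \<le> C" for z
    proof -
      show "0 \<le> h z" by (simp add: h_def)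
      have "ennreal (h z) \<le> ennreal C" by (simp add: h_enn)
      then show "\<bar>h z\<bar> \<le> C" using C \<open>0 \<le> h z\<close> by (simp add: ennreal_le_iff)
    qed
    have h_open: "open {z. t < h z}" for t
    proof (cases "0 \<le> t")
      case True
      then have eq: "{z. t < h z} = {z. ennreal t < q z \<and> ennreal t < ennreal C}"
        using h_enn by (auto simp: ennreal_less_iff[symmetric] simp del: ennreal_less_iff)
      show ?thesis unfolding eq using q_open[of "ennreal t"] by (cases "ennreal t < ennreal C") simp_all
    next
      case False
      then have "{z. t < h z} = UNIV" using h_bound(1) by (auto intro: less_le_trans[of _ 0])
      then show ?thesis by simp
    qed
    have int_eq: "(\<integral>\<^sup>+ z. min (q z) (ennreal C) \<partial>N) = ennreal (LINT z|N. h z)"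
      if "prob_space N" "sets N = sets borel" for N
    proof -
      interpret N: prob_space N by fact
      have "h \<in> borel_measurable N" by (rule borel_measurable_open_superlevel[OF h_open that(2)])
      then have "integrable N h" by (intro N.integrable_const_bound[where B=C]) (use h_bound in auto)
      then show ?thesis unfolding h_enn[symmetric] using h_bound by (intro nn_integral_eq_integral) auto
    qed
    have lower: "(LINT z|(\<nu> \<Otimes>\<^sub>M \<nu>). h z) - e \<le> 2 * (a - f \<nu>)" if "0 < e" for e
    proof (rule tendsto_lowerbound[OF _ _ F'(2)])
      show "((\<lambda>n. 2 * (a - f (\<mu> n)) + C / real n) \<longlongrightarrow> 2 * (a - f \<nu>)) F'"
        using tendsto_add[OF tendsto_mult[OF tendsto_const[of 2] tendsto_diff[OF tendsto_const[of a] f_lim]] inv_lim[of C]]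
        by simp
      have "\<forall>\<^sub>F n in F'. (LINT z|(\<nu> \<Otimes>\<^sub>M \<nu>). h z) - e < (LINT z|(\<mu> n \<Otimes>\<^sub>M \<mu> n). h z)"
        by (rule open_liminf_integral[OF open_liminf_ge_pair[OF lim \<mu> \<nu>] pair_\<mu> pair_\<nu> h_open h_bound(2) \<open>0 < e\<close>])
      with evP' show "\<forall>\<^sub>F n in F'. (LINT z|(\<nu> \<Otimes>\<^sub>M \<nu>). h z) - e \<le> 2 * (a - f (\<mu> n)) + C / real n"
      proof eventually_elim
        case (elim n)
        have "ennreal (LINT z|(\<mu> n \<Otimes>\<^sub>M \<mu> n). h z) \<le> ennreal (2 * (a - f (\<mu> n)) + C / real n)"
          unfolding int_eq[OF pair_\<mu>, symmetric] by (rule trunc[OF elim(1) C])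
        moreover have "0 \<le> 2 * (a - f (\<mu> n)) + C / real n"
        proof -
          have "0 \<le> T n / (real n)\<^sup>2" using XT[OF elim(1)] by simp
          then have "f (\<mu> n) \<le> a" using XT[OF elim(1)] unfolding \<mu>_eq[OF elim(1)] by linarith
          then show ?thesis using C by simp
        qed
        ultimately have "(LINT z|(\<mu> n \<Otimes>\<^sub>M \<mu> n). h z) \<le> 2 * (a - f (\<mu> n)) + C / real n"
          by (simp add: ennreal_le_iff)
        with elim show ?case by linarith
      qed
    qed
    have le: "(LINT z|(\<nu> \<Otimes>\<^sub>M \<nu>). h z) \<le> 2 * (a - f \<nu>)"
    proof (rule field_le_epsilon)
      show "(LINT z|(\<nu> \<Otimes>\<^sub>M \<nu>). h z) \<le> 2 * (a - f \<nu>) + e" if "0 < e" for e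
        using lower[OF that] by simp
    qed
    moreover have "0 \<le> (LINT z|(\<nu> \<Otimes>\<^sub>M \<nu>). h z)" using h_bound by (intro integral_nonneg_AE) auto
    ultimately show ?thesis unfolding int_eq[OF pair_\<nu>] by (auto intro: ennreal_leI)
  qed
  have "(\<integral>\<^sup>+ z. q z \<partial>(\<nu> \<Otimes>\<^sub>M \<nu>)) = (\<integral>\<^sup>+ z. (SUP k::nat. min (q z) (ennreal (real k))) \<partial>(\<nu> \<Otimes>\<^sub>M \<nu>))"
  proof (intro nn_integral_cong antisym SUP_least)
    fix z
    show "q z \<le> (SUP k::nat. min (q z) (ennreal (real k)))"
    proof (cases "q z")
      case (real r)
      obtain k :: nat where "r \<le> real k" using real_arch_simple by blast
      then have "q z = min (q z) (ennreal (real k))" using real by (simp add: min_absorb1 ennreal_leI)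
      then show ?thesis by (metis SUP_upper UNIV_I)
    next
      case top
      have "(SUP k::nat. ennreal (real k)) = top"
        using ennreal_SUP_of_nat_eq_top unfolding ennreal_of_nat_eq_real_of_nat .
      then show ?thesis by (simp only: top min_absorb2[OF top_greatest] order_refl)
    qed
  qed auto
  also have "\<dots> = (SUP k::nat. \<integral>\<^sup>+ z. min (q z) (ennreal (real k)) \<partial>(\<nu> \<Otimes>\<^sub>M \<nu>))"
  proof (rule nn_integral_monotone_convergence_SUP)
    show "incseq (\<lambda>k z. min (q z) (ennreal (real k)))"
      by (intro incseq_SucI le_funI min.mono ennreal_leI) auto
  qed (use qC_meas measurable_cong_sets[OF pair_\<nu>(2) refl] in auto)
  also have "\<dots> \<le> ennreal (2 * (a - f \<nu>))"
    using bound by (intro SUP_least) simp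
  finally show ?thesis
    using that[OF \<nu>_in] bound[of 0] by simp
qed

section \<open>Product measures and empirical averages\<close>

lemma distr_PiM_pair:
  assumes \<mu>: "prob_space \<mu>" and ij: "i \<in> I" "j \<in> I" "i \<noteq> j" and I: "finite I"
  shows "distr (PiM I (\<lambda>_. \<mu>)) (\<mu> \<Otimes>\<^sub>M \<mu>) (\<lambda>x. (x i, x j)) = \<mu> \<Otimes>\<^sub>M \<mu>"
proof (rule pair_measure_eqI[symmetric])
  interpret prob_space \<mu> by fact
  show "sigma_finite_measure \<mu>" "sigma_finite_measure \<mu>" by unfold_locales
  interpret P: product_sigma_finite "\<lambda>_. \<mu>" by unfold_locales
  fix A B assume AB: "A \<in> sets \<mu>" "B \<in> sets \<mu>"
  let ?Y = "\<lambda>k. if k = i then A else if k = j then B else space \<mu>"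
  have [measurable]: "(\<lambda>x. (x i, x j)) \<in> measurable (PiM I (\<lambda>_. \<mu>)) (\<mu> \<Otimes>\<^sub>M \<mu>)"
    using ij by measurable
  have "(\<lambda>x. (x i, x j)) -` (A \<times> B) \<inter> space (PiM I (\<lambda>_. \<mu>)) = PiE I ?Y"
  proof (intro set_eqI iffI)
    fix x assume x: "x \<in> PiE I ?Y"
    have "x k \<in> space \<mu>" if "k \<in> I" for k
      using PiE_mem[OF x that] AB[THEN sets.sets_into_space] by (auto split: if_splits)
    moreover have "x i \<in> A" "x j \<in> B" "x \<in> extensional I"
      using PiE_mem[OF x ij(1)] PiE_mem[OF x ij(2)] ij(3) x by (auto simp: PiE_def)
    ultimately show "x \<in> (\<lambda>x. (x i, x j)) -` (A \<times> B) \<inter> space (PiM I (\<lambda>_. \<mu>))"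
      by (auto simp: space_PiM PiE_iff)
  qed (auto simp: space_PiM PiE_iff)
  then have "emeasure (distr (PiM I (\<lambda>_. \<mu>)) (\<mu> \<Otimes>\<^sub>M \<mu>) (\<lambda>x. (x i, x j))) (A \<times> B) = emeasure (PiM I (\<lambda>_. \<mu>)) (PiE I ?Y)"
    using AB by (subst emeasure_distr) auto
  also have "\<dots> = (\<Prod>k\<in>I. emeasure \<mu> (?Y k))"
    using AB I by (intro P.emeasure_PiM) auto
  also have "\<dots> = (\<Prod>k\<in>{i, j}. emeasure \<mu> (?Y k))"
    using ij I by (intro prod.mono_neutral_right) (auto simp: emeasure_space_1)
  also have "\<dots> = emeasure \<mu> A * emeasure \<mu> B" using ij by simp
  finally show "emeasure \<mu> A * emeasure \<mu> B =
      emeasure (distr (PiM I (\<lambda>_. \<mu>)) (\<mu> \<Otimes>\<^sub>M \<mu>) (\<lambda>x. (x i, x j))) (A \<times> B)" by simp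
qed simp

lemma measurable_pair_coordinates:
  fixes q :: "'a::second_countable_topology \<times> 'a \<Rightarrow> ennreal"
  assumes "q \<in> borel_measurable borel" "sets M = sets borel" "i \<in> I" "j \<in> I"
  shows "(\<lambda>x. q (x i, x j)) \<in> borel_measurable (PiM I (\<lambda>_. M))"
proof -
  have "q \<in> borel_measurable (M \<Otimes>\<^sub>M M)"
    using assms(1) measurable_cong_sets[OF sets_pair_borel[OF assms(2)] refl] by blast
  moreover have "(\<lambda>x. (x i, x j)) \<in> measurable (PiM I (\<lambda>_. M)) (M \<Otimes>\<^sub>M M)"
    using assms(3,4) by measurable
  ultimately show ?thesis by (rule measurable_compose[rotated])
qed

lemma measurable_total_cost:
  fixes q :: "'a::second_countable_topology \<times> 'a \<Rightarrow> ennreal"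
  assumes "q \<in> borel_measurable borel" "sets M = sets borel"
  shows "total_cost q n \<in> borel_measurable (PiM {1..n} (\<lambda>_. M))"
proof -
  have "(\<lambda>x. \<Sum>p\<in>pairs n. q (x (fst p), x (snd p))) \<in> borel_measurable (PiM {1..n} (\<lambda>_. M))"
    by (intro borel_measurable_sum measurable_pair_coordinates assms) (auto simp: pairs_def)
  then show ?thesis by (simp add: total_cost_def[abs_def] case_prod_beta')
qed

text \<open>Two distinct coordinates always have joint law \<mu> \<otimes> \<mu>, so every pair
  contributes the same expectation and linearity finishes.\<close>

lemma nn_integral_total_cost:
  fixes q :: "'a::second_countable_topology \<times> 'a \<Rightarrow> ennreal"
  assumes q: "q \<in> borel_measurable borel" and \<mu>: "prob_space \<mu>" "sets \<mu> = sets borel"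
  shows "(\<integral>\<^sup>+ x. total_cost q n x \<partial>PiM {1..n} (\<lambda>_. \<mu>)) =
    ennreal (real n * (real n - 1) / 2) * (\<integral>\<^sup>+ z. q z \<partial>(\<mu> \<Otimes>\<^sub>M \<mu>))"
proof -
  have q': "q \<in> borel_measurable (\<mu> \<Otimes>\<^sub>M \<mu>)"
    using q measurable_cong_sets[OF sets_pair_borel[OF \<mu>(2)] refl] by blast
  have *: "(\<integral>\<^sup>+ x. q (x i, x j) \<partial>PiM {1..n} (\<lambda>_. \<mu>)) = (\<integral>\<^sup>+ z. q z \<partial>(\<mu> \<Otimes>\<^sub>M \<mu>))"
    if "(i, j) \<in> pairs n" for i j
  proof -
    have ij: "i \<in> {1..n}" "j \<in> {1..n}" "i \<noteq> j" using that by (auto simp: pairs_def)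
    have m: "(\<lambda>x. (x i, x j)) \<in> measurable (PiM {1..n} (\<lambda>_. \<mu>)) (\<mu> \<Otimes>\<^sub>M \<mu>)"
      using ij(1,2) by measurable
    show ?thesis
      by (subst distr_PiM_pair[OF \<mu>(1) ij finite_atLeastAtMost, symmetric], subst nn_integral_distr[OF m])
         (simp_all add: q')
  qed
  have "(\<integral>\<^sup>+ x. total_cost q n x \<partial>PiM {1..n} (\<lambda>_. \<mu>)) =
      (\<integral>\<^sup>+ x. (\<Sum>p\<in>pairs n. q (x (fst p), x (snd p))) \<partial>PiM {1..n} (\<lambda>_. \<mu>))"
    by (simp add: total_cost_def case_prod_beta')
  also have "\<dots> = (\<Sum>p\<in>pairs n. \<integral>\<^sup>+ x. q (x (fst p), x (snd p)) \<partial>PiM {1..n} (\<lambda>_. \<mu>))"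
    by (intro nn_integral_sum measurable_pair_coordinates q \<mu>) (auto simp: pairs_def)
  also have "\<dots> = (\<Sum>p\<in>pairs n. \<integral>\<^sup>+ z. q z \<partial>(\<mu> \<Otimes>\<^sub>M \<mu>))"
    by (intro sum.cong refl *) simp
  also have "\<dots> = ennreal (real (card (pairs n))) * (\<integral>\<^sup>+ z. q z \<partial>(\<mu> \<Otimes>\<^sub>M \<mu>))"
    by (simp add: ennreal_of_nat_eq_real_of_nat)
  finally show ?thesis by (simp only: card_pairs)
qed

lemma PiM_indep_coordinates:
  assumes \<mu>: "prob_space \<mu>" and I: "I \<noteq> {}"
  shows "prob_space.indep_vars (PiM I (\<lambda>_. \<mu>)) (\<lambda>_. \<mu>) (\<lambda>i x. x i) I"
proof -
  interpret P: prob_space "PiM I (\<lambda>_. \<mu>)" using \<mu> by (intro prob_space_PiM)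
  show ?thesis
  proof (subst P.indep_vars_iff_distr_eq_PiM'[OF I])
    have "distr (PiM I (\<lambda>_. \<mu>)) (PiM I (\<lambda>_. \<mu>)) (\<lambda>x. \<lambda>i\<in>I. x i) = distr (PiM I (\<lambda>_. \<mu>)) (PiM I (\<lambda>_. \<mu>)) (\<lambda>x. x)"
      by (intro distr_cong refl) (auto simp: space_PiM PiE_def extensional_restrict)
    also have "\<dots> = PiM I (\<lambda>_. \<mu>)" by (rule distr_id)
    also have "\<dots> = (\<Pi>\<^sub>M i\<in>I. distr (PiM I (\<lambda>_. \<mu>)) \<mu> (\<lambda>x. x i))"
      using \<mu> by (intro PiM_cong refl distr_PiM_component[symmetric])
    finally show "distr (PiM I (\<lambda>_. \<mu>)) (PiM I (\<lambda>_. \<mu>)) (\<lambda>x. \<lambda>i\<in>I. x i) = (\<Pi>\<^sub>M i\<in>I. distr (PiM I (\<lambda>_. \<mu>)) \<mu> (\<lambda>x. x i))" .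
  qed simp
qed

lemma weak_law_of_large_numbers:
  fixes g :: "'a \<Rightarrow> real"
  assumes \<mu>: "prob_space \<mu>" and g[measurable]: "g \<in> borel_measurable \<mu>" and B: "\<And>x. \<bar>g x\<bar> \<le> B"
    and n: "0 < n" and e: "0 \<le> e"
  shows "measure (PiM {1..n} (\<lambda>_. \<mu>)) {x\<in>space (PiM {1..n} (\<lambda>_. \<mu>)). e \<le> \<bar>(\<Sum>i=1..n. g (x i)) / real n - (LINT y|\<mu>. g y)\<bar>}
    \<le> 2 * exp (- 2 * real n * e\<^sup>2 / (2 * B + 1)\<^sup>2)"
proof -
  let ?P = "PiM {1..n} (\<lambda>_. \<mu>)"
  interpret P: prob_space ?P using \<mu> by (intro prob_space_PiM)
  have one: "1 \<in> {1..n}" using n by simp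
  have d: "distr ?P borel (\<lambda>x. g (x i)) = distr \<mu> borel g" if "i \<in> {1..n}" for i
  proof -
    have "distr \<mu> borel g = distr (distr ?P \<mu> (\<lambda>x. x i)) borel g"
      using \<mu> that by (subst distr_PiM_component) auto
    also have "\<dots> = distr ?P borel (\<lambda>x. g (x i))"
      using that by (subst distr_distr) (auto simp: comp_def)
    finally show ?thesis by simp
  qed
  have m1[measurable]: "(\<lambda>x. g (x 1)) \<in> borel_measurable ?P"
    using one by measurable
  have "P.indep_vars (\<lambda>_. borel) (\<lambda>i x. g (x i)) {1..n}"
    by (rule P.indep_vars_compose2[OF PiM_indep_coordinates[OF \<mu>]]) (use one in auto)
  \<comment> \<open>The upper end \<open>B + 1\<close> instead of \<open>B\<close> gives the
    interval positive length even if \<open>B = 0\<close>; hence the width \<open>2 * B + 1\<close>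
    in the bound.\<close>
  then interpret H: Hoeffding_ineq_iid ?P "{1..n}" "\<lambda>i x. g (x i)" "\<lambda>x. g (x 1)" "- B" "B + 1" "P.expectation (\<lambda>x. g (x 1))"
  proof unfold_locales
    show "distr ?P borel (\<lambda>x. g (x i)) = distr ?P borel (\<lambda>x. g (x 1))" if "i \<in> {1..n}" for i
      using d[OF that] d[OF one] by simp
    show "AE x in ?P. g (x 1) \<in> {- B..B + 1}"
      using B by (intro AE_I2) (auto simp: abs_le_iff add_increasing2 minus_le_iff)
  qed (use m1 in \<open>auto simp del: One_nat_def\<close>)
  have "P.expectation (\<lambda>x. g (x 1)) = (LINT y|distr ?P \<mu> (\<lambda>x. x 1). g y)"
    using one by (subst integral_distr) auto
  also have "distr ?P \<mu> (\<lambda>x. x 1) = \<mu>" using \<mu> one by (intro distr_PiM_component)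
  finally have E: "P.expectation (\<lambda>x. g (x 1)) = (LINT y|\<mu>. g y)" .
  have "0 \<le> B" using B[of undefined] by linarith
  then show ?thesis
    using H.Hoeffding_ineq_abs_ge'[OF e] n unfolding E by (simp add: add.commute add.assoc)
qed

text \<open>The law of large numbers in a topology given by a subbase, by induction over the
  generated open sets. Hoeffding's inequality treats subbasic sets, inclusion-exclusion treats
  intersections, and for a union one member containing \<mu> suffices. The sets \<open>E n\<close>
  are measurable subsets of the preimage of U, so measurability of the preimage itself never
  arises.\<close>

lemma empirical_measure_in_neighbourhood:
  fixes \<mu> :: "'a::topological_space measure"
  assumes "openin weak_topology U" "\<mu> \<in> U"
  obtains E where "\<forall>n. E n \<in> sets (PiM {1..n} (\<lambda>_. \<mu>))"
    "\<forall>n>0. \<forall>x\<in>E n. empirical_measure n x \<in> U"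
    "(\<lambda>n. measure (PiM {1..n} (\<lambda>_. \<mu>)) (E n)) \<longlonglongrightarrow> 1"
proof -
  have "U \<subseteq> prob_measures" using openin_subset[OF assms(1)] by simp
  then have \<mu>: "prob_space \<mu>" "sets \<mu> = sets borel" using assms(2) by (auto simp: prob_measures_def)
  have P: "prob_space (PiM {1..n} (\<lambda>_. \<mu>))" for n :: nat using \<mu> by (intro prob_space_PiM)
  define good where "good E U \<longleftrightarrow> (\<forall>n. E n \<in> sets (PiM {1..n} (\<lambda>_. \<mu>))) \<and>
      (\<forall>n x. 0 < n \<longrightarrow> x \<in> E n \<longrightarrow> empirical_measure n x \<in> U) \<and>
      (\<lambda>n. measure (PiM {1..n} (\<lambda>_. \<mu>)) (E n)) \<longlonglongrightarrow> 1" for E U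
  have "generate_topology_on {{\<mu> \<in> prob_measures. (LINT x|\<mu>. g x) \<in> U} | (g :: 'a \<Rightarrow> real) (U :: real set).
        continuous_on UNIV g \<and> bounded (range g) \<and> open U} U"
    using assms(1) unfolding weak_topology_def openin_topology_generated_by_iff by auto
  then have "\<exists>E. good E U"
    using assms(2)
  proof (induction rule: generate_topology_on.induct)
    case (Int a b)
    then obtain E E' where good: "good E a" "good E' b" by blast
    have E: "\<And>n. E n \<in> sets (PiM {1..n} (\<lambda>_. \<mu>))" "\<And>n x. 0 < n \<Longrightarrow> x \<in> E n \<Longrightarrow> empirical_measure n x \<in> a"
      "(\<lambda>n. measure (PiM {1..n} (\<lambda>_. \<mu>)) (E n)) \<longlonglongrightarrow> 1"
      using good(1) unfolding good_def by blast+
    have E': "\<And>n. E' n \<in> sets (PiM {1..n} (\<lambda>_. \<mu>))" "\<And>n x. 0 < n \<Longrightarrow> x \<in> E' n \<Longrightarrow> empirical_measure n x \<in> b"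
      "(\<lambda>n. measure (PiM {1..n} (\<lambda>_. \<mu>)) (E' n)) \<longlonglongrightarrow> 1"
      using good(2) unfolding good_def by blast+
    have "(\<lambda>n. measure (PiM {1..n} (\<lambda>_. \<mu>)) (E n \<inter> E' n)) \<longlonglongrightarrow> 1"
    proof (rule tendsto_sandwich)
      show "(\<lambda>n. measure (PiM {1..n} (\<lambda>_. \<mu>)) (E n) + measure (PiM {1..n} (\<lambda>_. \<mu>)) (E' n) - 1) \<longlonglongrightarrow> 1"
        using tendsto_diff[OF tendsto_add[OF E(3) E'(3)] tendsto_const[of 1]] by simp
      show "\<forall>\<^sub>F n in sequentially. measure (PiM {1..n} (\<lambda>_. \<mu>)) (E n) + measure (PiM {1..n} (\<lambda>_. \<mu>)) (E' n) - 1
          \<le> measure (PiM {1..n} (\<lambda>_. \<mu>)) (E n \<inter> E' n)"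
      proof (intro always_eventually allI)
        fix n :: nat
        interpret P: prob_space "PiM {1..n} (\<lambda>_. \<mu>)" by (rule P)
        have "P.prob (E n \<union> E' n) = P.prob (E n) + P.prob (E' n) - P.prob (E n \<inter> E' n)"
          using E(1) E'(1) by (intro measure_Un3) (auto simp: P.fmeasurable_eq_sets simp del: One_nat_def)
        then show "P.prob (E n) + P.prob (E' n) - 1 \<le> P.prob (E n \<inter> E' n)"
          using P.prob_le_1[of "E n \<union> E' n"] by linarith
      qed
      show "\<forall>\<^sub>F n in sequentially. measure (PiM {1..n} (\<lambda>_. \<mu>)) (E n \<inter> E' n) \<le> 1"
        using prob_space.prob_le_1[OF P] by auto
    qed auto
    then show ?case
      using E E' unfolding good_def by (intro exI[of _ "\<lambda>n. E n \<inter> E' n"]) auto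
  next
    case (UN K)
    then obtain k where k: "k \<in> K" "\<mu> \<in> k" by auto
    from UN.IH[OF this] obtain E where "good E k" by blast
    then show ?case using k(1) unfolding good_def by (intro exI[of _ E]) blast
  next
    case (Basis s)
    then obtain g :: "'a \<Rightarrow> real" and U where g: "continuous_on UNIV g" "bounded (range g)" "open U"
      and s: "s = {\<mu> \<in> prob_measures. (LINT x|\<mu>. g x) \<in> U}" by auto
    from Basis s obtain e where e: "0 < e" "\<And>y. \<bar>y - (LINT x|\<mu>. g x)\<bar> < e \<Longrightarrow> y \<in> U"
      using g(3) unfolding open_dist by (force simp: dist_real_def)
    obtain B where B: "\<And>x. \<bar>g x\<bar> \<le> B" using g(2) by (auto simp: bounded_iff)
    have gm: "g \<in> borel_measurable borel" using g(1) by (rule borel_measurable_continuous_onI)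
    then have gm'[measurable]: "g \<in> borel_measurable \<mu>" using measurable_cong_sets[OF \<mu>(2) refl] by blast
    define D where "D n = {x\<in>space (PiM {1..n} (\<lambda>_. \<mu>)). e \<le> \<bar>(\<Sum>i=1..n. g (x i)) / real n - (LINT y|\<mu>. g y)\<bar>}" for n :: nat
    have D[measurable]: "D n \<in> sets (PiM {1..n} (\<lambda>_. \<mu>))" for n unfolding D_def by measurable
    define E where "E n = space (PiM {1..n} (\<lambda>_. \<mu>)) - D n" for n
    have "0 \<le> B" using B[of undefined] by linarith
    have "(\<lambda>n. measure (PiM {1..n} (\<lambda>_. \<mu>)) (E n)) \<longlonglongrightarrow> 1"
    proof (rule tendsto_sandwich)
      show "\<forall>\<^sub>F n in sequentially. 1 - 2 * exp (- 2 * real n * e\<^sup>2 / (2 * B + 1)\<^sup>2) \<le> measure (PiM {1..n} (\<lambda>_. \<mu>)) (E n)"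
        using eventually_gt_at_top[of 0]
      proof eventually_elim
        case (elim n)
        interpret P: prob_space "PiM {1..n} (\<lambda>_. \<mu>)" by (rule P)
        show ?case
          unfolding E_def using weak_law_of_large_numbers[OF \<mu>(1) gm' B elim, of e] e(1) P.prob_compl[OF D]
          unfolding D_def[symmetric] by simp
      qed
      have "(\<lambda>n. 1 - 2 * exp (- 2 * real n * c)) \<longlonglongrightarrow> 1" if "0 < c" for c :: real
        using that by real_asymp
      from this[of "e\<^sup>2 / (2 * B + 1)\<^sup>2"]
      have "(\<lambda>n. 1 - 2 * exp (- 2 * real n * (e\<^sup>2 / (2 * B + 1)\<^sup>2))) \<longlonglongrightarrow> 1"
        using e(1) \<open>0 \<le> B\<close> by simp
      then show "(\<lambda>n. 1 - 2 * exp (- 2 * real n * e\<^sup>2 / (2 * B + 1)\<^sup>2)) \<longlonglongrightarrow> 1" by simp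
      show "\<forall>\<^sub>F n in sequentially. measure (PiM {1..n} (\<lambda>_. \<mu>)) (E n) \<le> 1"
        using prob_space.prob_le_1[OF P] by auto
    qed auto
    moreover have "empirical_measure n x \<in> s" if "0 < n" "x \<in> E n" for n x
      using that e(2) by (auto simp: s E_def D_def integral_empirical_measure[OF _ gm] not_le empirical_measure_in_prob_measures)
    moreover have "E n \<in> sets (PiM {1..n} (\<lambda>_. \<mu>))" for n unfolding E_def by measurable
    ultimately show ?case unfolding good_def by (intro exI[of _ E]) blast
  qed auto
  then obtain E where "good E U" by blast
  then have "\<forall>n. E n \<in> sets (PiM {1..n} (\<lambda>_. \<mu>))" "\<forall>n>0. \<forall>x\<in>E n. empirical_measure n x \<in> U"
    "(\<lambda>n. measure (PiM {1..n} (\<lambda>_. \<mu>)) (E n)) \<longlonglongrightarrow> 1"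
    unfolding good_def by blast+
  then show ?thesis by (rule that)
qed

section \<open>The lower bound\<close>

lemma measurable_exp_ereal [measurable]: "exp_ereal \<in> borel_measurable borel"
proof -
  have eq: "exp_ereal = (\<lambda>y. if y = \<infinity> then \<infinity> else if y = -\<infinity> then 0 else ennreal (exp (real_of_ereal y)))"
    by (rule ext) (auto simp: exp_ereal_def split: ereal.splits)
  show ?thesis unfolding eq by measurable
qed

lemma measurable_exp_neg [measurable]: "exp_neg \<in> borel_measurable borel"
  unfolding exp_neg_def[abs_def] by measurable

lemma exp_neg_ge:
  assumes "0 \<le> s" "z \<le> ennreal s"
  shows "ennreal (exp (- s)) \<le> exp_neg z"
proof (cases z)
  case (real r)
  then show ?thesis using assms by (simp add: ennreal_le_iff)
qed (use assms in \<open>simp add: top_unique\<close>)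

lemma gibbs_measure_eq:
  fixes l :: "'a::second_countable_topology measure"
  assumes l: "sets l = sets borel"
    and V: "\<And>x. V x \<noteq> -\<infinity>" "lower_semicontinuous V" and G: "\<And>x y. G x y \<noteq> -\<infinity>"
    and GV: "lower_semicontinuous (\<lambda>(x, y). G x y + V x + V y)"
    and int: "(\<integral>\<^sup>+ x. exp_ereal (- V x) \<partial>l) < \<infinity>"
    and d: "\<And>x y. ereal (- d) \<le> G x y + V x + V y" and n: "0 < n"
  shows "gibbs_measure l G V n = density (PiM {1..n} (\<lambda>_. density l (\<lambda>x. exp_ereal (- V x))))
    (\<lambda>x. ennreal (exp (d * (real n * (real n - 1) / 2))) * exp_neg (total_cost (pair_cost G V d) n x))"
proof -
  let ?h = "\<lambda>x. ennreal (exp (d * (real n * (real n - 1) / 2))) * exp_neg (total_cost (pair_cost G V d) n x)"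
  have "V \<in> borel_measurable l"
    using borel_measurable_lower_semicontinuous[OF V(2)] measurable_cong_sets[OF l refl] by blast
  then have Vm: "(\<lambda>x. exp_ereal (- V x)) \<in> borel_measurable l" by measurable
  have nt: "exp_ereal (- V x) \<noteq> \<infinity>" for x
    using V(1)[of x] by (cases "V x") (auto simp: exp_ereal_def)
  have qm: "pair_cost G V d \<in> borel_measurable borel"
    using open_pair_cost[OF GV V(1) G] by (intro borel_measurableI_greater) (simp add: borel_open)
  note [measurable] = measurable_total_cost[OF qm l]
  have hm: "?h \<in> borel_measurable (PiM {1..n} (\<lambda>_. l))" by measurable
  have pm: "(\<lambda>x. \<Prod>i=1..n. exp_ereal (- V (x i))) \<in> borel_measurable (PiM {1..n} (\<lambda>_. l))"
    using Vm[measurable] by measurable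
  have "gibbs_measure l G V n = density (PiM {1..n} (\<lambda>_. l)) (\<lambda>x. (\<Prod>i=1..n. exp_ereal (- V (x i))) * ?h x)"
    unfolding gibbs_measure_def
    by (simp only: exp_neg_hamiltonian[where d = d, OF V(1) G d n])
  also have "\<dots> = density (density (PiM {1..n} (\<lambda>_. l)) (\<lambda>x. \<Prod>i=1..n. exp_ereal (- V (x i)))) ?h"
    by (rule density_density_eq[symmetric, OF pm hm])
  also have "density (PiM {1..n} (\<lambda>_. l)) (\<lambda>x. \<Prod>i=1..n. exp_ereal (- V (x i))) =
      PiM {1..n} (\<lambda>_. density l (\<lambda>x. exp_ereal (- V x)))"
    using n nt by (intro PiM_density[symmetric] Vm int) auto
  finally show ?thesis .
qed

lemma prod_le_power_ennreal:
  fixes f :: "'i \<Rightarrow> ennreal"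
  assumes "\<And>i. i \<in> I \<Longrightarrow> f i \<le> c"
  shows "prod f I \<le> c ^ card I"
  using assms by (induction I rule: infinite_finite_induct) (auto intro: mult_mono)

text \<open>Restrict to configurations whose empirical measure lies in U and whose total cost is at
  most s, slightly above its mean under \<mu>. They have \<mu>-probability at least a fixed p.
  Because the density of \<mu>^n with respect to m^n is at most R^n, their m^n-measure is at least p
  / R^n, and each of them has weight at least exp (-s).\<close>

lemma bounded_density_lower_bound:
  fixes m \<mu> :: "'a::second_countable_topology measure"
  assumes m: "finite_measure m" "sets m = sets borel"
    and r[measurable]: "r \<in> borel_measurable m" and rR: "\<And>x. r x \<le> ennreal R" and R: "1 \<le> R"
    and \<mu>: "\<mu> = density m r" "prob_space \<mu>"
    and q: "q \<in> borel_measurable borel" and J: "(\<integral>\<^sup>+ z. q z \<partial>(\<mu> \<Otimes>\<^sub>M \<mu>)) = ennreal J" "0 \<le> J"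
    and U: "openin weak_topology U" "\<mu> \<in> U" and e: "0 < e"
  shows "\<forall>\<^sub>F n in sequentially. \<exists>E\<in>sets (PiM {1..n} (\<lambda>_. m)). (\<forall>x\<in>E. empirical_measure n x \<in> U) \<and>
    ennreal (exp ((real n)\<^sup>2 * - (J / 2 + e))) \<le> (\<integral>\<^sup>+ x. exp_neg (total_cost q n x) * indicator E x \<partial>PiM {1..n} (\<lambda>_. m))"
proof -
  have sets\<mu>: "sets \<mu> = sets borel" using \<mu> m by simp
  have sP: "sets (PiM {1..n} (\<lambda>_. \<mu>)) = sets (PiM {1..n} (\<lambda>_. m))" for n :: nat
    by (intro sets_PiM_cong refl) (simp add: \<mu>)
  have rt: "r x \<noteq> \<infinity>" for x using rR[of x] by (auto simp: top_unique)
  have int_r: "(\<integral>\<^sup>+ x. r x \<partial>m) < \<infinity>"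
    using prob_space.emeasure_space_1[OF \<mu>(2)] by (simp add: \<mu> emeasure_density cong: nn_integral_cong)
  obtain E where E: "\<forall>n. E n \<in> sets (PiM {1..n} (\<lambda>_. \<mu>))" "\<forall>n>0. \<forall>x\<in>E n. empirical_measure n x \<in> U"
    "(\<lambda>n. measure (PiM {1..n} (\<lambda>_. \<mu>)) (E n)) \<longlonglongrightarrow> 1"
    by (rule empirical_measure_in_neighbourhood[OF U])
  \<comment> \<open>By Markov's inequality the cost reaches N (J + e), where N J is its mean, with
    probability at most J / (J + e) = 1 - 2 p. Since the law of large numbers event has probability
    above 1 - p, a set of probability at least p remains. The slack e is additive because J may be
    0.\<close>
  define p where "p = e / (2 * (J + e))"
  have p: "0 < p" using e J(2) by (simp add: p_def)
  have "\<forall>\<^sub>F n in sequentially. 1 - p < measure (PiM {1..n} (\<lambda>_. \<mu>)) (E n)"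
    by (rule order_tendstoD(1)[OF E(3)]) (use p in simp)
  \<comment> \<open>Half of e is spent on the Markov threshold, since s is at most n^2 (J + e) / 2.
    The other half absorbs the loss p / R^n.\<close>
  moreover have "\<forall>\<^sub>F n in sequentially. real n * ln R - ln p \<le> (real n)\<^sup>2 * (e / 2)"
    using e by real_asymp
  ultimately show ?thesis
    using eventually_ge_at_top[of 2]
  proof eventually_elim
    case (elim n)
    let ?P = "PiM {1..n} (\<lambda>_. \<mu>)" and ?Q = "PiM {1..n} (\<lambda>_. m)"
    interpret P: prob_space ?P using \<mu>(2) by (intro prob_space_PiM)
    define N where "N = real n * (real n - 1) / 2"
    have N: "0 < N" using elim by (simp add: N_def)
    define s where "s = N * (J + e)"
    have s: "0 < s" using N e J by (simp add: s_def)
    have Tm: "total_cost q n \<in> borel_measurable ?P" by (rule measurable_total_cost[OF q sets\<mu>])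
    define D where "D = {x\<in>space ?P. 1 \<le> ennreal (1 / s) * total_cost q n x}"
    have D: "D \<in> sets ?P" unfolding D_def using Tm by measurable
    have "emeasure ?P D \<le> ennreal (1 / s) * (\<integral>\<^sup>+ x. total_cost q n x * indicator (space ?P) x \<partial>?P)"
      unfolding D_def by (rule nn_integral_Markov_inequality) (use Tm in measurable)
    also have "(\<integral>\<^sup>+ x. total_cost q n x * indicator (space ?P) x \<partial>?P) = (\<integral>\<^sup>+ x. total_cost q n x \<partial>?P)"
      by (intro nn_integral_cong) simp
    also have "\<dots> = ennreal (N * J)"
      unfolding nn_integral_total_cost[OF q \<mu>(2) sets\<mu>] J(1) N_def[symmetric] using N J(2)
      by (subst ennreal_mult[symmetric]) auto
    also have "ennreal (1 / s) * \<dots> = ennreal (J / (J + e))"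
      using s N J(2) by (subst ennreal_mult[symmetric]) (auto simp: s_def)
    finally have "P.prob D \<le> J / (J + e)"
      unfolding P.emeasure_eq_measure using J(2) e by (simp add: ennreal_le_iff)
    also have "J / (J + e) = 1 - 2 * p"
      using e J(2) by (simp add: p_def field_simps)
    finally have PD: "P.prob D \<le> 1 - 2 * p" .
    define A where "A = E n - D"
    have A: "A \<in> sets ?P" unfolding A_def using E(1) D by blast
    have "P.prob (E n) \<le> P.prob (A \<union> D)"
      by (intro P.finite_measure_mono sets.Un A D) (auto simp: A_def)
    also have "\<dots> \<le> P.prob A + P.prob D" using A D by (intro measure_Un_le)
    finally have PA: "p \<le> P.prob A" using PD elim(1) by linarith
    have AQ: "A \<in> sets ?Q" using A sP by simp
    have cost: "total_cost q n x \<le> ennreal s" if "x \<in> A" for x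
    proof (cases "total_cost q n x")
      case (real t)
      have "x \<in> space ?P" using that A sets.sets_into_space by blast
      then have "\<not> 1 \<le> ennreal (1 / s) * ennreal t" using that real by (auto simp: A_def D_def)
      then have "t / s < 1" using s real by (simp add: ennreal_mult[symmetric] not_le)
      then show ?thesis using s real by (simp add: ennreal_leI)
    next
      case top
      have "x \<in> space ?P" using that A sets.sets_into_space by blast
      then show ?thesis using that top s by (auto simp: A_def D_def ennreal_mult_top)
    qed
    have "?P = density ?Q (\<lambda>x. \<Prod>i=1..n. r (x i))"
      unfolding \<mu>(1) using elim rt by (intro PiM_density r int_r) auto
    then have "emeasure ?P A = (\<integral>\<^sup>+ x. (\<Prod>i=1..n. r (x i)) * indicator A x \<partial>?Q)"
      using AQ by (simp add: emeasure_density)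
    also have "\<dots> \<le> (\<integral>\<^sup>+ x. ennreal (R ^ n) * indicator A x \<partial>?Q)"
    proof (intro nn_integral_mono mult_right_mono)
      fix x
      show "(\<Prod>i=1..n. r (x i)) \<le> ennreal (R ^ n)"
        using prod_le_power_ennreal[of "{1..n}" "\<lambda>i. r (x i)" "ennreal R"] rR R by (simp add: ennreal_power)
    qed simp
    also have "\<dots> = ennreal (R ^ n) * emeasure ?Q A"
      using AQ by (rule nn_integral_cmult_indicator)
    finally have "ennreal p \<le> ennreal (R ^ n) * emeasure ?Q A"
      unfolding P.emeasure_eq_measure using ennreal_leI[OF PA] by (rule order_trans[rotated])
    then have "ennreal (1 / R ^ n) * ennreal p \<le> ennreal (1 / R ^ n) * (ennreal (R ^ n) * emeasure ?Q A)"
      by (rule mult_left_mono) simp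
    also have "\<dots> = emeasure ?Q A"
      using R by (simp add: mult.assoc[symmetric] ennreal_mult[symmetric])
    finally have QA: "ennreal (p / R ^ n) \<le> emeasure ?Q A"
      using p R by (simp add: ennreal_mult[symmetric])
    have "exp ((real n)\<^sup>2 * - (J / 2 + e)) \<le> exp (- s + ln p - real n * ln R)"
    proof (subst exp_le_cancel_iff)
      have "s \<le> (real n)\<^sup>2 / 2 * (J + e)"
        unfolding s_def N_def using e J(2) by (intro mult_right_mono) (auto simp: power2_eq_square algebra_simps)
      then show "(real n)\<^sup>2 * - (J / 2 + e) \<le> - s + ln p - real n * ln R"
        using elim(2) by (simp add: algebra_simps)
    qed
    also have "\<dots> = exp (- s) * (p / R ^ n)"
      using p R by (simp add: exp_add exp_diff exp_of_nat_mult exp_minus field_simps)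
    finally have "ennreal (exp ((real n)\<^sup>2 * - (J / 2 + e))) \<le> ennreal (exp (- s)) * ennreal (p / R ^ n)"
      using p R by (subst ennreal_mult[symmetric]) (auto intro: ennreal_leI)
    also have "\<dots> \<le> ennreal (exp (- s)) * emeasure ?Q A"
      by (intro mult_left_mono QA) simp
    also have "\<dots> = (\<integral>\<^sup>+ x. ennreal (exp (- s)) * indicator A x \<partial>?Q)"
      using AQ by (rule nn_integral_cmult_indicator[symmetric])
    also have "\<dots> \<le> (\<integral>\<^sup>+ x. exp_neg (total_cost q n x) * indicator A x \<partial>?Q)"
      using cost s by (intro nn_integral_mono) (auto simp: indicator_def intro!: exp_neg_ge)
    finally show ?case
      using AQ E(2) elim by (intro bexI[of _ A]) (auto simp: A_def)
  qed
qed

text \<open>The density e^-V vanishes exactly where V = \<infinity>. A null set of the weighted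
  measure is thus l-null up to points with V = \<infinity>, and these are not charged by
  \<mu>.\<close>

lemma absolutely_continuous_density_exp:
  assumes l: "sets \<mu> = sets l" and V: "V \<in> borel_measurable l"
    and ac: "absolutely_continuous l \<mu>" and fin: "AE x in \<mu>. V x \<noteq> \<infinity>"
  shows "absolutely_continuous (density l (\<lambda>x. exp_ereal (- V x))) \<mu>"
  unfolding absolutely_continuous_def
proof
  fix A assume "A \<in> null_sets (density l (\<lambda>x. exp_ereal (- V x)))"
  moreover have "(\<lambda>x. exp_ereal (- V x)) \<in> borel_measurable l" using V by measurable
  ultimately have A: "A \<in> sets l" "AE x in l. x \<in> A \<longrightarrow> exp_ereal (- V x) = 0"
    by (auto simp: null_sets_density_iff)
  have *: "exp_ereal (- V x) = 0 \<longleftrightarrow> V x = \<infinity>" for x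
    by (cases "V x") (auto simp: exp_ereal_def)
  have "AE x in \<mu>. x \<in> A \<longrightarrow> V x = \<infinity>"
    using absolutely_continuous_AE[OF l ac A(2)] by (simp add: *)
  with fin have "AE x in \<mu>. x \<notin> A" by eventually_elim auto
  then show "A \<in> null_sets \<mu>" using A(1) l by (simp add: AE_iff_null_sets)
qed

lemma nn_integral_uniform_measure_le:
  assumes "B \<in> sets M" "h \<in> borel_measurable M"
  shows "(\<integral>\<^sup>+ x. h x \<partial>uniform_measure M B) \<le> (\<integral>\<^sup>+ x. h x \<partial>M) / emeasure M B"
proof -
  have "(\<integral>\<^sup>+ x. h x * indicator B x \<partial>M) \<le> (\<integral>\<^sup>+ x. h x \<partial>M)"
    by (intro nn_integral_mono) (simp add: indicator_def)
  then show ?thesis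
    unfolding nn_integral_uniform_measure[OF assms(2,1)] by (rule divide_right_mono_ennreal)
qed

lemma nn_integral_pair_uniform_measure_le:
  fixes q :: "'a::second_countable_topology \<times> 'a \<Rightarrow> ennreal"
  assumes "prob_space \<mu>" "sets \<mu> = sets borel" and B: "B \<in> sets \<mu>" "emeasure \<mu> B \<noteq> 0"
    and q: "q \<in> borel_measurable borel"
  shows "(\<integral>\<^sup>+ z. q z \<partial>(uniform_measure \<mu> B \<Otimes>\<^sub>M uniform_measure \<mu> B)) \<le>
    (\<integral>\<^sup>+ z. q z \<partial>(\<mu> \<Otimes>\<^sub>M \<mu>)) / emeasure \<mu> B / emeasure \<mu> B"
proof -
  interpret prob_space \<mu> by fact
  let ?u = "uniform_measure \<mu> B"
  interpret u: prob_space ?u using B by (intro prob_space_uniform_measure) auto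
  have q1[measurable]: "q \<in> borel_measurable (\<mu> \<Otimes>\<^sub>M \<mu>)"
    using q measurable_cong_sets[OF sets_pair_borel[OF assms(2)] refl] by blast
  have su: "sets ?u = sets borel" using assms(2) by simp
  have q2: "q \<in> borel_measurable (?u \<Otimes>\<^sub>M ?u)"
    using q measurable_cong_sets[OF sets_pair_borel[OF su] refl] by blast
  have "(\<integral>\<^sup>+ z. q z \<partial>(?u \<Otimes>\<^sub>M ?u)) = (\<integral>\<^sup>+ x. \<integral>\<^sup>+ y. q (x, y) \<partial>?u \<partial>?u)"
    by (rule u.nn_integral_fst[symmetric, OF q2])
  also have "\<dots> \<le> (\<integral>\<^sup>+ x. (\<integral>\<^sup>+ y. q (x, y) \<partial>\<mu>) / emeasure \<mu> B \<partial>?u)"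
  proof (rule nn_integral_mono)
    fix x assume "x \<in> space ?u"
    then show "(\<integral>\<^sup>+ y. q (x, y) \<partial>?u) \<le> (\<integral>\<^sup>+ y. q (x, y) \<partial>\<mu>) / emeasure \<mu> B"
      by (intro nn_integral_uniform_measure_le B) measurable
  qed
  also have "\<dots> \<le> (\<integral>\<^sup>+ x. (\<integral>\<^sup>+ y. q (x, y) \<partial>\<mu>) / emeasure \<mu> B \<partial>\<mu>) / emeasure \<mu> B"
    by (intro nn_integral_uniform_measure_le B) measurable
  also have "(\<integral>\<^sup>+ x. (\<integral>\<^sup>+ y. q (x, y) \<partial>\<mu>) / emeasure \<mu> B \<partial>\<mu>) = (\<integral>\<^sup>+ x. (\<integral>\<^sup>+ y. q (x, y) \<partial>\<mu>) \<partial>\<mu>) / emeasure \<mu> B"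
    by (rule nn_integral_divide) measurable
  also have "(\<integral>\<^sup>+ x. (\<integral>\<^sup>+ y. q (x, y) \<partial>\<mu>) \<partial>\<mu>) = (\<integral>\<^sup>+ z. q z \<partial>(\<mu> \<Otimes>\<^sub>M \<mu>))"
    by (rule nn_integral_fst[OF q1])
  finally show ?thesis .
qed

lemma integral_uniform_measure:
  fixes g :: "'b \<Rightarrow> real"
  assumes "finite_measure M" and B: "B \<in> sets M" "measure M B \<noteq> 0" and g: "g \<in> borel_measurable M"
  shows "(LINT x|uniform_measure M B. g x) = (LINT x|M. indicator B x * g x) / measure M B"
proof -
  interpret finite_measure M by fact
  have pos: "0 < measure M B" using B(2) by (simp add: zero_less_measure_iff)
  have "(\<lambda>x. indicator B x / emeasure M B) = (\<lambda>x. ennreal (indicator B x / measure M B))"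
    using pos divide_ennreal[of 1 "measure M B"] by (auto simp: indicator_def emeasure_eq_measure)
  then have "uniform_measure M B = density M (\<lambda>x. ennreal (indicator B x / measure M B))"
    by (simp only: uniform_measure_def)
  then have "(LINT x|uniform_measure M B. g x) = (LINT x|M. (indicator B x / measure M B) * g x)"
    using B g pos by (simp add: integral_real_density)
  also have "\<dots> = (LINT x|M. indicator B x * g x / measure M B)"
    by (simp add: mult.commute)
  finally show ?thesis by simp
qed

text \<open>Condition \<mu> on the set \<open>B k\<close> where its density is at most k. The
  probability \<open>b k\<close> of this set tends to 1, the conditioned density is at most
  \<open>k / b k\<close>, and dominated convergence gives weak convergence. The energy is controlled
  from above only, which is the direction that the lower bound on the partition function uses. For
  small k, \<open>b k\<close> may vanish, hence the eventual formulation.\<close>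

lemma bounded_density_approximation:
  fixes m \<mu> :: "'a::second_countable_topology measure"
  assumes m: "finite_measure m" "sets m = sets borel"
    and \<mu>: "\<mu> \<in> prob_measures" and ac: "absolutely_continuous m \<mu>"
  obtains \<mu>s :: "nat \<Rightarrow> 'a measure" and c :: "nat \<Rightarrow> real" where
    "\<forall>\<^sub>F k in sequentially. \<mu>s k \<in> prob_measures \<and>
       (\<exists>r R. r \<in> borel_measurable m \<and> (\<forall>x. r x \<le> ennreal R) \<and> 1 \<le> R \<and> \<mu>s k = density m r) \<and>
       (\<forall>q\<in>borel_measurable borel. (\<integral>\<^sup>+ z. q z \<partial>(\<mu>s k \<Otimes>\<^sub>M \<mu>s k)) \<le> (\<integral>\<^sup>+ z. q z \<partial>(\<mu> \<Otimes>\<^sub>M \<mu>)) * ennreal (c k))"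
    "c \<longlonglongrightarrow> 1" "limitin weak_topology \<mu>s \<mu> sequentially"
proof -
  have P: "prob_space \<mu>" and sets\<mu>: "sets \<mu> = sets borel" using \<mu> by (auto simp: prob_measures_def)
  interpret prob_space \<mu> by fact
  interpret m: finite_measure m by fact
  have sm: "sets \<mu> = sets m" using m sets\<mu> by simp
  define r0 where "r0 = RN_deriv m \<mu>"
  have r0[measurable]: "r0 \<in> borel_measurable m" by (simp add: r0_def)
  then have [measurable]: "r0 \<in> borel_measurable \<mu>" using measurable_cong_sets[OF sm refl] by blast
  have \<mu>_eq: "density m r0 = \<mu>" unfolding r0_def by (rule m.density_RN_deriv[OF ac sm])
  have fin: "AE x in \<mu>. r0 x \<noteq> \<infinity>"
    unfolding r0_def
    by (rule absolutely_continuous_AE[OF sm ac m.RN_deriv_finite[OF prob_space_imp_sigma_finite ac sm]]) (rule P)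
  define B where "B k = {x \<in> space \<mu>. r0 x \<le> ennreal (real k)}" for k
  have B[measurable]: "B k \<in> sets \<mu>" for k unfolding B_def by measurable
  have Bm[measurable]: "B k \<in> sets m" for k using B sm by simp
  have UB: "AE x in \<mu>. \<forall>\<^sub>F k in sequentially. x \<in> B k"
    using fin AE_space
  proof eventually_elim
    case (elim x)
    obtain t where t: "r0 x = ennreal t" "0 \<le> t" using elim(1) by (cases "r0 x") auto
    show ?case
      using eventually_ge_at_top[of "nat \<lceil>t\<rceil>"]
    proof eventually_elim
      case (elim k)
      then have "t \<le> real k" by linarith
      then show ?case using t \<open>x \<in> space \<mu>\<close> by (auto simp: B_def intro: ennreal_leI)
    qed
  qed
  have ind_lim: "AE x in \<mu>. (\<lambda>k. indicator (B k) x :: real) \<longlonglongrightarrow> 1"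
    using UB by eventually_elim (auto intro!: tendsto_eventually elim: eventually_mono)
  have lim: "(\<lambda>k. LINT x|\<mu>. indicator (B k) x * g x) \<longlonglongrightarrow> (LINT x|\<mu>. g x)"
    if [measurable]: "g \<in> borel_measurable \<mu>" and C: "\<And>x. \<bar>g x\<bar> \<le> C" for g :: "'a \<Rightarrow> real" and C
  proof (rule integral_dominated_convergence[where w = "\<lambda>_. C"])
    show "AE x in \<mu>. (\<lambda>k. indicator (B k) x * g x) \<longlonglongrightarrow> g x"
      using ind_lim
    proof eventually_elim
      case (elim x)
      from tendsto_mult[OF this tendsto_const[of "g x"]] show ?case by simp
    qed
    have "0 \<le> C" using C[of undefined] by linarith
    then show "AE x in \<mu>. norm (indicator (B k) x * g x) \<le> C" for k
      using C by (intro AE_I2) (auto simp: indicator_def)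
  qed auto
  define b where "b k = measure \<mu> (B k)" for k
  have b: "b \<longlonglongrightarrow> 1"
  proof -
    have "(LINT x|\<mu>. indicator (B k) x * (1::real)) = b k" for k
      by (simp add: b_def)
    then show ?thesis using lim[of "\<lambda>_. 1" 1] by (simp add: prob_space)
  qed
  have b_pos: "\<forall>\<^sub>F k in sequentially. 0 < b k"
    by (rule order_tendstoD(1)[OF b]) simp
  define \<mu>s where "\<mu>s k = uniform_measure \<mu> (B k)" for k
  \<comment> \<open>One factor \<open>1 / b k\<close> for each of the two copies of the conditioned
    measure.\<close>
  define c where "c k = 1 / (b k)\<^sup>2" for k
  have in_P: "\<mu>s k \<in> prob_measures" if "0 < b k" for k
    using that sets\<mu> unfolding \<mu>s_def prob_measures_def b_def
    by (auto intro!: prob_space_uniform_measure simp: emeasure_eq_measure)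
  show ?thesis
  proof (rule that)
    show "c \<longlonglongrightarrow> 1"
      unfolding c_def using tendsto_divide[OF tendsto_const[of 1] tendsto_power[OF b, of 2]] by simp
    show "\<forall>\<^sub>F k in sequentially. \<mu>s k \<in> prob_measures \<and>
       (\<exists>r R. r \<in> borel_measurable m \<and> (\<forall>x. r x \<le> ennreal R) \<and> 1 \<le> R \<and> \<mu>s k = density m r) \<and>
       (\<forall>q\<in>borel_measurable borel. (\<integral>\<^sup>+ z. q z \<partial>(\<mu>s k \<Otimes>\<^sub>M \<mu>s k)) \<le> (\<integral>\<^sup>+ z. q z \<partial>(\<mu> \<Otimes>\<^sub>M \<mu>)) * ennreal (c k))"
      using b_pos
    proof eventually_elim
      case (elim k)
      have eb: "emeasure \<mu> (B k) = ennreal (b k)" by (simp add: emeasure_eq_measure b_def)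
      have q: "(\<integral>\<^sup>+ z. q z \<partial>(\<mu>s k \<Otimes>\<^sub>M \<mu>s k)) \<le> (\<integral>\<^sup>+ z. q z \<partial>(\<mu> \<Otimes>\<^sub>M \<mu>)) * ennreal (c k)"
        if "q \<in> borel_measurable borel" for q :: "'a \<times> 'a \<Rightarrow> ennreal"
      proof -
        have "(\<integral>\<^sup>+ z. q z \<partial>(\<mu>s k \<Otimes>\<^sub>M \<mu>s k)) \<le> (\<integral>\<^sup>+ z. q z \<partial>(\<mu> \<Otimes>\<^sub>M \<mu>)) / ennreal (b k) / ennreal (b k)"
          unfolding \<mu>s_def eb[symmetric]
          using elim by (intro nn_integral_pair_uniform_measure_le P sets\<mu> B that) (simp add: eb)
        also have "\<dots> = (\<integral>\<^sup>+ z. q z \<partial>(\<mu> \<Otimes>\<^sub>M \<mu>)) * ennreal (c k)"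
          using elim by (simp add: divide_ennreal_def inverse_ennreal mult.assoc ennreal_mult[symmetric] c_def
            power2_eq_square inverse_eq_divide)
        finally show ?thesis .
      qed
      define r where "r x = r0 x * (indicator (B k) x / ennreal (b k))" for x
      have rm: "r \<in> borel_measurable m" unfolding r_def by measurable
      have "\<mu>s k = density (density m r0) (\<lambda>x. indicator (B k) x / ennreal (b k))"
        by (simp add: \<mu>s_def uniform_measure_def \<mu>_eq eb)
      also have "\<dots> = density m r"
        unfolding r_def by (rule density_density_eq) measurable
      finally have d: "\<mu>s k = density m r" .
      have rR: "r x \<le> ennreal (max 1 (real k / b k))" for x
      proof (cases "x \<in> B k")
        case True
        then have "r x \<le> ennreal (real k) * (1 / ennreal (b k))"
          unfolding r_def by (intro mult_mono) (auto simp: B_def)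
        also have "\<dots> = ennreal (real k / b k)"
          using elim by (simp add: divide_ennreal_def inverse_ennreal ennreal_mult[symmetric] inverse_eq_divide)
        also have "\<dots> \<le> ennreal (max 1 (real k / b k))" by (intro ennreal_leI) simp
        finally show ?thesis .
      qed (simp add: r_def)
      show ?case
        using in_P[OF elim] q rm rR d
        by (intro conjI ballI exI[of _ r] exI[of _ "max 1 (real k / b k)"]) auto
    qed
    show "limitin weak_topology \<mu>s \<mu> sequentially"
    proof (rule limitin_weak_topologyI[OF \<mu>])
      show "\<forall>\<^sub>F k in sequentially. \<mu>s k \<in> prob_measures"
        using b_pos by eventually_elim (rule in_P)
      fix g :: "'a \<Rightarrow> real" assume g: "continuous_on UNIV g" "bounded (range g)"
      obtain C where C: "\<And>x. \<bar>g x\<bar> \<le> C" using g(2) by (auto simp: bounded_iff)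
      have gm: "g \<in> borel_measurable \<mu>"
        using borel_measurable_continuous_onI[OF g(1)] measurable_cong_sets[OF sets\<mu> refl] by blast
      have "(\<lambda>k. (LINT x|\<mu>. indicator (B k) x * g x) / b k) \<longlonglongrightarrow> (LINT x|\<mu>. g x) / 1"
        by (intro tendsto_divide lim[OF gm C] b) simp
      moreover have "\<forall>\<^sub>F k in sequentially. (LINT x|\<mu>. indicator (B k) x * g x) / b k = (LINT x|\<mu>s k. g x)"
        using b_pos
      proof eventually_elim
        case (elim k)
        then show ?case
          unfolding \<mu>s_def b_def by (subst integral_uniform_measure[OF finite_measure_axioms B _ gm]) auto
      qed
      ultimately show "(\<lambda>k. LINT x|\<mu>s k. g x) \<longlonglongrightarrow> (LINT x|\<mu>. g x)"
        by (simp add: tendsto_cong)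
    qed
  qed
qed

section \<open>The limit\<close>

theorem theorem4p10:
  fixes l :: "'a::polish_space measure"
    and V :: "'a \<Rightarrow> ereal"
    and G :: "'a \<Rightarrow> 'a \<Rightarrow> ereal"
    and f :: "'a measure \<Rightarrow> real"
  assumes l_borel: "sets l = sets borel"
    and V_range: "\<And>x. V x \<noteq> -\<infinity>"
    and V_lsc: "lower_semicontinuous V"
    and G_range: "\<And>x y. G x y \<noteq> -\<infinity>"
    and G_lsc: "lower_semicontinuous (\<lambda>(x, y). G x y)"
    and G_sym: "\<And>x y. G x y = G y x"
    and V_integrable: "(\<integral>\<^sup>+ x. exp_ereal (- V x) \<partial>l) < \<infinity>"
    and bounded_below: "\<exists>c::real. \<forall>x y. ereal c \<le> G x y + V x + V y"
    and confining: "\<forall>C::real. \<exists>K. compact K \<and>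
           (\<forall>x \<in> - K. \<forall>y \<in> - K. ereal C \<le> G x y + V x + V y)"
    and regular: "\<forall>\<mu> \<in> prob_measures. energy G V \<mu> < \<infinity> \<longrightarrow>
           (\<exists>\<mu>s :: nat \<Rightarrow> 'a measure.
              (\<forall>n. \<mu>s n \<in> prob_measures \<and> absolutely_continuous l (\<mu>s n)) \<and>
              limitin weak_topology \<mu>s \<mu> sequentially \<and>
              (\<lambda>n. energy G V (\<mu>s n)) \<longlonglongrightarrow> energy G V \<mu>)"
    and f_bounded: "bounded (f ` prob_measures)"
    and f_continuous: "continuous_map weak_topology euclideanreal f"
  shows "(\<lambda>n. ereal (1 / (real n)\<^sup>2) *
            ln_ennreal (\<integral>\<^sup>+ x. ennreal (exp (- ((real n)\<^sup>2 * f (empirical_measure n x))))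
              \<partial>gibbs_measure l G V n))
         \<longlonglongrightarrow> - (INF \<mu> \<in> prob_measures. ereal (f \<mu>) + energy G V \<mu>)"
proof -
  obtain c0 where c0: "\<And>x y. ereal c0 \<le> G x y + V x + V y" using bounded_below by blast
  \<comment> \<open>The maximum makes d nonnegative, as \<open>ereal_integral_shift\<close>
    requires, while -d remains a lower bound.\<close>
  define d where "d = max 0 (- c0)"
  have d0: "0 \<le> d" by (simp add: d_def)
  have d: "ereal (- d) \<le> G x y + V x + V y" for x y
    by (rule order_trans[OF _ c0]) (simp add: d_def)
  define q where "q = pair_cost G V d"
  have GV: "lower_semicontinuous (\<lambda>(x, y). G x y + V x + V y)"
    by (rule lower_semicontinuous_interaction[OF V_range V_lsc G_range G_lsc])
  have q_open: "open {z. t < q z}" for t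
    unfolding q_def by (rule open_pair_cost[OF GV V_range G_range])
  have qm: "q \<in> borel_measurable borel"
    using q_open by (intro borel_measurableI_greater) (simp add: borel_open)
  have q_sym: "q (x, y) = q (y, x)" for x y
    using G_sym[of x y] by (simp add: q_def pair_cost_def ac_simps)
  have q_confining: "\<exists>K. compact K \<and> (\<forall>x\<in>-K. \<forall>y\<in>-K. ennreal C \<le> q (x, y))" if "0 \<le> C" for C
  proof -
    obtain K where K: "compact K" "\<forall>x\<in>-K. \<forall>y\<in>-K. ereal C \<le> G x y + V x + V y"
      using spec[OF confining, of C] by (elim exE conjE)
    have "ennreal C \<le> q (x, y)" if "x \<in> - K" "y \<in> - K" for x y
    proof -
      have "ereal C + ereal 0 \<le> G x y + V x + V y + ereal d"
        by (rule add_mono) (use K(2) that d0 in auto)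
      from e2ennreal_mono[OF this] show ?thesis
        by (simp add: q_def pair_cost_def)
    qed
    with K(1) show ?thesis by blast
  qed
  define m where "m = density l (\<lambda>x. exp_ereal (- V x))"
  have Vm: "V \<in> borel_measurable l"
    using borel_measurable_lower_semicontinuous[OF V_lsc] measurable_cong_sets[OF l_borel refl] by blast
  then have expVm[measurable]: "(\<lambda>x. exp_ereal (- V x)) \<in> borel_measurable l" by measurable
  have m_borel: "sets m = sets borel" by (simp add: m_def l_borel)
  have fin_m: "finite_measure m"
  proof
    show "emeasure m (space m) \<noteq> \<infinity>"
      using V_integrable by (simp add: m_def emeasure_density cong: nn_integral_cong)
  qed
  interpret m: finite_measure m by (rule fin_m)
  define P where "P n = PiM {1..n} (\<lambda>_. m)" for n :: nat
  define w where "w n = ennreal (exp (d * (real n * (real n - 1) / 2)))" for n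
  have gibbs: "gibbs_measure l G V n = density (P n) (\<lambda>x. w n * exp_neg (total_cost q n x))" if "0 < n" for n
    unfolding P_def m_def w_def q_def
    by (rule gibbs_measure_eq[OF l_borel V_range V_lsc G_range GV V_integrable d that])
  have Tm[measurable]: "total_cost q n \<in> borel_measurable (P n)" for n
    unfolding P_def by (rule measurable_total_cost[OF qm m_borel])
  define F where "F n x = ennreal (exp (- ((real n)\<^sup>2 * f (empirical_measure n x))))" for n and x :: "nat \<Rightarrow> 'a"
  define Z where "Z n = (\<integral>\<^sup>+ x. F n x \<partial>gibbs_measure l G V n)" for n
  define a where "a n = ereal (1 / (real n)\<^sup>2) * ln_ennreal (Z n)" for n
  define I where "I = (INF \<mu> \<in> prob_measures. ereal (f \<mu>) + energy G V \<mu>)"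
  have energy: "energy G V \<mu> = ereal (1/2) * (enn2ereal (\<integral>\<^sup>+ z. q z \<partial>(\<mu> \<Otimes>\<^sub>M \<mu>)) - ereal d)"
    if "\<mu> \<in> prob_measures" for \<mu>
    unfolding q_def by (rule energy_eq[OF that GV d0 d])
  have energy_real: "energy G V \<mu> = ereal ((J - d) / 2)"
    if "\<mu> \<in> prob_measures" "(\<integral>\<^sup>+ z. q z \<partial>(\<mu> \<Otimes>\<^sub>M \<mu>)) = ennreal J" "0 \<le> J" for \<mu> J
    unfolding energy[OF that(1)] that(2) using that(3) by simp
  have energy_finite: "\<exists>J\<ge>0. (\<integral>\<^sup>+ z. q z \<partial>(\<mu> \<Otimes>\<^sub>M \<mu>)) = ennreal J"
    if "\<mu> \<in> prob_measures" "energy G V \<mu> < \<infinity>" for \<mu>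
    using that(2) unfolding energy[OF that(1)]
    by (cases "\<integral>\<^sup>+ z. q z \<partial>(\<mu> \<Otimes>\<^sub>M \<mu>)") auto

  have lower_density: "\<forall>\<^sub>F n in sequentially. ereal (- b) \<le> a n"
    if \<mu>: "\<mu> \<in> prob_measures" "\<mu> = density m r" and r: "r \<in> borel_measurable m" "\<And>x. r x \<le> ennreal R" "1 \<le> R"
      and J: "(\<integral>\<^sup>+ z. q z \<partial>(\<mu> \<Otimes>\<^sub>M \<mu>)) = ennreal J" "0 \<le> J" and b: "f \<mu> + (J - d) / 2 < b"
    for \<mu> r R J b
  proof -
    \<comment> \<open>The gap is split three ways: one e for the oscillation of f on U, one for
      \<open>bounded_density_lower_bound\<close>, and one for the difference between d n(n-1)/2 and
      d n^2/2.\<close>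
    define e where "e = (b - (f \<mu> + (J - d) / 2)) / 3"
    have e: "0 < e" using b by (simp add: e_def)
    have b_eq: "b = f \<mu> + (J - d) / 2 + 3 * e" by (simp add: e_def field_simps)
    define U where "U = {\<mu>' \<in> topspace weak_topology. f \<mu>' \<in> {..<f \<mu> + e}}"
    have U: "openin weak_topology U"
      unfolding U_def by (rule openin_continuous_map_preimage[OF f_continuous]) simp
    have \<mu>U: "\<mu> \<in> U" using \<mu>(1) e by (simp add: U_def)
    have prob\<mu>: "prob_space \<mu>" using \<mu>(1) by (simp add: prob_measures_def)
    have "\<forall>\<^sub>F n in sequentially. d * real n / 2 \<le> (real n)\<^sup>2 * e"
      using e by real_asymp
    with bounded_density_lower_bound[OF fin_m m_borel r \<mu>(2) prob\<mu> qm J U \<mu>U e]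
    show ?thesis
      using eventually_gt_at_top[of 0]
    proof eventually_elim
      case (elim n)
      from elim(1) obtain E where E: "E \<in> sets (P n)" "\<And>x. x \<in> E \<Longrightarrow> empirical_measure n x \<in> U"
        and EQ: "ennreal (exp ((real n)\<^sup>2 * - (J / 2 + e))) \<le> (\<integral>\<^sup>+ x. exp_neg (total_cost q n x) * indicator E x \<partial>P n)"
        unfolding P_def by blast
      let ?k = "ennreal (exp (- ((real n)\<^sup>2 * (f \<mu> + e))))"
      have "exp ((real n)\<^sup>2 * - b) \<le>
          exp (- ((real n)\<^sup>2 * (f \<mu> + e))) * exp (d * (real n * (real n - 1) / 2)) * exp ((real n)\<^sup>2 * - (J / 2 + e))"
        unfolding exp_add[symmetric] exp_le_cancel_iff b_eq using elim(2)
        by (simp add: field_simps power2_eq_square)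
      then have "ennreal (exp ((real n)\<^sup>2 * - b)) \<le> ?k * w n * ennreal (exp ((real n)\<^sup>2 * - (J / 2 + e)))"
        unfolding w_def by (simp add: ennreal_mult[symmetric] ennreal_leI del: exp_le_cancel_iff)
      also have "\<dots> \<le> ?k * w n * (\<integral>\<^sup>+ x. exp_neg (total_cost q n x) * indicator E x \<partial>P n)"
        by (intro mult_left_mono EQ) simp
      also have "\<dots> = (\<integral>\<^sup>+ x. (w n * exp_neg (total_cost q n x)) * (?k * indicator E x) \<partial>P n)"
        using E(1) by (subst nn_integral_cmult[symmetric]) (auto intro!: nn_integral_cong simp: ac_simps)
      also have "\<dots> = (\<integral>\<^sup>+ x. ?k * indicator E x \<partial>gibbs_measure l G V n)"
        unfolding gibbs[OF elim(3)] using E(1) by (subst nn_integral_density) auto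
      also have "\<dots> \<le> Z n"
        unfolding Z_def
      proof (intro nn_integral_mono)
        fix x
        show "?k * indicator E x \<le> F n x"
        proof (cases "x \<in> E")
          case True
          then have "f (empirical_measure n x) \<le> f \<mu> + e" using E(2) by (force simp: U_def)
          then have "(real n)\<^sup>2 * f (empirical_measure n x) \<le> (real n)\<^sup>2 * (f \<mu> + e)"
            by (intro mult_left_mono) auto
          then show ?thesis using True by (simp add: F_def ennreal_leI)
        qed simp
      qed
      finally show ?case
        unfolding a_def using elim(3) by (intro scaled_ln_ge) auto
    qed
  qed

  have lower_ac: "\<forall>\<^sub>F n in sequentially. ereal (- b) \<le> a n"
    if \<mu>: "\<mu> \<in> prob_measures" "absolutely_continuous l \<mu>" and b: "ereal (f \<mu>) + energy G V \<mu> < ereal b" for \<mu> b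
  proof -
    have prob\<mu>: "prob_space \<mu>" and sets\<mu>: "sets \<mu> = sets borel" using \<mu>(1) by (auto simp: prob_measures_def)
    have "energy G V \<mu> < \<infinity>" using b by (cases "energy G V \<mu>") auto
    then obtain J where J: "(\<integral>\<^sup>+ z. q z \<partial>(\<mu> \<Otimes>\<^sub>M \<mu>)) = ennreal J" "0 \<le> J"
      using energy_finite[OF \<mu>(1)] by blast
    have bJ: "f \<mu> + (J - d) / 2 < b" using b unfolding energy_real[OF \<mu>(1) J] by simp
    have V\<mu>: "V \<in> borel_measurable \<mu>"
      using borel_measurable_lower_semicontinuous[OF V_lsc] measurable_cong_sets[OF sets\<mu> refl] by blast
    define A where "A = {x \<in> space \<mu>. V x = \<infinity>}"
    have A: "A \<in> sets \<mu>" unfolding A_def using V\<mu> by measurable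
    \<comment> \<open>On \<open>A \<times> A\<close> the cost is infinite, so finite energy forces
      \<mu> A = 0. This is what allows l to be replaced by m in the absolute continuity.\<close>
    have "top * (emeasure \<mu> A)\<^sup>2 \<le> (\<integral>\<^sup>+ z. q z \<partial>(\<mu> \<Otimes>\<^sub>M \<mu>))"
    proof (rule emeasure_times_le_nn_integral[OF prob\<mu> A])
      fix z assume "z \<in> A \<times> A"
      then show "top \<le> q z"
        using G_range by (cases z) (auto simp: A_def q_def pair_cost_def)
    qed
    then have "emeasure \<mu> A = 0"
      unfolding J(1) by (auto simp: ennreal_top_mult top_unique split: if_splits)
    then have "AE x in \<mu>. V x \<noteq> \<infinity>"
      using A unfolding A_def by (intro AE_I[of _ _ A]) (auto simp: A_def)
    then have ac: "absolutely_continuous m \<mu>"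
      unfolding m_def using sets\<mu> l_borel by (intro absolutely_continuous_density_exp Vm \<mu>(2)) auto
    obtain \<mu>s c where approx: "\<forall>\<^sub>F k in sequentially. \<mu>s k \<in> prob_measures \<and>
       (\<exists>r R. r \<in> borel_measurable m \<and> (\<forall>x. r x \<le> ennreal R) \<and> 1 \<le> R \<and> \<mu>s k = density m r) \<and>
       (\<forall>q\<in>borel_measurable borel. (\<integral>\<^sup>+ z. q z \<partial>(\<mu>s k \<Otimes>\<^sub>M \<mu>s k)) \<le> (\<integral>\<^sup>+ z. q z \<partial>(\<mu> \<Otimes>\<^sub>M \<mu>)) * ennreal (c k))"
      and c: "c \<longlonglongrightarrow> 1" and lim: "limitin weak_topology \<mu>s \<mu> sequentially"
      by (rule bounded_density_approximation[OF fin_m m_borel \<mu>(1) ac])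
    have "(\<lambda>k. f (\<mu>s k)) \<longlonglongrightarrow> f \<mu>"
      using continuous_map_limit[OF f_continuous lim] by (simp add: comp_def)
    then have "(\<lambda>k. f (\<mu>s k) + (J * c k - d) / 2) \<longlonglongrightarrow> f \<mu> + (J * 1 - d) / 2"
      by (intro tendsto_intros c) auto
    then have "\<forall>\<^sub>F k in sequentially. f (\<mu>s k) + (J * c k - d) / 2 < b"
      by (rule order_tendstoD(2)) (use bJ in simp)
    moreover have "\<forall>\<^sub>F k in sequentially. 0 < c k" by (rule order_tendstoD(1)[OF c]) simp
    \<comment> \<open>A single approximating measure is enough. Its energy integral
      \<open>J'\<close> is finite because it is at most \<open>J * c k\<close>.\<close>
    ultimately have "\<forall>\<^sub>F k in sequentially. \<exists>\<mu>' r R J'. \<mu>' \<in> prob_measures \<and> \<mu>' = density m r \<and>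
        r \<in> borel_measurable m \<and> (\<forall>x. r x \<le> ennreal R) \<and> 1 \<le> R \<and>
        (\<integral>\<^sup>+ z. q z \<partial>(\<mu>' \<Otimes>\<^sub>M \<mu>')) = ennreal J' \<and> 0 \<le> J' \<and> f \<mu>' + (J' - d) / 2 < b"
      using approx
    proof eventually_elim
      case (elim k)
      then obtain r R where r: "r \<in> borel_measurable m" "\<forall>x. r x \<le> ennreal R" "1 \<le> R" "\<mu>s k = density m r" by blast
      have "(\<integral>\<^sup>+ z. q z \<partial>(\<mu>s k \<Otimes>\<^sub>M \<mu>s k)) \<le> ennreal J * ennreal (c k)"
        using elim(3) qm J(1) by auto
      then have le: "(\<integral>\<^sup>+ z. q z \<partial>(\<mu>s k \<Otimes>\<^sub>M \<mu>s k)) \<le> ennreal (J * c k)"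
        using J(2) elim(2) by (simp add: ennreal_mult)
      then obtain J' where J': "(\<integral>\<^sup>+ z. q z \<partial>(\<mu>s k \<Otimes>\<^sub>M \<mu>s k)) = ennreal J'" "0 \<le> J'"
        by (cases "\<integral>\<^sup>+ z. q z \<partial>(\<mu>s k \<Otimes>\<^sub>M \<mu>s k)") (auto simp: top_unique)
      have "J' \<le> J * c k"
        using le J' J(2) elim(2) by (simp add: ennreal_le_iff)
      then have "f (\<mu>s k) + (J' - d) / 2 < b" using elim(1) by (simp add: field_simps)
      then show ?case using elim(3) r J' by blast
    qed
    then obtain \<mu>' r R J' where "\<mu>' \<in> prob_measures" "\<mu>' = density m r"
        "r \<in> borel_measurable m" "\<forall>x. r x \<le> ennreal R" "1 \<le> R"
        "(\<integral>\<^sup>+ z. q z \<partial>(\<mu>' \<Otimes>\<^sub>M \<mu>')) = ennreal J'" "0 \<le> J'" "f \<mu>' + (J' - d) / 2 < b"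
      using eventually_happens by fastforce
    then show ?thesis by (intro lower_density[of \<mu>' r R J']) auto
  qed

  have lower: "\<forall>\<^sub>F n in sequentially. ereal (- b) \<le> a n"
    if \<mu>: "\<mu> \<in> prob_measures" and b: "ereal (f \<mu>) + energy G V \<mu> < ereal b" for \<mu> b
  proof -
    have fin: "energy G V \<mu> < \<infinity>" using b by (cases "energy G V \<mu>") auto
    obtain J where J: "(\<integral>\<^sup>+ z. q z \<partial>(\<mu> \<Otimes>\<^sub>M \<mu>)) = ennreal J" "0 \<le> J"
      using energy_finite[OF \<mu> fin] by blast
    obtain \<mu>s where \<mu>s: "\<And>n. \<mu>s n \<in> prob_measures" "\<And>n. absolutely_continuous l (\<mu>s n)"
      and lim: "limitin weak_topology \<mu>s \<mu> sequentially"
      and elim: "(\<lambda>n. energy G V (\<mu>s n)) \<longlonglongrightarrow> energy G V \<mu>"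
      using regular \<mu> fin by metis
    have "(\<lambda>n. ereal (f (\<mu>s n))) \<longlonglongrightarrow> ereal (f \<mu>)"
      using continuous_map_limit[OF f_continuous lim] by (simp add: comp_def)
    then have "(\<lambda>n. ereal (f (\<mu>s n)) + energy G V (\<mu>s n)) \<longlonglongrightarrow> ereal (f \<mu>) + energy G V \<mu>"
      \<comment> \<open>The limits are finite, so addition of extended reals is continuous
        there.\<close>
      by (intro tendsto_add_ereal elim) (simp_all add: energy_real[OF \<mu> J])
    then have "\<forall>\<^sub>F n in sequentially. ereal (f (\<mu>s n)) + energy G V (\<mu>s n) < ereal b"
      by (rule order_tendstoD(2)) (rule b)
    then obtain k where "ereal (f (\<mu>s k)) + energy G V (\<mu>s k) < ereal b"
      by (auto simp: eventually_sequentially)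
    then show ?thesis by (intro lower_ac[OF \<mu>s])
  qed

  obtain B where B: "\<And>\<mu>. \<mu> \<in> prob_measures \<Longrightarrow> \<bar>f \<mu>\<bar> \<le> B"
    using f_bounded by (auto simp: bounded_iff)
  have upper: "\<forall>\<^sub>F n in sequentially. a n \<le> ereal t'" if t: "- I < ereal t" "t < t'" for t t'
  proof -
    \<comment> \<open>As W = (J - d) / 2, the inequality f + J / 2 \<le> s says f + W \<le> -t.
      Conversely, the prefactor \<open>w n\<close> contributes about d n^2 / 2 to the exponent and
      turns -s into t.\<close>
    define s where "s = - t + d / 2"
    \<comment> \<open>Otherwise a cluster measure \<nu> would satisfy f \<nu> + W \<nu> \<le> -t,
      although -t < I. Only finite costs T matter, since configurations of infinite cost have weight
      0.\<close>
    have "\<not> (\<exists>\<^sub>F n in sequentially. \<exists>x T. 0 \<le> T \<and> total_cost q n x = ennreal T \<and>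
        f (empirical_measure n x) + T / (real n)\<^sup>2 \<le> s)"
    proof
      assume freq: "\<exists>\<^sub>F n in sequentially. \<exists>x T. 0 \<le> T \<and> total_cost q n x = ennreal T \<and>
        f (empirical_measure n x) + T / (real n)\<^sup>2 \<le> s"
      obtain \<nu> where \<nu>: "\<nu> \<in> prob_measures" "f \<nu> \<le> s"
        "(\<integral>\<^sup>+ z. q z \<partial>(\<nu> \<Otimes>\<^sub>M \<nu>)) \<le> ennreal (2 * (s - f \<nu>))"
        by (rule empirical_energy_cluster[OF q_open q_sym q_confining f_continuous B freq])
      then obtain J where J: "(\<integral>\<^sup>+ z. q z \<partial>(\<nu> \<Otimes>\<^sub>M \<nu>)) = ennreal J" "0 \<le> J"
        by (cases "\<integral>\<^sup>+ z. q z \<partial>(\<nu> \<Otimes>\<^sub>M \<nu>)") (auto simp: top_unique)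
      have "J \<le> 2 * (s - f \<nu>)" using \<nu>(2,3) J by (simp add: ennreal_le_iff)
      then have "ereal (f \<nu>) + energy G V \<nu> \<le> ereal (- t)"
        unfolding energy_real[OF \<nu>(1) J] by (simp add: s_def field_simps)
      moreover have "I \<le> ereal (f \<nu>) + energy G V \<nu>"
        unfolding I_def by (rule INF_lower[OF \<nu>(1)])
      ultimately have "I \<le> ereal (- t)" by (rule order_trans[rotated])
      then have "ereal t \<le> - I" by (cases I) auto
      with t(1) show False by simp
    qed
    then have ev: "\<forall>\<^sub>F n in sequentially. \<forall>x T. 0 \<le> T \<longrightarrow> total_cost q n x = ennreal T \<longrightarrow>
        s < f (empirical_measure n x) + T / (real n)\<^sup>2"
      unfolding not_frequently by (rule eventually_mono) (meson not_le)
    \<comment> \<open>The mass of m may be 0, so k is the mass itself instead of its logarithm. The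
      slack t' - t then absorbs the factor exp (n k).\<close>
    obtain k where k: "measure m (space m) \<le> exp k" "0 \<le> k"
    proof -
      have "measure m (space m) \<le> exp (measure m (space m))"
        using exp_ge_add_one_self[of "measure m (space m)"] by linarith
      then show ?thesis using that[of "measure m (space m)"] by simp
    qed
    have "\<forall>\<^sub>F n in sequentially. real n * k \<le> (real n)\<^sup>2 * (t' - t)"
      using t(2) by real_asymp
    with ev show ?thesis
      using eventually_gt_at_top[of 0]
    proof eventually_elim
      case (elim n)
      \<comment> \<open>The exponential on [0, \<infinity>], with value \<open>top\<close> at
        \<open>top\<close>. It provides a measurable majorant of \<open>F n\<close>, trivial where
        the cost is infinite; there \<open>exp_neg\<close> is 0, and 0 times \<open>top\<close> is
        0, so the product stays at most 1 and the density can be integrated.\<close>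
      define \<kappa> where "\<kappa> z = (if z = top then top else ennreal (exp (enn2real z)))" for z
      have [measurable]: "\<kappa> \<in> borel_measurable borel" unfolding \<kappa>_def by measurable
      have \<kappa>: "exp_neg z * \<kappa> z \<le> 1" for z
        by (cases z) (auto simp: \<kappa>_def ennreal_mult[symmetric] exp_minus field_simps simp flip: exp_add)
      let ?u = "ennreal (exp (- ((real n)\<^sup>2 * s)))"
      have FK: "F n x \<le> ?u * \<kappa> (total_cost q n x)" for x
      proof (cases "total_cost q n x")
        case (real T)
        have "s < f (empirical_measure n x) + T / (real n)\<^sup>2" using elim(1) real by blast
        then have "(real n)\<^sup>2 * s \<le> (real n)\<^sup>2 * (f (empirical_measure n x) + T / (real n)\<^sup>2)"
          by (intro mult_left_mono) auto
        then have "- ((real n)\<^sup>2 * f (empirical_measure n x)) \<le> - ((real n)\<^sup>2 * s) + T"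
          using elim(3) by (simp add: algebra_simps)
        then have "F n x \<le> ennreal (exp (- ((real n)\<^sup>2 * s) + T))"
          unfolding F_def by (intro ennreal_leI) simp
        also have "\<dots> = ?u * \<kappa> (total_cost q n x)"
          using real by (simp add: \<kappa>_def ennreal_mult[symmetric] exp_add[symmetric])
        finally show ?thesis .
      qed (simp add: \<kappa>_def ennreal_mult_top)
      have "Z n \<le> (\<integral>\<^sup>+ x. ?u * \<kappa> (total_cost q n x) \<partial>gibbs_measure l G V n)"
        unfolding Z_def by (intro nn_integral_mono FK)
      also have "\<dots> = (\<integral>\<^sup>+ x. (w n * exp_neg (total_cost q n x)) * (?u * \<kappa> (total_cost q n x)) \<partial>P n)"
        unfolding gibbs[OF elim(3)] by (rule nn_integral_density) measurable
      also have "\<dots> = (\<integral>\<^sup>+ x. (w n * ?u) * (exp_neg (total_cost q n x) * \<kappa> (total_cost q n x)) \<partial>P n)"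
        by (intro nn_integral_cong) (simp add: ac_simps)
      also have "\<dots> \<le> (\<integral>\<^sup>+ x. (w n * ?u) * 1 \<partial>P n)"
        by (intro nn_integral_mono mult_left_mono \<kappa>) simp
      also have "\<dots> = w n * ?u * emeasure (P n) (space (P n))"
        by simp
      also have "emeasure (P n) (space (P n)) = (\<Prod>i=1..n. emeasure m (space m))"
        unfolding P_def space_PiM using elim(3) by (intro emeasure_PiM_boxes) auto
      also have "\<dots> \<le> ennreal (exp k) ^ card {1..n}"
        using k(1) by (intro prod_le_power_ennreal) (simp add: m.emeasure_eq_measure ennreal_leI)
      also have "\<dots> = ennreal (exp (real n * k))"
        by (simp add: ennreal_power exp_of_nat_mult)
      finally have "Z n \<le> w n * ?u * ennreal (exp (real n * k))"
        by (simp add: mult_left_mono)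
      also have "\<dots> = ennreal (exp (d * (real n * (real n - 1) / 2) + - ((real n)\<^sup>2 * s) + real n * k))"
        by (simp only: w_def exp_add ennreal_mult exp_ge_zero mult_nonneg_nonneg)
      also have "\<dots> \<le> ennreal (exp ((real n)\<^sup>2 * t'))"
      proof (intro ennreal_leI, subst exp_le_cancel_iff)
        have "0 \<le> d * real n" using d0 by simp
        then show "d * (real n * (real n - 1) / 2) + - ((real n)\<^sup>2 * s) + real n * k \<le> (real n)\<^sup>2 * t'"
          using elim(2) by (simp add: s_def field_simps power2_eq_square)
      qed
      finally show ?case
        unfolding a_def using elim(3) by (intro scaled_ln_le) auto
    qed
  qed

  \<comment> \<open>Bounds by the order, rather than by a distance, include the case I =
    \<infinity>, where the limit is -\<infinity> and only the upper half has content.\<close>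
  have "a \<longlonglongrightarrow> - I"
  proof (rule order_tendstoI)
    fix y assume "y < - I"
    then obtain b where b: "y < ereal b" "ereal b < - I" using ereal_dense2 by blast
    then have "I < ereal (- b)" by (cases I) auto
    then obtain \<mu> where "\<mu> \<in> prob_measures" "ereal (f \<mu>) + energy G V \<mu> < ereal (- b)"
      unfolding I_def INF_less_iff by blast
    from lower[OF this] show "\<forall>\<^sub>F n in sequentially. y < a n"
      by (rule eventually_mono) (use b(1) in \<open>auto intro: less_le_trans\<close>)
  next
    fix y assume "- I < y"
    then obtain t' where t': "- I < ereal t'" "ereal t' < y" using ereal_dense2 by blast
    obtain t where t: "- I < ereal t" "ereal t < ereal t'" using ereal_dense2[OF t'(1)] by blast
    have "\<forall>\<^sub>F n in sequentially. a n \<le> ereal t'"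
      by (rule upper[OF t(1)]) (use t(2) in simp)
    then show "\<forall>\<^sub>F n in sequentially. a n < y"
      by (rule eventually_mono) (use t'(2) in \<open>auto intro: le_less_trans\<close>)
  qed
  then show ?thesis
    unfolding a_def Z_def F_def I_def .
qed

end
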